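(* There exists a numerical constant $c>0$ such that for any $\sigma>0$, any $\Delta>0$, any integer $d\geq 1$, any $\theta>0$, any $\delta\in(0,1/12)$, and any integers $N,K$ with $N\geq 2K\geq 4$ such that $\mathcal{E}(\Delta,\theta,\sigma,N,K,d)\neq\emptyset$, $$T^*(\delta,\mathcal{E}(\Delta,\theta,\sigma,N,K,d))\;\geq\; cN+c\,\frac{\sigma^2}{\Delta^2}\left[N\log\left(\frac{N}{\delta}\right)+\sqrt{dKN\log\left(\frac{N}{\delta}\right)}\right].$$
   Context: Active clustering problem. There are $N$ arms indexed by $[N]$; arm $a$ has an unknown distribution $\nu_a$ on $\mathbb{R}^d$ with mean $\mu_a$. An environment is $\nu=(\nu_a)_{a\in[N]}$ satisfying: (i) ($\sigma$-subGaussian) for each arm $a$ there is a symmetric $d\times d$ matrix $\Sigma_a$ with $\|\Sigma_a\|_{op}\leq\sigma^2$ such that, for $X\sim\nu_a$, the coordinates $E_i$ of $E=\Sigma_a^{-1/2}(X-\mu_a)$ are independent and satisfy $\mathbb{E}[\exp(tE_i)]\leq\exp(t^2/2)$ for all $t\in\mathbb{R}$; (ii) (hidden partition) there is a partition $G^*=\{G^*_1,\dots,G^*_K\}$ of $[N]$ into $K$ nonempty groups such that $\mu_a=\mu_b$ iff $a,b$ lie in the same group; $\mu(k)$ denotes the common mean of $G^*_k$. Define $\Delta_*=\min_{k\neq k'}\|\mu(k)-\mu(k')\|$ (Euclidean norm) and $\theta_*=\min_k |G^*_k|/N$. $\mathcal{E}(\Delta,\theta,\sigma,N,K,d)$ is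 the set of such environments with $N$ arms, $K$ groups, $d$-dimensional observations, parameter $\sigma$, and $\Delta_*\geq\Delta$, $\theta_*\geq\theta$. A strategy interacts sequentially: at each time $t$ it chooses an arm $A_t$ based on past arms/observations (and possibly independent external randomness), then observes $X_t\sim\nu_{A_t}$ independently given the past; it stops at a stopping time $\tau$ (the budget) with respect to the filtration $\mathcal{F}_t=\sigma(A_1,X_1,\dots,A_t,X_t)$ and outputs an $\mathcal{F}_\tau$-measurable partition $\hat G$ of $[N]$ into $K$ groups. Two partitions are equivalent, $G\sim G'$, if they coincide up to relabelling of the groups. A strategy $\pi$ is $\delta$-PAC on a set of environments $\mathcal{E}$ if $\mathbb{P}_{\pi,\nu}(\hat G\sim G^* )\geq 1-\delta$ for every $\nu\in\mathcal{E}$. The optimal worst-case budget is $T^*(\delta,\mathcal{E})=\inf_{\pi\ \delta\text{-PAC on }\mathcal{E}}\ \sup_{\nu\in\mathcal{E}}\mathbb{E}_{\pi,\nu}[\tau]$. *)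

theory Defs
  imports "HOL-Probability.Probability"
begin

type_synonym obs = "nat \<Rightarrow> real"   \<comment> \<open>a point of R^d: coordinates 0..d-1\<close>
type_synonym hist = "nat \<Rightarrow> nat \<times> obs"  \<comment> \<open>history: time s < t \<mapsto> (A_s, X_s)\<close>

definition obs_space :: "nat \<Rightarrow> obs measure" where
  "obs_space d = (\<Pi>\<^sub>M i\<in>{..<d}. (borel :: real measure))"

definition vnorm :: "nat \<Rightarrow> obs \<Rightarrow> real" where
  "vnorm d x = sqrt (\<Sum>i<d. (x i)^2)"

definition mat_vec :: "nat \<Rightarrow> (nat \<Rightarrow> nat \<Rightarrow> real) \<Rightarrow> obs \<Rightarrow> obs" where
  "mat_vec d M x = (\<lambda>i. \<Sum>j<d. M i j * x j)"

definition sym_mat :: "nat \<Rightarrow> (nat \<Rightarrow> nat \<Rightarrow> real) \<Rightarrow> bool" where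
  "sym_mat d M \<longleftrightarrow> (\<forall>i<d. \<forall>j<d. M i j = M j i)"

definition pos_def_mat :: "nat \<Rightarrow> (nat \<Rightarrow> nat \<Rightarrow> real) \<Rightarrow> bool" where
  "pos_def_mat d M \<longleftrightarrow> (\<forall>x. (\<exists>i<d. x i \<noteq> 0) \<longrightarrow> (\<Sum>i<d. \<Sum>j<d. x i * M i j * x j) > 0)"

definition op_norm :: "nat \<Rightarrow> (nat \<Rightarrow> nat \<Rightarrow> real) \<Rightarrow> real" where
  "op_norm d M = Sup {vnorm d (mat_vec d M x) | x. vnorm d x \<le> 1}"

definition is_inv_sqrt :: "nat \<Rightarrow> (nat \<Rightarrow> nat \<Rightarrow> real) \<Rightarrow> (nat \<Rightarrow> nat \<Rightarrow> real) \<Rightarrow> bool" where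
  "is_inv_sqrt d Sig B \<longleftrightarrow> sym_mat d B \<and> pos_def_mat d B \<and>
     (\<forall>i<d. \<forall>k<d. (\<Sum>j<d. \<Sum>l<d. B i j * B j l * Sig l k) = (if i = k then 1 else 0))"

definition mean :: "nat \<Rightarrow> obs measure \<Rightarrow> obs" where
  "mean d P = (\<lambda>i\<in>{..<d}. \<integral>x. x i \<partial>P)"

definition subgaussian_arm :: "real \<Rightarrow> nat \<Rightarrow> obs measure \<Rightarrow> bool" where
  "subgaussian_arm \<sigma> d P \<longleftrightarrow> (\<forall>i<d. integrable P (\<lambda>x. x i)) \<and>
     (\<exists>Sig B. sym_mat d Sig \<and> op_norm d Sig \<le> \<sigma>^2 \<and> is_inv_sqrt d Sig B \<and>
        (let E = (\<lambda>i x. \<Sum>j<d. B i j * (x j - mean d P j)) in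
           prob_space.indep_vars P (\<lambda>_. borel) E {..<d} \<and>
           (\<forall>i<d. \<forall>t::real. integrable P (\<lambda>x. exp (t * E i x)) \<and>
                (\<integral>x. exp (t * E i x) \<partial>P) \<le> exp (t^2 / 2))))"

definition is_partition :: "nat \<Rightarrow> nat \<Rightarrow> nat set set \<Rightarrow> bool" where
  "is_partition N K G \<longleftrightarrow> card G = K \<and> (\<forall>g\<in>G. g \<noteq> {}) \<and> \<Union>G = {..<N} \<and>
     (\<forall>g\<in>G. \<forall>g'\<in>G. g \<noteq> g' \<longrightarrow> g \<inter> g' = {})"

definition hidden_partition :: "nat \<Rightarrow> nat \<Rightarrow> nat \<Rightarrow> (nat \<Rightarrow> obs measure) \<Rightarrow> nat set set \<Rightarrow> bool" where
  "hidden_partition N K d \<nu> G \<longleftrightarrow> is_partition N K G \<and>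
     (\<forall>a<N. \<forall>b<N. mean d (\<nu> a) = mean d (\<nu> b) \<longleftrightarrow> (\<exists>g\<in>G. a \<in> g \<and> b \<in> g))"

definition true_partition :: "nat \<Rightarrow> nat \<Rightarrow> nat \<Rightarrow> (nat \<Rightarrow> obs measure) \<Rightarrow> nat set set" where
  "true_partition N K d \<nu> = (THE G. hidden_partition N K d \<nu> G)"

definition group_mean :: "nat \<Rightarrow> (nat \<Rightarrow> obs measure) \<Rightarrow> nat set \<Rightarrow> obs" where
  "group_mean d \<nu> g = mean d (\<nu> (SOME a. a \<in> g))"

definition Delta_star :: "nat \<Rightarrow> nat \<Rightarrow> nat \<Rightarrow> (nat \<Rightarrow> obs measure) \<Rightarrow> real" where
  "Delta_star N K d \<nu> = Min {vnorm d (\<lambda>i. group_mean d \<nu> g i - group_mean d \<nu> g' i) | g g'.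
       g \<in> true_partition N K d \<nu> \<and> g' \<in> true_partition N K d \<nu> \<and> g \<noteq> g'}"

definition theta_star :: "nat \<Rightarrow> nat \<Rightarrow> nat \<Rightarrow> (nat \<Rightarrow> obs measure) \<Rightarrow> real" where
  "theta_star N K d \<nu> = real (Min (card ` true_partition N K d \<nu>)) / real N"

definition envs :: "real \<Rightarrow> real \<Rightarrow> real \<Rightarrow> nat \<Rightarrow> nat \<Rightarrow> nat \<Rightarrow> (nat \<Rightarrow> obs measure) set" where
  "envs \<Delta> \<theta> \<sigma> N K d = {\<nu>.
     (\<forall>a<N. prob_space (\<nu> a) \<and> sets (\<nu> a) = sets (obs_space d) \<and> subgaussian_arm \<sigma> d (\<nu> a)) \<and>
     (\<exists>G. hidden_partition N K d \<nu> G) \<and>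
     Delta_star N K d \<nu> \<ge> \<Delta> \<and> theta_star N K d \<nu> \<ge> \<theta>}"

definition hist_space :: "nat \<Rightarrow> nat \<Rightarrow> nat \<Rightarrow> hist measure" where
  "hist_space N d t = (\<Pi>\<^sub>M s\<in>{..<t}. count_space {..<N} \<Otimes>\<^sub>M obs_space d)"

text \<open>A strategy: a law of external randomness U (real-valued), a sampling rule
  A_t = sample_rule t U (history up to t), a stopping rule and an output rule, both
  functions of the observed history only (stopping time / F_tau-measurable output).\<close>
record strategy =
  ext_rand :: "real measure"
  sample_rule :: "nat \<Rightarrow> real \<Rightarrow> hist \<Rightarrow> nat"
  stop_rule :: "nat \<Rightarrow> hist \<Rightarrow> bool"
  out_rule :: "nat \<Rightarrow> hist \<Rightarrow> nat set set"

definition valid_strategy :: "nat \<Rightarrow> nat \<Rightarrow> nat \<Rightarrow> strategy \<Rightarrow> bool" where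
  "valid_strategy N K d S \<longleftrightarrow> prob_space (ext_rand S) \<and> sets (ext_rand S) = sets (borel :: real measure) \<and>
     (\<forall>t. (\<lambda>(u, h). sample_rule S t u h) \<in> (borel \<Otimes>\<^sub>M hist_space N d t) \<rightarrow>\<^sub>M count_space {..<N}) \<and>
     (\<forall>t. {h \<in> space (hist_space N d t). stop_rule S t h} \<in> sets (hist_space N d t)) \<and>
     (\<forall>t G. {h \<in> space (hist_space N d t). out_rule S t h = G} \<in> sets (hist_space N d t)) \<and>
     (\<forall>t h. is_partition N K (out_rule S t h))"

text \<open>Interaction, realised on the table model: Y (a, n) is the (n+1)-th sample of arm a.\<close>
fun traj :: "strategy \<Rightarrow> real \<Rightarrow> (nat \<times> nat \<Rightarrow> obs) \<Rightarrow> nat \<Rightarrow> hist" where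
  "traj S u Y 0 = (\<lambda>_. undefined)"
| "traj S u Y (Suc t) =
     (let h = traj S u Y t; a = sample_rule S t u h; n = card {s. s < t \<and> fst (h s) = a}
      in h(t := (a, Y (a, n))))"

definition stop_time :: "strategy \<Rightarrow> real \<Rightarrow> (nat \<times> nat \<Rightarrow> obs) \<Rightarrow> enat" where
  "stop_time S u Y = (if \<exists>t. stop_rule S t (traj S u Y t)
                      then enat (LEAST t. stop_rule S t (traj S u Y t)) else \<infinity>)"

definition run_space :: "strategy \<Rightarrow> nat \<Rightarrow> (nat \<Rightarrow> obs measure) \<Rightarrow> (real \<times> (nat \<times> nat \<Rightarrow> obs)) measure" where
  "run_space S N \<nu> = ext_rand S \<Otimes>\<^sub>M (\<Pi>\<^sub>M p\<in>{..<N} \<times> UNIV. \<nu> (fst p))"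

definition expected_budget :: "strategy \<Rightarrow> nat \<Rightarrow> (nat \<Rightarrow> obs measure) \<Rightarrow> ennreal" where
  "expected_budget S N \<nu> = (\<integral>\<^sup>+ \<omega>. ennreal_of_enat (stop_time S (fst \<omega>) (snd \<omega>)) \<partial>run_space S N \<nu>)"

definition success_prob :: "strategy \<Rightarrow> nat \<Rightarrow> nat \<Rightarrow> nat \<Rightarrow> (nat \<Rightarrow> obs measure) \<Rightarrow> real" where
  "success_prob S N K d \<nu> = measure (run_space S N \<nu>)
     {\<omega> \<in> space (run_space S N \<nu>). \<exists>t. stop_time S (fst \<omega>) (snd \<omega>) = enat t \<and>
          out_rule S t (traj S (fst \<omega>) (snd \<omega>) t) = true_partition N K d \<nu>}"

definition delta_PAC :: "real \<Rightarrow> nat \<Rightarrow> nat \<Rightarrow> nat \<Rightarrow> (nat \<Rightarrow> obs measure) set \<Rightarrow> strategy \<Rightarrow> bool" where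
  "delta_PAC \<delta> N K d E S \<longleftrightarrow> valid_strategy N K d S \<and> (\<forall>\<nu>\<in>E. success_prob S N K d \<nu> \<ge> 1 - \<delta>)"

definition T_star :: "real \<Rightarrow> nat \<Rightarrow> nat \<Rightarrow> nat \<Rightarrow> (nat \<Rightarrow> obs measure) set \<Rightarrow> ennreal" where
  "T_star \<delta> N K d E = (INF S \<in> {S. delta_PAC \<delta> N K d E S}. SUP \<nu>\<in>E. expected_budget S N \<nu>)"

end

theory Submission
  imports Defs
begin

text \<open>
  The hard environments are Gaussian. The groups come in pairs (blocks) with centres \<open>b \<plusminus> h\<close>, where \<open>h\<close> is a random vertex
  of a cube with \<open>2 |h| = \<Delta>\<close>, and the arms of a block are matched in pairs of opposite signs. Swapping one pair keeps all
  group sizes and changes the partition. The correct answers for the swapped environments are distinct, so on average over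
  the \<open>P \<ge> N / 9\<close> possible swaps the strategy answers with the swapped partition with probability at most \<open>\<delta> / P\<close>,
  whereas it must do so with probability \<open>1 - \<delta>\<close> once the swap has taken place.

  If the expected budget is \<open>T\<close>, Markov's inequality, averaged over the swaps, allows us to assume that the pair is
  pulled at most \<open>r = 8T / P\<close> times and its block at most \<open>R = 8T / (K div 2)\<close> times. Averaged over \<open>h\<close>, the two likelihoods
  are products over the coordinates of \<open>cosh (W \<plusminus> U)\<close>, with \<open>U\<close> the sum over the pair and \<open>W\<close> the sum over the rest of
  the block. The square of the first divided by the second is dominated by a martingale of the pure noise model, and optional
  stopping bounds the chi-square divergence in spite of the adaptive sampling. With \<open>\<eta>\<^sup>2 = \<Delta>\<^sup>2 / (4 d \<sigma>\<^sup>2)\<close> this gives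
  \<open>P / (4 \<delta>) \<le> exp (8 d \<eta>\<^sup>2 r)\<close> and \<open>P / (4 \<delta>) \<le> exp (d (exp (4 \<eta>\<^sup>2 R) - 1) (exp (4 \<eta>\<^sup>2 r) - 1))\<close>. The first inequality
  forces \<open>r \<ge> 1\<close>, which is the term \<open>N\<close>, and yields the term \<open>N log (N / \<delta>)\<close>; the second one yields the square root term.
\<close>

section \<open>Freshness of the observed sample\<close>

text \<open>The obstacle is that the numbers of pulls depend on the data, so the divergence of two
  mixtures cannot be computed for fixed sample sizes. It is replaced by a process that bounds the
  squared likelihood ratio for all counts up to deterministic limits and is killed beyond them.
  Killing keeps it a nonnegative supermartingale, and its initial value plays the role of the
  divergence.

  The unknown direction is what creates the square root. Were the centres known, only the pulls of
  the pair would count. As they are not, the pair must be compared with the rest of its block, which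
  is noisy too, so the divergence is governed by the product of \<open>R\<close> and
  \<open>r\<close>. That product is of order T^2 / (K N), whence the geometric mean of d K and N log
  (N / \<delta>). For large \<open>R\<close> the second inequality is useless, but then T already
  exceeds a multiple of d K \<sigma>^2 / \<Delta>^2, and the first inequality suffices.

  Likelihoods are compared by a linear inequality with one free constant, which can be summed over
  all environments. The averaging over swaps gains the factor \<open>P\<close> because the wrong
  answers share a mass of at most \<delta>.\<close>

definition arm_laws :: "nat \<Rightarrow> nat \<Rightarrow> (nat \<Rightarrow> obs measure) \<Rightarrow> bool" where
  "arm_laws N d \<nu> \<longleftrightarrow> (\<forall>a<N. prob_space (\<nu> a) \<and> sets (\<nu> a) = sets (obs_space d))"

definition table :: "nat \<Rightarrow> (nat \<Rightarrow> obs measure) \<Rightarrow> (nat \<times> nat \<Rightarrow> obs) measure" where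
  "table N \<nu> = (\<Pi>\<^sub>M p\<in>{..<N} \<times> UNIV. \<nu> (fst p))"

text \<open>The table entry read at time \<open>t\<close>. It is always a fresh one, so resampling that entry changes neither the past
  nor the choice of the cell; this gives the conditional law of the next observation.\<close>

definition cell :: "strategy \<Rightarrow> real \<Rightarrow> nat \<Rightarrow> hist \<Rightarrow> nat \<times> nat" where
  "cell S u t h = (sample_rule S t u h, card {s. s < t \<and> fst (h s) = sample_rule S t u h})"

lemma traj_Suc_cell:
  "traj S u Y (Suc t) = (traj S u Y t)
     (t := (sample_rule S t u (traj S u Y t), Y (cell S u t (traj S u Y t))))"
  by (simp add: cell_def Let_def)

declare traj.simps(2)[simp del]

lemma traj_outside: "s \<ge> t \<Longrightarrow> traj S u Y t s = undefined"
  by (induction t) (auto simp: traj_Suc_cell)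

lemma traj_restrict: "s \<le> t \<Longrightarrow> restrict (traj S u Y t) {..<s} = traj S u Y s"
proof (induction t)
  case (Suc t)
  show ?case
  proof (cases "s = Suc t")
    case True
    then show ?thesis by (auto simp: fun_eq_iff restrict_def traj_outside)
  next
    case False
    then have "s \<le> t" using Suc.prems by simp
    then have "restrict (traj S u Y (Suc t)) {..<s} = restrict (traj S u Y t) {..<s}"
      by (auto simp: fun_eq_iff restrict_def traj_Suc_cell)
    then show ?thesis using Suc.IH \<open>s \<le> t\<close> by simp
  qed
qed auto

lemma traj_nth: "r < s \<Longrightarrow> s \<le> t \<Longrightarrow> traj S u Y t r = traj S u Y s r"
  by (metis lessThan_iff restrict_apply' traj_restrict)

text \<open>Suppose that an earlier time s < t had read the same cell. Then the same arm was pulled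
  at time s, so the number of its previous pulls is strictly larger at time t than at time s, and
  the second index of the cell would differ.\<close>

lemma traj_fun_upd_fresh:
  assumes "cell S u t (traj S u Y t) = p" "s \<le> t"
  shows "traj S u (Y(p := x)) s = traj S u Y s"
  using assms(2)
proof (induction s)
  case (Suc s)
  have IH: "traj S u (Y(p := x)) s = traj S u Y s"
    using Suc.IH[OF Suc_leD[OF Suc.prems]] .
  define a where "a = sample_rule S s u (traj S u Y s)"
  have a: "fst (traj S u Y t s) = a"
    using traj_nth[of s "Suc s" t S u Y] Suc.prems by (simp add: traj_Suc_cell a_def)
  have "cell S u s (traj S u Y s) \<noteq> p"
  proof
    assume eq: "cell S u s (traj S u Y s) = p"
    have "a = sample_rule S t u (traj S u Y t)"
      using eq assms(1) by (auto simp: cell_def a_def)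
    then have "card {r. r < s \<and> fst (traj S u Y s r) = a} = card {r. r < t \<and> fst (traj S u Y t r) = a}"
      using eq assms(1) by (auto simp: cell_def a_def)
    moreover have "{r. r < s \<and> fst (traj S u Y s r) = a} \<subset> {r. r < t \<and> fst (traj S u Y t r) = a}"
      using Suc.prems a traj_nth[of _ s t S u Y] by (auto simp: psubset_eq set_eq_iff)
    then have "card {r. r < s \<and> fst (traj S u Y s r) = a} < card {r. r < t \<and> fst (traj S u Y t r) = a}"
      by (intro psubset_card_mono) auto
    ultimately show False by simp
  qed
  then show ?case unfolding traj_Suc_cell IH by simp
qed simp

text \<open>The converse direction writes the old value back, which is again an update at the cell
  that is read.\<close>

lemma cell_fun_upd_iff:
  "cell S u t (traj S u (Y(p := x)) t) = p \<longleftrightarrow> cell S u t (traj S u Y t) = p"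
proof
  assume "cell S u t (traj S u Y t) = p"
  then show "cell S u t (traj S u (Y(p := x)) t) = p"
    using traj_fun_upd_fresh[of S u t Y p t x] by simp
next
  assume *: "cell S u t (traj S u (Y(p := x)) t) = p"
  then have "traj S u ((Y(p := x))(p := Y p)) t = traj S u (Y(p := x)) t"
    by (rule traj_fun_upd_fresh) simp
  then show "cell S u t (traj S u Y t) = p" using * by simp
qed

lemma resample_cell:
  assumes \<nu>: "arm_laws N d \<nu>" and p: "p \<in> {..<N} \<times> UNIV"
    and F: "F \<in> borel_measurable (table N \<nu>)"
  shows "(\<integral>\<^sup>+Y. F Y \<partial>table N \<nu>) = (\<integral>\<^sup>+Y. \<integral>\<^sup>+x. F (Y(p := x)) \<partial>\<nu> (fst p) \<partial>table N \<nu>)"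
proof -
  let ?I = "{..<N} \<times> (UNIV::nat set)" and ?M = "\<lambda>p. \<nu> (fst p)"
  have ps: "\<And>i. i \<in> ?I \<Longrightarrow> prob_space (?M i)" using \<nu> by (auto simp: arm_laws_def)
  interpret T: prob_space "table N \<nu>"
    unfolding table_def by (intro prob_space_PiM ps)
  interpret A: prob_space "?M p" using ps[OF p] .
  interpret P: pair_sigma_finite "?M p" "table N \<nu>" ..
  \<comment> \<open>\<open>distr_pair_PiM_eq_PiM\<close> describes the product over
    \<open>insert p I\<close>. As \<open>p\<close> already lies in the index set, it says that
    overwriting one coordinate by an independent draw preserves the law of the table.\<close>
  have ins: "insert p ?I = ?I" using p by blast
  have eq: "distr (?M p \<Otimes>\<^sub>M table N \<nu>) (table N \<nu>) (\<lambda>(x, X). X(p := x)) = table N \<nu>"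
    using distr_pair_PiM_eq_PiM[of ?I ?M p] ps p unfolding table_def ins by blast
  have m: "(\<lambda>(x, X). X(p := x)) \<in> ?M p \<Otimes>\<^sub>M table N \<nu> \<rightarrow>\<^sub>M table N \<nu>"
    unfolding table_def split_beta'
    by (rule measurable_fun_upd[of _ ?I]) (use p in auto)
  have "(\<integral>\<^sup>+Y. F Y \<partial>table N \<nu>) = (\<integral>\<^sup>+z. F (case z of (x, X) \<Rightarrow> X(p := x)) \<partial>(?M p \<Otimes>\<^sub>M table N \<nu>))"
    by (subst eq[symmetric], subst nn_integral_distr[OF m]) (use F in auto)
  also have "\<dots> = (\<integral>\<^sup>+Y. \<integral>\<^sup>+x. F (Y(p := x)) \<partial>?M p \<partial>table N \<nu>)"
    using measurable_compose[OF m F] 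
    by (subst P.nn_integral_snd[symmetric]) (auto simp: split_beta')
  finally show ?thesis .
qed

section \<open>The interaction as a Markov chain of histories\<close>

locale table_run =
  fixes S :: strategy and N K d :: nat
  assumes valid: "valid_strategy N K d S"
begin

abbreviation "tabsp \<equiv> (\<Pi>\<^sub>M p\<in>{..<N} \<times> (UNIV::nat set). obs_space d)"

lemma prob_ext: "prob_space (ext_rand S)" and sets_ext: "sets (ext_rand S) = sets borel"
  using valid by (auto simp: valid_strategy_def)

lemma sample_rule_measurable':
  "(\<lambda>(u, h). sample_rule S t u h) \<in> borel \<Otimes>\<^sub>M hist_space N d t \<rightarrow>\<^sub>M count_space {..<N}"
  using valid by (auto simp: valid_strategy_def)

lemma sample_rule_measurable:
  assumes "f \<in> M \<rightarrow>\<^sub>M borel" "g \<in> M \<rightarrow>\<^sub>M hist_space N d t"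
  shows "(\<lambda>x. sample_rule S t (f x) (g x)) \<in> M \<rightarrow>\<^sub>M count_space {..<N}"
  using measurable_compose[OF measurable_Pair[OF assms] sample_rule_measurable'] by simp

lemma hist_nth_measurable:
  "s < t \<Longrightarrow> (\<lambda>h. h s) \<in> hist_space N d t \<rightarrow>\<^sub>M count_space {..<N} \<Otimes>\<^sub>M obs_space d"
  unfolding hist_space_def by (rule measurable_component_singleton) simp

lemma cell_measurable:
  assumes f: "f \<in> M \<rightarrow>\<^sub>M borel" and g: "g \<in> M \<rightarrow>\<^sub>M hist_space N d t"
  shows "(\<lambda>x. cell S (f x) t (g x)) \<in> M \<rightarrow>\<^sub>M count_space ({..<N} \<times> UNIV)"
proof -
  let ?a = "\<lambda>x. sample_rule S t (f x) (g x)"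
  have a: "?a \<in> M \<rightarrow>\<^sub>M count_space {..<N}" by (rule sample_rule_measurable[OF f g])
  have a': "?a \<in> M \<rightarrow>\<^sub>M count_space UNIV"
    using measurable_compose[OF a, of "\<lambda>x. x" "count_space UNIV"] by simp
  have b: "(\<lambda>x. fst (g x s)) \<in> M \<rightarrow>\<^sub>M count_space UNIV" if "s < t" for s
  proof -
    have "(\<lambda>x. fst (g x s)) \<in> M \<rightarrow>\<^sub>M count_space {..<N}"
      using measurable_compose[OF measurable_compose[OF g hist_nth_measurable[OF that]] measurable_fst] .
    from measurable_compose[OF this, of "\<lambda>x. x" "count_space UNIV"] show ?thesis by simp
  qed
  have c: "(\<lambda>x. if fst (g x s) = ?a x then 1 else 0 :: nat) \<in> M \<rightarrow>\<^sub>M count_space UNIV" if "s < t" for s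
  proof -
    note [measurable] = a' b[OF that]
    \<comment> \<open>Equality of two countably valued functions is spelt out as an existential over
      the common value, a form that the measurability prover decomposes.\<close>
    have "Measurable.pred M (\<lambda>x. \<exists>n. fst (g x s) = n \<and> ?a x = n)" by measurable
    moreover have "(\<lambda>x. \<exists>n. fst (g x s) = n \<and> ?a x = n) = (\<lambda>x. fst (g x s) = ?a x)" by (intro ext) metis
    ultimately have "Measurable.pred M (\<lambda>x. fst (g x s) = ?a x)" by (simp only:)
    then show ?thesis by (intro measurable_If) (auto simp: pred_def)
  qed
  have "(\<lambda>x. \<Sum>s<t. if fst (g x s) = ?a x then 1 else 0 :: nat) \<in> M \<rightarrow>\<^sub>M count_space UNIV"
    using c by (rule measurable_sum_nat) auto
  moreover have "card {s. s < t \<and> fst (g x s) = ?a x} = (\<Sum>s<t. if fst (g x s) = ?a x then 1 else 0)" for x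
    by (simp add: sum.If_cases card_eq_sum[symmetric] Int_def)
  ultimately have "(\<lambda>x. card {s. s < t \<and> fst (g x s) = ?a x}) \<in> M \<rightarrow>\<^sub>M count_space UNIV"
    by simp
  then have "(\<lambda>x. (?a x, card {s. s < t \<and> fst (g x s) = ?a x})) \<in> M \<rightarrow>\<^sub>M count_space {..<N} \<Otimes>\<^sub>M count_space UNIV"
    by (rule measurable_Pair[OF a])
  then show ?thesis unfolding cell_def by (simp add: pair_measure_countable)
qed

lemma hist_upd_measurable:
  assumes "h \<in> M \<rightarrow>\<^sub>M hist_space N d t" "a \<in> M \<rightarrow>\<^sub>M count_space {..<N}" "x \<in> M \<rightarrow>\<^sub>M obs_space d"
  shows "(\<lambda>w. (h w)(t := (a w, x w))) \<in> M \<rightarrow>\<^sub>M hist_space N d (Suc t)"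
  unfolding hist_space_def
  by (rule measurable_fun_upd[of _ "{..<t}"]) (use assms in \<open>auto simp: hist_space_def lessThan_Suc\<close>)

lemma traj_measurable:
  "(\<lambda>w. traj S (fst w) (snd w) t) \<in> borel \<Otimes>\<^sub>M tabsp \<rightarrow>\<^sub>M hist_space N d t"
proof (induction t)
  case 0
  show ?case by (auto simp: hist_space_def space_PiM_empty intro!: measurable_PiM_single')
next
  case (Suc t)
  have c: "(\<lambda>w. cell S (fst w) t (traj S (fst w) (snd w) t)) \<in> borel \<Otimes>\<^sub>M tabsp \<rightarrow>\<^sub>M count_space ({..<N} \<times> UNIV)"
    by (rule cell_measurable[OF measurable_fst Suc])
  have y: "(\<lambda>w. snd w (cell S (fst w) t (traj S (fst w) (snd w) t))) \<in> borel \<Otimes>\<^sub>M tabsp \<rightarrow>\<^sub>M obs_space d"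
    by (rule measurable_compose_countable'[OF _ c])
       (auto intro!: measurable_compose[OF measurable_snd measurable_component_singleton])
  show ?case unfolding traj_Suc_cell
    by (rule hist_upd_measurable[OF Suc sample_rule_measurable[OF measurable_fst Suc] y])
qed

lemma table_sets: "arm_laws N d \<nu> \<Longrightarrow> sets (table N \<nu>) = sets tabsp"
  unfolding table_def by (rule sets_PiM_cong) (auto simp: arm_laws_def)

lemma run_space_table: "run_space S N \<nu> = ext_rand S \<Otimes>\<^sub>M table N \<nu>"
  by (simp add: run_space_def table_def)

lemma sets_run: "arm_laws N d \<nu> \<Longrightarrow> sets (run_space S N \<nu>) = sets (borel \<Otimes>\<^sub>M tabsp)"
  unfolding run_space_table by (rule sets_pair_measure_cong) (auto simp: sets_ext table_sets)

lemma traj_measurable_run: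
  "arm_laws N d \<nu> \<Longrightarrow> (\<lambda>w. traj S (fst w) (snd w) t) \<in> run_space S N \<nu> \<rightarrow>\<^sub>M hist_space N d t"
  using traj_measurable measurable_cong_sets[OF sets_run refl] by blast

lemma prob_space_table: "arm_laws N d \<nu> \<Longrightarrow> prob_space (table N \<nu>)"
  unfolding table_def by (intro prob_space_PiM) (auto simp: arm_laws_def)

lemma prob_space_run: "arm_laws N d \<nu> \<Longrightarrow> prob_space (run_space S N \<nu>)"
  unfolding run_space_table
  by (intro prob_space_pair prob_ext prob_space_table)

definition hist_exp :: "(nat \<Rightarrow> obs measure) \<Rightarrow> nat \<Rightarrow> (real \<Rightarrow> hist \<Rightarrow> ennreal) \<Rightarrow> ennreal" where
  "hist_exp \<nu> t \<Phi> = (\<integral>\<^sup>+w. \<Phi> (fst w) (traj S (fst w) (snd w) t) \<partial>run_space S N \<nu>)"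

abbreviation "hist_meas t \<Phi> \<equiv> case_prod \<Phi> \<in> borel_measurable (borel \<Otimes>\<^sub>M hist_space N d t)"

text \<open>The transition operator of the chain: the conditional expectation of \<Phi> given U and
  the history up to time t.\<close>

definition step :: "(nat \<Rightarrow> obs measure) \<Rightarrow> nat \<Rightarrow> (real \<Rightarrow> hist \<Rightarrow> ennreal) \<Rightarrow> real \<Rightarrow> hist \<Rightarrow> ennreal" where
  "step \<nu> t \<Phi> u h = (let a = sample_rule S t u h in \<integral>\<^sup>+x. \<Phi> u (h(t := (a, x))) \<partial>\<nu> a)"

lemma step_measurable:
  assumes \<nu>: "arm_laws N d \<nu>" and \<Phi>: "hist_meas (Suc t) \<Phi>"
  shows "hist_meas t (step \<nu> t \<Phi>)"
proof -
  let ?B = "borel \<Otimes>\<^sub>M hist_space N d t"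
  have "(\<lambda>z. (\<lambda>a z. \<integral>\<^sup>+x. \<Phi> (fst z) ((snd z)(t := (a, x))) \<partial>\<nu> a)
      (sample_rule S t (fst z) (snd z)) z) \<in> borel_measurable ?B"
  proof (rule measurable_compose_countable'[of "{..<N}"])
    fix a assume a: "a \<in> {..<N}"
    interpret prob_space "\<nu> a" using \<nu> a by (auto simp: arm_laws_def)
    have s: "sets (\<nu> a) = sets (obs_space d)" using \<nu> a by (auto simp: arm_laws_def)
    have "(\<lambda>w. (snd (fst w))(t := (a, snd w))) \<in> ?B \<Otimes>\<^sub>M \<nu> a \<rightarrow>\<^sub>M hist_space N d (Suc t)"
      using a s by (intro hist_upd_measurable) (auto simp: measurable_cong_sets[OF refl s[symmetric]])
    then have "(\<lambda>w. (fst (fst w), (snd (fst w))(t := (a, snd w)))) \<in> ?B \<Otimes>\<^sub>M \<nu> a \<rightarrow>\<^sub>M borel \<Otimes>\<^sub>M hist_space N d (Suc t)"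
      by (intro measurable_Pair) auto
    from measurable_compose[OF this \<Phi>]
    show "(\<lambda>z. \<integral>\<^sup>+x. \<Phi> (fst z) ((snd z)(t := (a, x))) \<partial>\<nu> a) \<in> borel_measurable ?B"
      by (intro borel_measurable_nn_integral) (simp add: split_beta')
  qed (auto intro!: sample_rule_measurable)
  then show ?thesis by (simp add: step_def Let_def split_beta')
qed

text \<open>This links the table model with the sequential one. The integral is split according to
  the cell that is read. On each piece that entry can be resampled independently, since by freshness
  neither the past nor the event defining the piece notices the change.\<close>

lemma hist_exp_Suc:
  assumes \<nu>: "arm_laws N d \<nu>" and \<Phi>: "hist_meas (Suc t) \<Phi>"
  shows "hist_exp \<nu> (Suc t) \<Phi> = hist_exp \<nu> t (step \<nu> t \<Phi>)"
proof -
  interpret U: prob_space "ext_rand S" by (rule prob_ext)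
  interpret T: prob_space "table N \<nu>" by (rule prob_space_table[OF \<nu>])
  interpret P: pair_sigma_finite "ext_rand S" "table N \<nu>" ..
  have run: "sets (run_space S N \<nu>) = sets (borel \<Otimes>\<^sub>M tabsp)" by (rule sets_run[OF \<nu>])
  have mm: "(\<lambda>w. \<Psi> (fst w) (traj S (fst w) (snd w) r)) \<in> borel_measurable (ext_rand S \<Otimes>\<^sub>M table N \<nu>)"
    if "hist_meas r \<Psi>" for r \<Psi>
  proof -
    have "(\<lambda>w. (fst w, traj S (fst w) (snd w) r)) \<in> ext_rand S \<Otimes>\<^sub>M table N \<nu> \<rightarrow>\<^sub>M borel \<Otimes>\<^sub>M hist_space N d r"
      using traj_measurable_run[OF \<nu>, of r]
      by (intro measurable_Pair) (auto simp: run_space_table measurable_cong_sets[OF refl sets_ext[symmetric]])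
    from measurable_compose[OF this that] show ?thesis by simp
  qed
  have mtab: "(\<lambda>Y. \<Psi> u (traj S u Y r)) \<in> borel_measurable (table N \<nu>)"
    if "hist_meas r \<Psi>" for r \<Psi> u
  proof -
    have "u \<in> space (ext_rand S)" using sets_eq_imp_space_eq[OF sets_ext] by simp
    then show ?thesis using measurable_compose[OF measurable_Pair1' mm[OF that]] by simp
  qed
  have tm: "(\<lambda>Y. traj S u Y t) \<in> table N \<nu> \<rightarrow>\<^sub>M hist_space N d t" for u
  proof -
    have "u \<in> space (ext_rand S)" using sets_eq_imp_space_eq[OF sets_ext] by simp
    then show ?thesis
      using measurable_compose[OF measurable_Pair1' traj_measurable_run[OF \<nu>, unfolded run_space_table, of t]] by simp
  qed
  have key: "(\<integral>\<^sup>+Y. \<Phi> u (traj S u Y (Suc t)) \<partial>table N \<nu>) = (\<integral>\<^sup>+Y. step \<nu> t \<Phi> u (traj S u Y t) \<partial>table N \<nu>)" for u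
  proof -
    let ?c = "\<lambda>Y. cell S u t (traj S u Y t)"
    \<comment> \<open>At most t pulls precede time t, so the second index is at most t and the split
      is a finite sum.\<close>
    let ?Q = "{..<N} \<times> {..t}"
    have cm: "?c \<in> table N \<nu> \<rightarrow>\<^sub>M count_space ({..<N} \<times> UNIV)"
      by (rule cell_measurable[OF _ tm]) auto
    have cQ: "?c Y \<in> ?Q" if "Y \<in> space (table N \<nu>)" for Y
    proof -
      have "card {s. s < t \<and> fst (traj S u Y t s) = sample_rule S t u (traj S u Y t)} \<le> card {..<t}"
        by (intro card_mono) auto
      then show ?thesis using measurable_space[OF cm that] by (auto simp: cell_def)
    qed
    have ind: "(\<lambda>Y. indicator {p} (?c Y) :: ennreal) \<in> borel_measurable (table N \<nu>)" for p
      by (rule measurable_compose[OF cm]) simp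
    have split: "(\<integral>\<^sup>+Y. G Y \<partial>table N \<nu>) = (\<Sum>p\<in>?Q. \<integral>\<^sup>+Y. indicator {p} (?c Y) * G Y \<partial>table N \<nu>)"
      if G: "G \<in> borel_measurable (table N \<nu>)" for G
    proof -
      have "(\<integral>\<^sup>+Y. G Y \<partial>table N \<nu>) = (\<integral>\<^sup>+Y. (\<Sum>p\<in>?Q. indicator {p} (?c Y) * G Y) \<partial>table N \<nu>)"
      proof (rule nn_integral_cong)
        fix Y assume "Y \<in> space (table N \<nu>)"
        then have "?c Y \<in> ?Q" by (rule cQ)
        then have "(\<Sum>p\<in>?Q. indicator {p} (?c Y)) = (1::ennreal)"
          by (subst sum.remove[of _ "?c Y"]) (auto intro!: sum.neutral split: split_indicator)
        then show "G Y = (\<Sum>p\<in>?Q. indicator {p} (?c Y) * G Y)"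
          by (simp only: sum_distrib_right[symmetric]) simp
      qed
      also have "\<dots> = (\<Sum>p\<in>?Q. \<integral>\<^sup>+Y. indicator {p} (?c Y) * G Y \<partial>table N \<nu>)"
        using G ind by (intro nn_integral_sum) auto
      finally show ?thesis .
    qed
    have one: "(\<integral>\<^sup>+Y. indicator {p} (?c Y) * \<Phi> u (traj S u Y (Suc t)) \<partial>table N \<nu>) =
        (\<integral>\<^sup>+Y. indicator {p} (?c Y) * step \<nu> t \<Phi> u (traj S u Y t) \<partial>table N \<nu>)"
      if p: "p \<in> ?Q" for p
    proof -
      have p': "p \<in> {..<N} \<times> UNIV" using p by auto
      have "(\<integral>\<^sup>+Y. indicator {p} (?c Y) * \<Phi> u (traj S u Y (Suc t)) \<partial>table N \<nu>) =
        (\<integral>\<^sup>+Y. \<integral>\<^sup>+x. indicator {p} (?c (Y(p := x))) * \<Phi> u (traj S u (Y(p := x)) (Suc t)) \<partial>\<nu> (fst p) \<partial>table N \<nu>)"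
        using ind mtab[OF \<Phi>] by (intro resample_cell[OF \<nu> p']) auto
      also have "\<dots> = (\<integral>\<^sup>+Y. indicator {p} (?c Y) * step \<nu> t \<Phi> u (traj S u Y t) \<partial>table N \<nu>)"
      proof (rule nn_integral_cong)
        fix Y
        show "(\<integral>\<^sup>+x. indicator {p} (?c (Y(p := x))) * \<Phi> u (traj S u (Y(p := x)) (Suc t)) \<partial>\<nu> (fst p)) =
          indicator {p} (?c Y) * step \<nu> t \<Phi> u (traj S u Y t)"
        proof (cases "?c Y = p")
          case True
          have *: "traj S u (Y(p := x)) t = traj S u Y t" for x
            using traj_fun_upd_fresh[OF True order_refl] .
          have "sample_rule S t u (traj S u Y t) = fst p" using True by (auto simp: cell_def)
          then show ?thesis using True by (simp add: traj_Suc_cell * step_def Let_def)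
        next
          case False
          then have "?c (Y(p := x)) \<noteq> p" for x by (simp add: cell_fun_upd_iff)
          then show ?thesis using False by simp
        qed
      qed
      finally show ?thesis .
    qed
    show ?thesis
      using one by (subst (1 2) split) (auto intro!: mtab \<Phi> step_measurable \<nu>)
  qed
  have "hist_exp \<nu> (Suc t) \<Phi> = (\<integral>\<^sup>+u. \<integral>\<^sup>+Y. \<Phi> u (traj S u Y (Suc t)) \<partial>table N \<nu> \<partial>ext_rand S)"
    unfolding hist_exp_def run_space_table using mm[OF \<Phi>] by (subst T.nn_integral_fst[symmetric]) auto
  also have "\<dots> = (\<integral>\<^sup>+u. \<integral>\<^sup>+Y. step \<nu> t \<Phi> u (traj S u Y t) \<partial>table N \<nu> \<partial>ext_rand S)"
    by (simp add: key)
  also have "\<dots> = hist_exp \<nu> t (step \<nu> t \<Phi>)"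
    unfolding hist_exp_def run_space_table
    using mm[OF step_measurable[OF \<nu> \<Phi>]] by (subst T.nn_integral_fst[symmetric]) auto
  finally show ?thesis .
qed

end

section \<open>Likelihood ratios at the stopping time\<close>

text \<open>Log-likelihood ratios, pull counts and signed sums over sets of arms are all additive in
  the observations. One update rule and one measurability lemma serve them all.\<close>

definition hsum :: "nat \<Rightarrow> (nat \<Rightarrow> obs \<Rightarrow> real) \<Rightarrow> hist \<Rightarrow> real" where
  "hsum t g h = (\<Sum>s<t. g (fst (h s)) (snd (h s)))"

lemma hsum_0 [simp]: "hsum 0 g h = 0"
  by (simp add: hsum_def)

lemma hsum_upd [simp]: "hsum (Suc t) g (h(t := (a, x))) = hsum t g h + g a x"
  by (simp add: hsum_def)

abbreviation pulls :: "nat \<Rightarrow> nat set \<Rightarrow> hist \<Rightarrow> real" where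
  "pulls t B \<equiv> hsum t (\<lambda>a _. indicator B a)"

lemma sum_pulls_le:
  assumes "finite Q" "disjoint_family_on B Q"
  shows "(\<Sum>q\<in>Q. pulls t (B q) h) \<le> real t"
proof -
  have "(\<Sum>q\<in>Q. pulls t (B q) h) = (\<Sum>s<t. \<Sum>q\<in>Q. indicator (B q) (fst (h s)))"
    unfolding hsum_def by (rule sum.swap)
  also have "\<dots> = (\<Sum>s<t. indicator (\<Union>q\<in>Q. B q) (fst (h s)))"
    by (intro sum.cong refl indicator_UN_disjoint[symmetric] assms)
  also have "\<dots> \<le> (\<Sum>s<t. 1)"
    by (intro sum_mono) (auto simp: indicator_def)
  finally show ?thesis by simp
qed

context table_run
begin

lemma traj_space: "w \<in> space (run_space S N \<nu>) \<Longrightarrow> arm_laws N d \<nu> \<Longrightarrow>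
    traj S (fst w) (snd w) t \<in> space (hist_space N d t)"
  using measurable_space[OF traj_measurable_run] by blast

lemma hist_exp_integrand_measurable:
  assumes \<nu>: "arm_laws N d \<nu>" and "hist_meas t \<Phi>"
  shows "(\<lambda>w. \<Phi> (fst w) (traj S (fst w) (snd w) t)) \<in> borel_measurable (run_space S N \<nu>)"
proof -
  have "(\<lambda>w. (fst w, traj S (fst w) (snd w) t)) \<in> run_space S N \<nu> \<rightarrow>\<^sub>M borel \<Otimes>\<^sub>M hist_space N d t"
    using traj_measurable_run[OF \<nu>, of t]
    by (intro measurable_Pair) (auto simp: run_space_table measurable_cong_sets[OF refl sets_ext[symmetric]])
  from measurable_compose[OF this assms(2)] show ?thesis by simp
qed

lemma hist_exp_mono:
  assumes "arm_laws N d \<nu>" "\<And>u h. h \<in> space (hist_space N d t) \<Longrightarrow> \<Phi> u h \<le> \<Psi> u h"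
  shows "hist_exp \<nu> t \<Phi> \<le> hist_exp \<nu> t \<Psi>"
  unfolding hist_exp_def by (rule nn_integral_mono, rule assms(2), erule traj_space[OF _ assms(1)])

lemma hist_exp_cong:
  assumes "arm_laws N d \<nu>" "\<And>u h. h \<in> space (hist_space N d t) \<Longrightarrow> \<Phi> u h = \<Psi> u h"
  shows "hist_exp \<nu> t \<Phi> = hist_exp \<nu> t \<Psi>"
  unfolding hist_exp_def by (rule nn_integral_cong, rule assms(2), erule traj_space[OF _ assms(1)])

lemma hist_exp_add:
  assumes "arm_laws N d \<nu>" "hist_meas t \<Phi>" "hist_meas t \<Psi>"
  shows "hist_exp \<nu> t (\<lambda>u h. \<Phi> u h + \<Psi> u h) = hist_exp \<nu> t \<Phi> + hist_exp \<nu> t \<Psi>"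
  unfolding hist_exp_def by (intro nn_integral_add hist_exp_integrand_measurable assms)

lemma hist_exp_cmult:
  assumes "arm_laws N d \<nu>" "hist_meas t \<Phi>"
  shows "hist_exp \<nu> t (\<lambda>u h. c * \<Phi> u h) = c * hist_exp \<nu> t \<Phi>"
  unfolding hist_exp_def by (intro nn_integral_cmult hist_exp_integrand_measurable assms)

lemma hist_exp_sum:
  assumes "arm_laws N d \<nu>" "\<And>i. i \<in> I \<Longrightarrow> hist_meas t (\<Phi> i)"
  shows "hist_exp \<nu> t (\<lambda>u h. \<Sum>i\<in>I. \<Phi> i u h) = (\<Sum>i\<in>I. hist_exp \<nu> t (\<Phi> i))"
  unfolding hist_exp_def by (intro nn_integral_sum hist_exp_integrand_measurable assms)

lemma hist_exp_0:
  assumes \<nu>: "arm_laws N d \<nu>" and \<Phi>: "hist_meas 0 \<Phi>"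
  shows "hist_exp \<nu> 0 \<Phi> = (\<integral>\<^sup>+u. \<Phi> u (\<lambda>_. undefined) \<partial>ext_rand S)"
proof -
  interpret T: prob_space "table N \<nu>" by (rule prob_space_table[OF \<nu>])
  have m: "(\<lambda>w. \<Phi> (fst w) (\<lambda>_. undefined)) \<in> borel_measurable (ext_rand S \<Otimes>\<^sub>M table N \<nu>)"
    using hist_exp_integrand_measurable[OF \<nu> \<Phi>] by (simp add: run_space_table)
  have "hist_exp \<nu> 0 \<Phi> = (\<integral>\<^sup>+w. \<Phi> (fst w) (\<lambda>_. undefined) \<partial>(ext_rand S \<Otimes>\<^sub>M table N \<nu>))"
    by (simp add: hist_exp_def run_space_table)
  also have "\<dots> = (\<integral>\<^sup>+u. \<integral>\<^sup>+Y. \<Phi> u (\<lambda>_. undefined) \<partial>table N \<nu> \<partial>ext_rand S)"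
    by (subst T.nn_integral_fst[OF m, symmetric]) simp
  also have "\<dots> = (\<integral>\<^sup>+u. \<Phi> u (\<lambda>_. undefined) \<partial>ext_rand S)"
    by (simp add: T.emeasure_space_1)
  finally show ?thesis .
qed

lemma hsum_measurable:
  assumes "\<And>a. a < N \<Longrightarrow> g a \<in> borel_measurable (obs_space d)"
  shows "hsum t g \<in> borel_measurable (hist_space N d t)"
proof -
  have g: "(\<lambda>z. g (fst z) (snd z)) \<in> borel_measurable (count_space {..<N} \<Otimes>\<^sub>M obs_space d)"
    using assms by (intro measurable_pair_measure_countable1) auto
  have "(\<lambda>h. g (fst (h s)) (snd (h s))) \<in> borel_measurable (hist_space N d t)" if "s < t" for s
    using measurable_compose[OF hist_nth_measurable[OF that] g] .
  then show ?thesis unfolding hsum_def by (intro borel_measurable_sum) auto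
qed

lemma hist_meas_hist: "f \<in> borel_measurable (hist_space N d t) \<Longrightarrow> hist_meas t (\<lambda>u h. f h)"
  by (auto simp: split_beta' intro: measurable_compose[OF measurable_snd])

lemma hist_meas_mult: "hist_meas t (\<Phi> :: real \<Rightarrow> hist \<Rightarrow> ennreal) \<Longrightarrow> hist_meas t \<Psi> \<Longrightarrow> hist_meas t (\<lambda>u h. \<Phi> u h * \<Psi> u h)"
  unfolding split_beta' by measurable

lemma hist_meas_cmult: "hist_meas t (\<Phi> :: real \<Rightarrow> hist \<Rightarrow> ennreal) \<Longrightarrow> hist_meas t (\<lambda>u h. c * \<Phi> u h)"
  unfolding split_beta' by measurable

lemma hist_upd_measurable_obs:
  assumes "h \<in> space (hist_space N d t)" "a < N"
  shows "(\<lambda>x. h(t := (a, x))) \<in> obs_space d \<rightarrow>\<^sub>M hist_space N d (Suc t)"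
  using assms by (intro hist_upd_measurable) auto

lemma hist_meas_section:
  assumes "hist_meas (Suc t) \<Phi>" "h \<in> space (hist_space N d t)" "a < N"
  shows "(\<lambda>x. \<Phi> u (h(t := (a, x)))) \<in> borel_measurable (obs_space d)"
proof -
  have "(\<lambda>x. (u, h(t := (a, x)))) \<in> obs_space d \<rightarrow>\<^sub>M borel \<Otimes>\<^sub>M hist_space N d (Suc t)"
    using hist_upd_measurable_obs[OF assms(2,3)] by (intro measurable_Pair) auto
  from measurable_compose[OF this assms(1)] show ?thesis by simp
qed

lemma sample_rule_less: "h \<in> space (hist_space N d t) \<Longrightarrow> sample_rule S t u h < N"
  using measurable_space[OF sample_rule_measurable', of "(u, h)" t] by (auto simp: space_pair_measure)

text \<open>The external randomness and the sampling rule are common to both environments and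
  cancel, so only the observations contribute factors, however adaptively the arms were chosen. The
  induction peels off the last pull.\<close>

lemma hist_exp_density:
  assumes \<mu>: "arm_laws N d \<mu>" and \<nu>: "arm_laws N d \<nu>"
    and l: "\<And>a. a < N \<Longrightarrow> l a \<in> borel_measurable (obs_space d)"
    and dens: "\<And>a. a < N \<Longrightarrow> \<nu> a = density (\<mu> a) (\<lambda>x. ennreal (exp (l a x)))"
    and \<Phi>: "hist_meas t \<Phi>"
  shows "hist_exp \<nu> t \<Phi> = hist_exp \<mu> t (\<lambda>u h. ennreal (exp (hsum t l h)) * \<Phi> u h)"
  using \<Phi>
proof (induction t arbitrary: \<Phi>)
  case 0
  then show ?case using \<mu> \<nu> by (simp add: hist_exp_0)
next
  case (Suc t)
  have m: "hist_meas r (\<lambda>u h. ennreal (exp (hsum r l h)))" for r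
    using hsum_measurable[of l r] l by (intro hist_meas_hist) auto
  have "hist_exp \<nu> (Suc t) \<Phi> = hist_exp \<nu> t (step \<nu> t \<Phi>)" by (rule hist_exp_Suc[OF \<nu> Suc.prems])
  also have "\<dots> = hist_exp \<mu> t (\<lambda>u h. ennreal (exp (hsum t l h)) * step \<nu> t \<Phi> u h)"
    by (rule Suc.IH[OF step_measurable[OF \<nu> Suc.prems]])
  also have "\<dots> = hist_exp \<mu> t (step \<mu> t (\<lambda>u h. ennreal (exp (hsum (Suc t) l h)) * \<Phi> u h))"
  proof (rule hist_exp_cong[OF \<mu>])
    fix u h assume h: "h \<in> space (hist_space N d t)"
    define a where "a = sample_rule S t u h"
    have a: "a < N" using sample_rule_less[OF h] by (simp add: a_def)
    have s: "sets (\<mu> a) = sets (obs_space d)" using \<mu> a by (auto simp: arm_laws_def)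
    have f: "(\<lambda>x. \<Phi> u (h(t := (a, x)))) \<in> borel_measurable (\<mu> a)"
      using hist_meas_section[OF Suc.prems h a] measurable_cong_sets[OF s refl] by blast
    have la: "l a \<in> borel_measurable (\<mu> a)"
      using l[OF a] measurable_cong_sets[OF s refl] by blast
    have "ennreal (exp (hsum t l h)) * step \<nu> t \<Phi> u h =
        ennreal (exp (hsum t l h)) * (\<integral>\<^sup>+x. ennreal (exp (l a x)) * \<Phi> u (h(t := (a, x))) \<partial>\<mu> a)"
      using f la by (simp add: step_def a_def[symmetric] dens[OF a] nn_integral_density)
    also have "\<dots> = (\<integral>\<^sup>+x. ennreal (exp (hsum t l h)) * (ennreal (exp (l a x)) * \<Phi> u (h(t := (a, x)))) \<partial>\<mu> a)"
      using f la by (intro nn_integral_cmult[symmetric]) auto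
    also have "\<dots> = step \<mu> t (\<lambda>u h. ennreal (exp (hsum (Suc t) l h)) * \<Phi> u h) u h"
      by (simp add: step_def a_def[symmetric] exp_add ennreal_mult mult_ac)
    finally show "ennreal (exp (hsum t l h)) * step \<nu> t \<Phi> u h =
      step \<mu> t (\<lambda>u h. ennreal (exp (hsum (Suc t) l h)) * \<Phi> u h) u h" .
  qed
  also have "\<dots> = hist_exp \<mu> (Suc t) (\<lambda>u h. ennreal (exp (hsum (Suc t) l h)) * \<Phi> u h)"
    by (intro hist_exp_Suc[symmetric] \<mu> hist_meas_mult m Suc.prems)
  finally show ?case .
qed

section \<open>Stopping events and optional stopping\<close>

definition no_stop :: "nat \<Rightarrow> hist set" where
  "no_stop t = {h \<in> space (hist_space N d t). \<forall>s<t. \<not> stop_rule S s (restrict h {..<s})}"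

definition good_meas :: "(nat \<Rightarrow> hist \<Rightarrow> bool) \<Rightarrow> bool" where
  "good_meas g \<longleftrightarrow> (\<forall>t. {h \<in> space (hist_space N d t). g t h} \<in> sets (hist_space N d t))"

definition stop_set :: "(nat \<Rightarrow> hist \<Rightarrow> bool) \<Rightarrow> nat \<Rightarrow> hist set" where
  "stop_set g t = {h \<in> no_stop t. stop_rule S t h \<and> g t h}"

lemma stop_rule_pred: "Measurable.pred (hist_space N d t) (stop_rule S t)"
  using valid by (auto simp: valid_strategy_def pred_def)

lemma hist_restrict_measurable:
  "s \<le> t \<Longrightarrow> (\<lambda>h. restrict h {..<s}) \<in> hist_space N d t \<rightarrow>\<^sub>M hist_space N d s"
  unfolding hist_space_def by (rule measurable_restrict_subset) auto

lemma no_stop_sets: "no_stop t \<in> sets (hist_space N d t)"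
proof -
  have "Measurable.pred (hist_space N d t) (\<lambda>h. stop_rule S s (restrict h {..<s}))" if "s \<in> {..<t}" for s
    using that by (intro measurable_compose[OF hist_restrict_measurable stop_rule_pred]) auto
  then have "Measurable.pred (hist_space N d t) (\<lambda>h. \<forall>s\<in>{..<t}. \<not> stop_rule S s (restrict h {..<s}))"
    by (intro pred_intros_finite pred_intros_logic) auto
  then have "{h \<in> space (hist_space N d t). \<forall>s\<in>{..<t}. \<not> stop_rule S s (restrict h {..<s})} \<in> sets (hist_space N d t)"
    by (rule predE)
  then show ?thesis by (simp only: no_stop_def Ball_def lessThan_iff)
qed

lemma stop_set_sets:
  assumes "good_meas g"
  shows "stop_set g t \<in> sets (hist_space N d t)"
proof -
  have "stop_set g t = no_stop t \<inter> {h \<in> space (hist_space N d t). stop_rule S t h} \<inter>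
      {h \<in> space (hist_space N d t). g t h}"
    by (auto simp: stop_set_def no_stop_def)
  then show ?thesis
    using assms no_stop_sets valid by (auto simp: good_meas_def valid_strategy_def)
qed

lemma hist_meas_indicator: "A \<in> sets (hist_space N d t) \<Longrightarrow> hist_meas t (\<lambda>u h. indicator A h)"
  by (intro hist_meas_hist) auto

lemma stop_time_eq_iff:
  assumes "arm_laws N d \<nu>" "w \<in> space (run_space S N \<nu>)"
  shows "stop_time S (fst w) (snd w) = enat t \<and> g t (traj S (fst w) (snd w) t) \<longleftrightarrow>
    traj S (fst w) (snd w) t \<in> stop_set g t"
proof -
  let ?r = "\<lambda>t. stop_rule S t (traj S (fst w) (snd w) t)"
  have "stop_time S (fst w) (snd w) = enat t \<longleftrightarrow> ?r t \<and> (\<forall>s<t. \<not> ?r s)"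
  proof
    assume "stop_time S (fst w) (snd w) = enat t"
    then have "\<exists>t. ?r t" "(LEAST t. ?r t) = t" by (auto simp: stop_time_def split: if_splits)
    then show "?r t \<and> (\<forall>s<t. \<not> ?r s)" using LeastI_ex[of ?r] not_less_Least[of _ ?r] by auto
  next
    assume *: "?r t \<and> (\<forall>s<t. \<not> ?r s)"
    then have "(LEAST t. ?r t) = t" by (intro Least_equality) (auto simp: not_less[symmetric])
    then show "stop_time S (fst w) (snd w) = enat t" using * by (auto simp: stop_time_def)
  qed
  moreover have "restrict (traj S (fst w) (snd w) t) {..<s} = traj S (fst w) (snd w) s" if "s < t" for s
    using that by (intro traj_restrict) simp
  ultimately show ?thesis
    using traj_space[OF assms(2,1), of t] by (auto simp: stop_set_def no_stop_def)
qed

definition stop_event :: "(nat \<Rightarrow> obs measure) \<Rightarrow> (nat \<Rightarrow> hist \<Rightarrow> bool) \<Rightarrow> (real \<times> (nat \<times> nat \<Rightarrow> obs)) set" where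
  "stop_event \<nu> g = {w \<in> space (run_space S N \<nu>). \<exists>t. stop_time S (fst w) (snd w) = enat t \<and>
     g t (traj S (fst w) (snd w) t)}"

definition stop_prob :: "(nat \<Rightarrow> obs measure) \<Rightarrow> (nat \<Rightarrow> hist \<Rightarrow> bool) \<Rightarrow> real" where
  "stop_prob \<nu> g = measure (run_space S N \<nu>) (stop_event \<nu> g)"

lemma stop_event_UN:
  assumes "arm_laws N d \<nu>"
  shows "stop_event \<nu> g = (\<Union>t. (\<lambda>w. traj S (fst w) (snd w) t) -` stop_set g t \<inter> space (run_space S N \<nu>))"
  using stop_time_eq_iff[OF assms, of _ _ g] by (auto simp: stop_event_def) blast

lemma stop_event_sets:
  assumes "arm_laws N d \<nu>" "good_meas g"
  shows "stop_event \<nu> g \<in> sets (run_space S N \<nu>)"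
  unfolding stop_event_UN[OF assms(1)]
  using measurable_sets[OF traj_measurable_run[OF assms(1)] stop_set_sets[OF assms(2)]]
  by (intro sets.countable_UN) auto

lemma stop_prob_eq:
  assumes \<nu>: "arm_laws N d \<nu>" and g: "good_meas g"
  shows "ennreal (stop_prob \<nu> g) = (\<Sum>t. hist_exp \<nu> t (\<lambda>u. indicator (stop_set g t)))"
proof -
  interpret prob_space "run_space S N \<nu>" by (rule prob_space_run[OF \<nu>])
  let ?A = "\<lambda>t. (\<lambda>w. traj S (fst w) (snd w) t) -` stop_set g t \<inter> space (run_space S N \<nu>)"
  have A: "?A t \<in> sets (run_space S N \<nu>)" for t
    by (intro measurable_sets[OF traj_measurable_run[OF \<nu>]] stop_set_sets g)
  have "disjoint_family ?A"
    unfolding disjoint_family_on_def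
  proof (intro ballI impI equals0I)
    fix m n :: nat and w assume "m \<noteq> n" "w \<in> ?A m \<inter> ?A n"
    then have "stop_time S (fst w) (snd w) = enat m" "stop_time S (fst w) (snd w) = enat n"
      using stop_time_eq_iff[OF \<nu>, of w _ g] by auto
    then show False using \<open>m \<noteq> n\<close> by simp
  qed
  then have "(\<Sum>t. emeasure (run_space S N \<nu>) (?A t)) = emeasure (run_space S N \<nu>) (\<Union>t. ?A t)"
    using A by (intro suminf_emeasure) auto
  moreover have "emeasure (run_space S N \<nu>) (?A t) = hist_exp \<nu> t (\<lambda>u. indicator (stop_set g t))" for t
    unfolding hist_exp_def nn_integral_indicator[OF A, symmetric]
    by (intro nn_integral_cong) (auto split: split_indicator)
  ultimately show ?thesis
    by (simp add: stop_prob_def stop_event_UN[OF \<nu>] emeasure_eq_measure)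
qed

lemma optional_stopping:
  assumes \<mu>: "arm_laws N d \<mu>"
    and Z: "\<And>t. Z t \<in> borel_measurable (hist_space N d t)"
    and super: "\<And>t h a. h \<in> space (hist_space N d t) \<Longrightarrow> a < N \<Longrightarrow>
      (\<integral>\<^sup>+x. Z (Suc t) (h(t := (a, x))) \<partial>\<mu> a) \<le> Z t h"
    and g: "good_meas g"
  shows "(\<Sum>t. hist_exp \<mu> t (\<lambda>u h. indicator (stop_set g t) h * Z t h)) \<le> Z 0 (\<lambda>_. undefined)"
proof -
  let ?s = "\<lambda>t. hist_exp \<mu> t (\<lambda>u h. indicator (stop_set g t) h * Z t h)"
  let ?n = "\<lambda>t. hist_exp \<mu> t (\<lambda>u h. indicator (no_stop t) h * Z t h)"
  have bound: "(\<Sum>t<H. ?s t) + ?n H \<le> Z 0 (\<lambda>_. undefined)" for H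
  proof (induction H)
    case 0
    interpret prob_space "ext_rand S" by (rule prob_ext)
    have "?n 0 = (\<integral>\<^sup>+u. indicator (no_stop 0) (\<lambda>_. undefined) * Z 0 (\<lambda>_. undefined) \<partial>ext_rand S)"
      by (rule hist_exp_0[OF \<mu> hist_meas_mult[OF hist_meas_indicator[OF no_stop_sets] hist_meas_hist[OF Z]]])
    also have "\<dots> \<le> Z 0 (\<lambda>_. undefined)"
      by (simp add: emeasure_space_1 indicator_def)
    finally show ?case by simp
  next
    case (Suc H)
    have mZ: "hist_meas H (\<lambda>u h. Z H h)" "hist_meas (Suc H) (\<lambda>u h. Z (Suc H) h)" by (auto intro: hist_meas_hist Z)
    \<comment> \<open>\<open>no_stop H\<close> only says that no stop occurred strictly before H.
      \<open>?C\<close> also excludes a stop at H, and only histories in \<open>?C\<close> extend to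
      \<open>no_stop (Suc H)\<close>. Together with \<open>stop_set g H\<close> it is a disjoint
      part of \<open>no_stop H\<close>, so nothing is counted twice.\<close>
    let ?C = "no_stop H - {h \<in> space (hist_space N d H). stop_rule S H h}"
    have C: "?C \<in> sets (hist_space N d H)" using no_stop_sets valid by (auto simp: valid_strategy_def)
    have "?n (Suc H) = hist_exp \<mu> H (step \<mu> H (\<lambda>u h. indicator (no_stop (Suc H)) h * Z (Suc H) h))"
      by (rule hist_exp_Suc[OF \<mu> hist_meas_mult[OF hist_meas_indicator[OF no_stop_sets] mZ(2)]])
    also have "\<dots> \<le> hist_exp \<mu> H (\<lambda>u h. indicator ?C h * Z H h)"
    proof (rule hist_exp_mono[OF \<mu>])
      fix u h assume h: "h \<in> space (hist_space N d H)"
      define a where "a = sample_rule S H u h"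
      have a: "a < N" using sample_rule_less[OF h] by (simp add: a_def)
      have res: "restrict (h(H := z)) {..<s} = restrict h {..<s}" if "s \<le> H" for s z
        using that by (auto simp: restrict_def fun_eq_iff)
      have resH: "restrict h {..<H} = h"
        using h by (auto simp: hist_space_def space_PiM PiE_restrict)
      show "step \<mu> H (\<lambda>u h. indicator (no_stop (Suc H)) h * Z (Suc H) h) u h \<le> indicator ?C h * Z H h"
      proof (cases "h \<in> ?C")
        case True
        have "step \<mu> H (\<lambda>u h. indicator (no_stop (Suc H)) h * Z (Suc H) h) u h
            \<le> (\<integral>\<^sup>+x. Z (Suc H) (h(H := (a, x))) \<partial>\<mu> a)"
          unfolding step_def Let_def a_def[symmetric]
          by (intro nn_integral_mono) (auto simp: indicator_def)
        also have "\<dots> \<le> Z H h" by (rule super[OF h a])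
        finally show ?thesis using True by simp
      next
        case False
        have "h(H := (a, x)) \<notin> no_stop (Suc H)" for x
        proof
          assume "h(H := (a, x)) \<in> no_stop (Suc H)"
          then have "\<not> stop_rule S s (restrict h {..<s})" if "s \<le> H" for s
            using that by (auto simp: no_stop_def res less_Suc_eq_le)
          from this[of H] this show False using False h resH by (auto simp: no_stop_def)
        qed
        then show ?thesis by (simp add: step_def a_def[symmetric])
      qed
    qed
    finally have n: "?n (Suc H) \<le> hist_exp \<mu> H (\<lambda>u h. indicator ?C h * Z H h)" .
    have "?s H + hist_exp \<mu> H (\<lambda>u h. indicator ?C h * Z H h) =
        hist_exp \<mu> H (\<lambda>u h. indicator (stop_set g H) h * Z H h + indicator ?C h * Z H h)"
      by (intro hist_exp_add[symmetric] \<mu> hist_meas_mult hist_meas_indicator stop_set_sets g C mZ)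
    also have "\<dots> \<le> ?n H"
      by (rule hist_exp_mono[OF \<mu>]) (auto simp: stop_set_def no_stop_def split: split_indicator)
    finally have "?s H + ?n (Suc H) \<le> ?n H" using n by (meson add_left_mono order_trans)
    then have "(\<Sum>t<Suc H. ?s t) + ?n (Suc H) \<le> (\<Sum>t<H. ?s t) + ?n H"
      by (simp add: add.assoc add_left_mono)
    then show ?case using Suc by (rule order_trans)
  qed
  have "(\<Sum>t<H. ?s t) \<le> Z 0 (\<lambda>_. undefined)" for H
    by (rule order_trans[OF _ bound[of H]]) simp
  then show ?thesis by (intro suminf_le_const) auto
qed

text \<open>The comparison \<open>dom\<close> is asked only of the two mixtures, never for a single
  \<xi>, so the cancellation between directions is kept. Integrated at the stopping time, the
  mixtures become stopping probabilities and the remainder is bounded by its initial value.\<close>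

lemma change_of_measure:
  assumes \<mu>: "arm_laws N d \<mu>" and fin: "finite \<Xi>"
    and \<nu>: "\<And>\<xi>. \<xi> \<in> \<Xi> \<Longrightarrow> arm_laws N d (\<nu> \<xi>)" and \<nu>': "\<And>\<xi>. \<xi> \<in> \<Xi> \<Longrightarrow> arm_laws N d (\<nu>' \<xi>)"
    and l: "\<And>\<xi> a. a < N \<Longrightarrow> l \<xi> a \<in> borel_measurable (obs_space d)"
    and l': "\<And>\<xi> a. a < N \<Longrightarrow> l' \<xi> a \<in> borel_measurable (obs_space d)"
    and dens: "\<And>\<xi> a. \<xi> \<in> \<Xi> \<Longrightarrow> a < N \<Longrightarrow> \<nu> \<xi> a = density (\<mu> a) (\<lambda>x. ennreal (exp (l \<xi> a x)))"
    and dens': "\<And>\<xi> a. \<xi> \<in> \<Xi> \<Longrightarrow> a < N \<Longrightarrow> \<nu>' \<xi> a = density (\<mu> a) (\<lambda>x. ennreal (exp (l' \<xi> a x)))"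
    and Z: "\<And>t. Z t \<in> borel_measurable (hist_space N d t)"
    and super: "\<And>t h a. h \<in> space (hist_space N d t) \<Longrightarrow> a < N \<Longrightarrow>
      (\<integral>\<^sup>+x. Z (Suc t) (h(t := (a, x))) \<partial>\<mu> a) \<le> Z t h"
    and g: "good_meas g"
    and dom: "\<And>t h. h \<in> space (hist_space N d t) \<Longrightarrow> g t h \<Longrightarrow>
      ennreal (\<Sum>\<xi>\<in>\<Xi>. exp (hsum t (l' \<xi>) h)) \<le> ennreal c * ennreal (\<Sum>\<xi>\<in>\<Xi>. exp (hsum t (l \<xi>) h)) + e * Z t h"
  shows "ennreal (\<Sum>\<xi>\<in>\<Xi>. stop_prob (\<nu>' \<xi>) g) \<le>
    ennreal c * ennreal (\<Sum>\<xi>\<in>\<Xi>. stop_prob (\<nu> \<xi>) g) + e * Z 0 (\<lambda>_. undefined)"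
proof -
  let ?I = "\<lambda>t h. indicator (stop_set g t) h :: ennreal"
  have mI: "hist_meas t (\<lambda>u. ?I t)" for t by (intro hist_meas_indicator stop_set_sets g)
  have mix: "ennreal (\<Sum>\<xi>\<in>\<Xi>. stop_prob (\<nu> \<xi>) g) =
      (\<Sum>t. hist_exp \<mu> t (\<lambda>u h. ?I t h * ennreal (\<Sum>\<xi>\<in>\<Xi>. exp (hsum t (l \<xi>) h))))"
    if \<nu>: "\<And>\<xi>. \<xi> \<in> \<Xi> \<Longrightarrow> arm_laws N d (\<nu> \<xi>)"
      and l: "\<And>\<xi> a. a < N \<Longrightarrow> l \<xi> a \<in> borel_measurable (obs_space d)"
      and dens: "\<And>\<xi> a. \<xi> \<in> \<Xi> \<Longrightarrow> a < N \<Longrightarrow> \<nu> \<xi> a = density (\<mu> a) (\<lambda>x. ennreal (exp (l \<xi> a x)))"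
    for \<nu> l
  proof -
    have m: "hist_meas t (\<lambda>u h. ennreal (exp (hsum t (l \<xi>) h)))" for t \<xi>
      using hsum_measurable[of "l \<xi>" t] l by (intro hist_meas_hist) auto
    have "ennreal (\<Sum>\<xi>\<in>\<Xi>. stop_prob (\<nu> \<xi>) g) = (\<Sum>\<xi>\<in>\<Xi>. ennreal (stop_prob (\<nu> \<xi>) g))"
      by (intro sum_ennreal[symmetric]) (simp add: stop_prob_def)
    also have "\<dots> = (\<Sum>\<xi>\<in>\<Xi>. \<Sum>t. hist_exp \<mu> t (\<lambda>u h. ennreal (exp (hsum t (l \<xi>) h)) * ?I t h))"
    proof (rule sum.cong[OF refl])
      fix \<xi> assume \<xi>: "\<xi> \<in> \<Xi>"
      show "ennreal (stop_prob (\<nu> \<xi>) g) = (\<Sum>t. hist_exp \<mu> t (\<lambda>u h. ennreal (exp (hsum t (l \<xi>) h)) * ?I t h))"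
        unfolding stop_prob_eq[OF \<nu>[OF \<xi>] g]
        by (intro suminf_cong hist_exp_density[OF \<mu> \<nu>[OF \<xi>] l dens[OF \<xi>] mI])
    qed
    also have "\<dots> = (\<Sum>t. \<Sum>\<xi>\<in>\<Xi>. hist_exp \<mu> t (\<lambda>u h. ennreal (exp (hsum t (l \<xi>) h)) * ?I t h))"
      by (intro suminf_sum[symmetric]) auto
    also have "\<dots> = (\<Sum>t. hist_exp \<mu> t (\<lambda>u h. \<Sum>\<xi>\<in>\<Xi>. ennreal (exp (hsum t (l \<xi>) h)) * ?I t h))"
      by (intro suminf_cong hist_exp_sum[symmetric] \<mu> hist_meas_mult m mI)
    also have "\<dots> = (\<Sum>t. hist_exp \<mu> t (\<lambda>u h. ?I t h * ennreal (\<Sum>\<xi>\<in>\<Xi>. exp (hsum t (l \<xi>) h))))"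
      by (simp add: sum_distrib_right[symmetric] sum_ennreal mult.commute)
    finally show ?thesis .
  qed
  have m: "hist_meas t (\<lambda>u h. ennreal (\<Sum>\<xi>\<in>\<Xi>. exp (hsum t (l \<xi>) h)))" for t
    using hsum_measurable[of _ t] l by (intro hist_meas_hist) auto
  have "ennreal (\<Sum>\<xi>\<in>\<Xi>. stop_prob (\<nu>' \<xi>) g) =
      (\<Sum>t. hist_exp \<mu> t (\<lambda>u h. ?I t h * ennreal (\<Sum>\<xi>\<in>\<Xi>. exp (hsum t (l' \<xi>) h))))"
    by (rule mix[OF \<nu>' l' dens'])
  also have "\<dots> \<le> (\<Sum>t. hist_exp \<mu> t (\<lambda>u h. ennreal c * (?I t h * ennreal (\<Sum>\<xi>\<in>\<Xi>. exp (hsum t (l \<xi>) h))) + e * (?I t h * Z t h)))"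
  proof (intro suminf_le summableI hist_exp_mono[OF \<mu>])
    fix t h assume "h \<in> space (hist_space N d t)"
    then show "?I t h * ennreal (\<Sum>\<xi>\<in>\<Xi>. exp (hsum t (l' \<xi>) h)) \<le>
      ennreal c * (?I t h * ennreal (\<Sum>\<xi>\<in>\<Xi>. exp (hsum t (l \<xi>) h))) + e * (?I t h * Z t h)"
      using dom[of h t] by (auto simp: stop_set_def split: split_indicator)
  qed
  also have "\<dots> = (\<Sum>t. ennreal c * hist_exp \<mu> t (\<lambda>u h. ?I t h * ennreal (\<Sum>\<xi>\<in>\<Xi>. exp (hsum t (l \<xi>) h)))
      + e * hist_exp \<mu> t (\<lambda>u h. ?I t h * Z t h))"
    by (intro suminf_cong, subst hist_exp_add[OF \<mu>], (intro hist_meas_cmult hist_meas_mult mI m hist_meas_hist Z)+,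
        (subst hist_exp_cmult[OF \<mu>], (intro hist_meas_mult mI m hist_meas_hist Z)+)+, simp)
  also have "\<dots> = ennreal c * (\<Sum>t. hist_exp \<mu> t (\<lambda>u h. ?I t h * ennreal (\<Sum>\<xi>\<in>\<Xi>. exp (hsum t (l \<xi>) h))))
      + e * (\<Sum>t. hist_exp \<mu> t (\<lambda>u h. ?I t h * Z t h))"
    by (simp add: suminf_add[symmetric] ennreal_suminf_cmult)
  also have "\<dots> \<le> ennreal c * ennreal (\<Sum>\<xi>\<in>\<Xi>. stop_prob (\<nu> \<xi>) g) + e * Z 0 (\<lambda>_. undefined)"
    using mix[OF \<nu> l dens] optional_stopping[OF \<mu> Z super g]
    by (intro add_mono mult_left_mono) auto
  finally show ?thesis .
qed

text \<open>Markov's inequality for all sets at once: on a run that stops at time t the disjoint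
  sets share t pulls, so no factor \<open>card Q\<close> is lost.\<close>

lemma stop_prob_markov:
  assumes \<nu>: "arm_laws N d \<nu>" and Q: "finite Q" "disjoint_family_on B Q"
  shows "(\<Sum>q\<in>Q. ennreal (real (Suc R) * stop_prob \<nu> (\<lambda>t h. \<not> pulls t (B q) h \<le> real R))) \<le> expected_budget S N \<nu>"
proof -
  interpret prob_space "run_space S N \<nu>" by (rule prob_space_run[OF \<nu>])
  let ?g = "\<lambda>q t h. \<not> pulls t (B q) h \<le> real R"
  have gm: "good_meas (?g q)" for q
    unfolding good_meas_def using hsum_measurable[of "\<lambda>a _. indicator (B q) a"]
    by (auto intro!: sets.sets_Collect(2) borel_measurable_le)
  have ev: "stop_event \<nu> (?g q) \<in> sets (run_space S N \<nu>)" for q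
    by (rule stop_event_sets[OF \<nu> gm])
  have "(\<Sum>q\<in>Q. ennreal (real (Suc R) * stop_prob \<nu> (?g q))) =
      (\<Sum>q\<in>Q. \<integral>\<^sup>+w. ennreal (real (Suc R)) * indicator (stop_event \<nu> (?g q)) w \<partial>run_space S N \<nu>)"
    using ev by (simp add: nn_integral_cmult emeasure_eq_measure stop_prob_def ennreal_mult)
  also have "\<dots> = (\<integral>\<^sup>+w. (\<Sum>q\<in>Q. ennreal (real (Suc R)) * indicator (stop_event \<nu> (?g q)) w) \<partial>run_space S N \<nu>)"
    using ev by (intro nn_integral_sum[symmetric]) auto
  also have "\<dots> \<le> expected_budget S N \<nu>"
    unfolding expected_budget_def
  proof (rule nn_integral_mono)
    fix w assume w: "w \<in> space (run_space S N \<nu>)"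
    show "(\<Sum>q\<in>Q. ennreal (real (Suc R)) * indicator (stop_event \<nu> (?g q)) w)
        \<le> ennreal_of_enat (stop_time S (fst w) (snd w))"
    proof (cases "stop_time S (fst w) (snd w)")
      case (enat t)
      let ?h = "traj S (fst w) (snd w) t"
      have int: "pulls t (B q) ?h = real (card {s\<in>{..<t}. fst (?h s) \<in> B q})" for q
        by (simp add: hsum_def indicator_def sum.If_cases Int_def)
      have "(\<Sum>q\<in>Q. ennreal (real (Suc R)) * indicator (stop_event \<nu> (?g q)) w) \<le> (\<Sum>q\<in>Q. ennreal (pulls t (B q) ?h))"
      proof (rule sum_mono)
        fix q
        show "ennreal (real (Suc R)) * indicator (stop_event \<nu> (?g q)) w \<le> ennreal (pulls t (B q) ?h)"
        proof (cases "w \<in> stop_event \<nu> (?g q)")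
          case True
          then have "\<not> pulls t (B q) ?h \<le> real R" using enat by (auto simp: stop_event_def)
          \<comment> \<open>The count is an integer, so exceeding R means reaching
            \<open>Suc R\<close>. This gain allows R to be a floor later, and it is what makes the
            case of limit 0 meaningful.\<close>
          then have "real (Suc R) \<le> pulls t (B q) ?h" unfolding int by (simp add: not_le)
          then show ?thesis using True by (simp add: ennreal_leI del: of_nat_Suc)
        qed simp
      qed
      also have "\<dots> = ennreal (\<Sum>q\<in>Q. pulls t (B q) ?h)"
        by (intro sum_ennreal) (auto simp: hsum_def sum_nonneg)
      also have "\<dots> \<le> ennreal (real t)" by (intro ennreal_leI sum_pulls_le Q)
      finally show ?thesis using enat by (simp add: ennreal_of_nat_eq_real_of_nat)
    qed simp
  qed
  finally show ?thesis .
qed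

lemma good_meas_pulls: "good_meas (\<lambda>t h. pulls t B h \<le> c)"
  unfolding good_meas_def using hsum_measurable[of "\<lambda>a _. indicator B a"]
  by (auto intro!: borel_measurable_le)

lemma good_meas_out: "good_meas (\<lambda>t h. out_rule S t h = G)"
  using valid by (auto simp: good_meas_def valid_strategy_def)

lemma good_meas_conj: "good_meas f \<Longrightarrow> good_meas g \<Longrightarrow> good_meas (\<lambda>t h. f t h \<and> g t h)"
  by (auto simp: good_meas_def intro: sets.sets_Collect)

lemma good_meas_not: "good_meas f \<Longrightarrow> good_meas (\<lambda>t h. \<not> f t h)"
  by (auto simp: good_meas_def intro: sets.sets_Collect)

lemma stop_prob_conj_ge:
  assumes \<nu>: "arm_laws N d \<nu>" and "good_meas f" "good_meas g"
  shows "stop_prob \<nu> f - stop_prob \<nu> (\<lambda>t h. \<not> g t h) \<le> stop_prob \<nu> (\<lambda>t h. f t h \<and> g t h)"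
proof -
  interpret prob_space "run_space S N \<nu>" by (rule prob_space_run[OF \<nu>])
  have "stop_prob \<nu> f \<le> measure (run_space S N \<nu>) (stop_event \<nu> (\<lambda>t h. f t h \<and> g t h) \<union> stop_event \<nu> (\<lambda>t h. \<not> g t h))"
    unfolding stop_prob_def
    by (intro finite_measure_mono sets.Un stop_event_sets \<nu> good_meas_conj good_meas_not assms)
       (auto simp: stop_event_def)
  also have "\<dots> \<le> stop_prob \<nu> (\<lambda>t h. f t h \<and> g t h) + stop_prob \<nu> (\<lambda>t h. \<not> g t h)"
    unfolding stop_prob_def
    by (intro measure_Un_le stop_event_sets \<nu> good_meas_conj good_meas_not assms)
  finally show ?thesis by simp
qed

lemma sum_stop_prob_out_le:
  assumes \<nu>: "arm_laws N d \<nu>" and Q: "finite Q" "inj_on G Q"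
    and f: "\<And>q. q \<in> Q \<Longrightarrow> good_meas (f q)"
  shows "(\<Sum>q\<in>Q. stop_prob \<nu> (\<lambda>t h. out_rule S t h = G q \<and> f q t h)) \<le> 1"
proof -
  interpret prob_space "run_space S N \<nu>" by (rule prob_space_run[OF \<nu>])
  let ?A = "\<lambda>q. stop_event \<nu> (\<lambda>t h. out_rule S t h = G q \<and> f q t h)"
  have "(\<Sum>q\<in>Q. measure (run_space S N \<nu>) (?A q)) = measure (run_space S N \<nu>) (\<Union>q\<in>Q. ?A q)"
  proof (rule finite_measure_finite_Union[symmetric, OF Q(1)])
    show "?A ` Q \<subseteq> sets (run_space S N \<nu>)"
      by (auto intro!: stop_event_sets \<nu> good_meas_conj good_meas_out f)
    show "disjoint_family_on ?A Q"
      using Q(2) by (auto simp: disjoint_family_on_def stop_event_def inj_on_def)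
  qed
  also have "\<dots> \<le> 1" by simp
  finally show ?thesis by (simp add: stop_prob_def)
qed

lemma success_prob_eq:
  "success_prob S N K d \<nu> = stop_prob \<nu> (\<lambda>t h. out_rule S t h = true_partition N K d \<nu>)"
  by (simp add: success_prob_def stop_prob_def stop_event_def)

end

section \<open>Gaussian arms\<close>

abbreviation normal_law :: "real \<Rightarrow> real \<Rightarrow> real measure" where
  "normal_law \<sigma> m \<equiv> density lborel (\<lambda>x. ennreal (normal_density m \<sigma> x))"

definition gauss :: "real \<Rightarrow> nat \<Rightarrow> obs \<Rightarrow> obs measure" where
  "gauss \<sigma> d m = (\<Pi>\<^sub>M i\<in>{..<d}. normal_law \<sigma> (m i))"

lemma normal_density_tilt:
  assumes "\<sigma> > 0"
  shows "normal_density b \<sigma> x * exp ((e * (x - b) - e^2 / 2) / \<sigma>^2) = normal_density (b + e) \<sigma> x"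
proof -
  have "- ((x - b)^2) / (2 * \<sigma>^2) + (e * (x - b) - e^2 / 2) / \<sigma>^2 = - ((x - (b + e))^2) / (2 * \<sigma>^2)"
    using assms by (simp add: field_simps power2_eq_square)
  then show ?thesis unfolding normal_density_def by (simp add: exp_add[symmetric])
qed

lemma normal_law_tilt:
  assumes "\<sigma> > 0"
  shows "density (normal_law \<sigma> b) (\<lambda>x. ennreal (exp ((e * (x - b) - e^2 / 2) / \<sigma>^2))) = normal_law \<sigma> (b + e)"
  by (subst density_density_eq) (auto simp: ennreal_mult[symmetric] normal_density_tilt[OF assms])

lemma normal_law_exp:
  assumes "\<sigma> > 0"
  shows "has_bochner_integral (normal_law \<sigma> b) (\<lambda>x. exp (k * (x - b))) (exp (k^2 * \<sigma>^2 / 2))"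
proof -
  \<comment> \<open>Completing the square: the factor exp (k (x - b)) shifts the mean by k
    \<sigma>^2, up to a constant.\<close>
  have eq: "normal_density b \<sigma> x * exp (k * (x - b)) = exp (k^2 * \<sigma>^2 / 2) * normal_density (b + k * \<sigma>^2) \<sigma> x" for x
  proof -
    have "k * (x - b) = k^2 * \<sigma>^2 / 2 + (k * \<sigma>^2 * (x - b) - (k * \<sigma>^2)^2 / 2) / \<sigma>^2"
      using assms by (simp add: field_simps power2_eq_square)
    then have "exp (k * (x - b)) = exp (k^2 * \<sigma>^2 / 2) * exp ((k * \<sigma>^2 * (x - b) - (k * \<sigma>^2)^2 / 2) / \<sigma>^2)"
      by (simp only: exp_add)
    then show ?thesis
      using normal_density_tilt[OF assms, of b x "k * \<sigma>^2", symmetric] by (simp add: mult_ac)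
  qed
  have "has_bochner_integral lborel (\<lambda>x. exp (k^2 * \<sigma>^2 / 2) * normal_density (b + k * \<sigma>^2) \<sigma> x) (exp (k^2 * \<sigma>^2 / 2) * 1)"
    using assms by (intro has_bochner_integral_mult_right) (simp add: has_bochner_integral_iff)
  then show ?thesis
    by (intro has_bochner_integral_density) (auto simp: eq)
qed

lemma normal_law_cosh:
  assumes "\<sigma> > 0"
  shows "has_bochner_integral (normal_law \<sigma> b) (\<lambda>x. cosh (k * (c + s * (x - b)))) (exp (k^2 * s^2 * \<sigma>^2 / 2) * cosh (k * c))"
    and "has_bochner_integral (normal_law \<sigma> b) (\<lambda>x. sinh (k * (c + s * (x - b)))) (exp (k^2 * s^2 * \<sigma>^2 / 2) * sinh (k * c))"
proof -
  have p: "has_bochner_integral (normal_law \<sigma> b) (\<lambda>x. exp (k * (c + s * (x - b)))) (exp (k^2 * s^2 * \<sigma>^2 / 2) * exp (k * c))" for k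
  proof -
    have "has_bochner_integral (normal_law \<sigma> b) (\<lambda>x. exp (k * c) * exp ((k * s) * (x - b))) (exp (k * c) * exp ((k * s)^2 * \<sigma>^2 / 2))"
      by (intro has_bochner_integral_mult_right normal_law_exp assms)
    then show ?thesis by (simp add: exp_add[symmetric] algebra_simps power_mult_distrib)
  qed
  have q: "has_bochner_integral (normal_law \<sigma> b) (\<lambda>x. exp (- (k * (c + s * (x - b))))) (exp (k^2 * s^2 * \<sigma>^2 / 2) * exp (- (k * c)))"
    using p[of "- k"] by simp
  show "has_bochner_integral (normal_law \<sigma> b) (\<lambda>x. cosh (k * (c + s * (x - b)))) (exp (k^2 * s^2 * \<sigma>^2 / 2) * cosh (k * c))"
    using has_bochner_integral_divide[OF has_bochner_integral_add[OF p[of k] q], of 2]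
    by (simp add: cosh_field_def algebra_simps add_divide_distrib)
  show "has_bochner_integral (normal_law \<sigma> b) (\<lambda>x. sinh (k * (c + s * (x - b)))) (exp (k^2 * s^2 * \<sigma>^2 / 2) * sinh (k * c))"
    using has_bochner_integral_divide[OF has_bochner_integral_diff[OF p[of k] q], of 2]
    by (simp add: sinh_field_def algebra_simps diff_divide_distrib)
qed

lemma product_prob_space_normal: "\<sigma> > 0 \<Longrightarrow> product_prob_space (\<lambda>i. normal_law \<sigma> (m i))"
  by (intro product_prob_spaceI prob_space_normal_density)

lemma prob_space_gauss: "\<sigma> > 0 \<Longrightarrow> prob_space (gauss \<sigma> d m)"
  unfolding gauss_def by (intro prob_space_PiM prob_space_normal_density)

lemma sets_gauss: "sets (gauss \<sigma> d m) = sets (obs_space d)"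
  unfolding gauss_def obs_space_def by (intro sets_PiM_cong) auto

lemma nn_integral_gauss_prod:
  assumes "\<sigma> > 0" "\<And>i. i < d \<Longrightarrow> f i \<in> borel_measurable borel"
  shows "(\<integral>\<^sup>+x. (\<Prod>i<d. f i (x i)) \<partial>gauss \<sigma> d b) = (\<Prod>i<d. \<integral>\<^sup>+x. f i x \<partial>normal_law \<sigma> (b i))"
proof -
  interpret product_prob_space "\<lambda>i. normal_law \<sigma> (b i)" by (rule product_prob_space_normal[OF assms(1)])
  show ?thesis unfolding gauss_def by (rule product_nn_integral_prod) (use assms in auto)
qed

lemma gauss_tilt:
  assumes "\<sigma> > 0"
  shows "gauss \<sigma> d (\<lambda>i. b i + e i) =
    density (gauss \<sigma> d b) (\<lambda>x. ennreal (exp (\<Sum>i<d. (e i * (x i - b i) - (e i)^2 / 2) / \<sigma>^2)))"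
proof -
  interpret product_prob_space "\<lambda>i. normal_law \<sigma> (b i + e i)" by (rule product_prob_space_normal[OF assms(1)])
  let ?f = "\<lambda>i x. ennreal (exp ((e i * (x - b i) - (e i)^2 / 2) / \<sigma>^2))"
  let ?F = "\<lambda>x. ennreal (exp (\<Sum>i<d. (e i * (x i - b i) - (e i)^2 / 2) / \<sigma>^2))"
  have F: "?F x = (\<Prod>i<d. ?f i (x i))" for x
    by (simp add: exp_sum prod_ennreal)
  have sets_eq: "sets (gauss \<sigma> d b) = sets (\<Pi>\<^sub>M i\<in>{..<d}. (borel::real measure))"
    by (simp add: sets_gauss obs_space_def)
  have Fm: "?F \<in> borel_measurable (gauss \<sigma> d b)"
  proof -
    have "?F \<in> borel_measurable (\<Pi>\<^sub>M i\<in>{..<d}. (borel::real measure))" by measurable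
    then show ?thesis using measurable_cong_sets[OF sets_eq refl] by blast
  qed
  show ?thesis unfolding gauss_def[of \<sigma> d "\<lambda>i. b i + e i"]
  proof (rule PiM_eqI[symmetric])
    show "sets (density (gauss \<sigma> d b) ?F) = sets (\<Pi>\<^sub>M i\<in>{..<d}. normal_law \<sigma> (b i + e i))"
      unfolding sets_density sets_eq by (intro sets_PiM_cong) auto
    fix A assume A: "\<And>i. i \<in> {..<d} \<Longrightarrow> A i \<in> sets (normal_law \<sigma> (b i + e i))"
    have Pi: "Pi\<^sub>E {..<d} A \<in> sets (gauss \<sigma> d b)"
      unfolding gauss_def using A by (intro sets_PiM_I_finite) auto
    have "emeasure (density (gauss \<sigma> d b) ?F) (Pi\<^sub>E {..<d} A) =
        (\<integral>\<^sup>+x. ?F x * indicator (Pi\<^sub>E {..<d} A) x \<partial>gauss \<sigma> d b)"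
      by (rule emeasure_density[OF Fm Pi])
    also have "\<dots> = (\<integral>\<^sup>+x. (\<Prod>i<d. ?f i (x i) * indicator (A i) (x i)) \<partial>gauss \<sigma> d b)"
    proof (rule nn_integral_cong)
      fix x assume "x \<in> space (gauss \<sigma> d b)"
      then have "x \<in> extensional {..<d}" by (auto simp: gauss_def space_PiM PiE_def)
      then have "indicator (Pi\<^sub>E {..<d} A) x = (\<Prod>i<d. indicator (A i) (x i) :: ennreal)"
        by (auto simp: indicator_def PiE_def Pi_def prod_eq_1_iff split: if_splits intro!: prod_zero[symmetric])
      then show "?F x * indicator (Pi\<^sub>E {..<d} A) x = (\<Prod>i<d. ?f i (x i) * indicator (A i) (x i))"
        unfolding F by (simp add: prod.distrib)
    qed
    also have "\<dots> = (\<Prod>i<d. \<integral>\<^sup>+x. ?f i x * indicator (A i) x \<partial>normal_law \<sigma> (b i))"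
      using A by (intro nn_integral_gauss_prod assms) auto
    also have "\<dots> = (\<Prod>i<d. emeasure (normal_law \<sigma> (b i + e i)) (A i))"
    proof (rule prod.cong[OF refl])
      fix i assume "i \<in> {..<d}"
      then show "(\<integral>\<^sup>+x. ?f i x * indicator (A i) x \<partial>normal_law \<sigma> (b i)) = emeasure (normal_law \<sigma> (b i + e i)) (A i)"
        using A[of i] by (subst normal_law_tilt[OF assms, symmetric], subst emeasure_density) auto
    qed
    finally show "emeasure (density (gauss \<sigma> d b) ?F) (Pi\<^sub>E {..<d} A) = (\<Prod>i<d. emeasure (normal_law \<sigma> (b i + e i)) (A i))" .
  qed auto
qed

section \<open>Marginals, means and the subGaussian property of Gaussian arms\<close>

lemma distr_gauss_component:
  assumes "\<sigma> > 0" "i < d"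
  shows "distr (gauss \<sigma> d m) borel (\<lambda>x. x i) = normal_law \<sigma> (m i)"
proof -
  have "distr (gauss \<sigma> d m) (normal_law \<sigma> (m i)) (\<lambda>x. x i) = normal_law \<sigma> (m i)"
    unfolding gauss_def by (rule distr_PiM_component) (use assms in \<open>auto intro: prob_space_normal_density\<close>)
  moreover have "distr (gauss \<sigma> d m) (normal_law \<sigma> (m i)) (\<lambda>x. x i) = distr (gauss \<sigma> d m) borel (\<lambda>x. x i)"
    by (rule distr_cong) auto
  ultimately show ?thesis by simp
qed

lemma gauss_component_measurable: "i < d \<Longrightarrow> (\<lambda>x. x i) \<in> borel_measurable (gauss \<sigma> d m)"
  unfolding measurable_cong_sets[OF sets_gauss refl] obs_space_def
  by (rule measurable_component_singleton) simp

lemma integral_gauss_component: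
  assumes "\<sigma> > 0" "i < d" "has_bochner_integral (normal_law \<sigma> (m i)) f I" "f \<in> borel_measurable borel"
  shows "has_bochner_integral (gauss \<sigma> d m) (\<lambda>x. f (x i)) (I::real)"
  using assms(3) assms(4) gauss_component_measurable[OF assms(2), of \<sigma> m]
  unfolding distr_gauss_component[OF assms(1,2), symmetric]
  by (auto simp: has_bochner_integral_iff integrable_distr_eq integral_distr)

lemma normal_law_mean: "\<sigma> > 0 \<Longrightarrow> has_bochner_integral (normal_law \<sigma> m) (\<lambda>x. x) m"
  using normal_moment_nz_1[of \<sigma> m] by (intro has_bochner_integral_density) auto

lemma mean_gauss: "\<sigma> > 0 \<Longrightarrow> mean d (gauss \<sigma> d m) = restrict m {..<d}"
  using integral_gauss_component[OF _ _ normal_law_mean, of \<sigma> _ d m]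
  by (intro ext) (simp add: mean_def has_bochner_integral_iff)

lemma indep_gauss_components:
  assumes "\<sigma> > 0" "d \<ge> 1"
  shows "prob_space.indep_vars (gauss \<sigma> d m) (\<lambda>_. borel) (\<lambda>i x. x i) {..<d}"
proof -
  interpret prob_space "gauss \<sigma> d m" by (rule prob_space_gauss[OF assms(1)])
  have s: "sets (gauss \<sigma> d m) = sets (\<Pi>\<^sub>M i\<in>{..<d}. (borel::real measure))"
    by (simp add: sets_gauss obs_space_def)
  have "distr (gauss \<sigma> d m) (\<Pi>\<^sub>M i\<in>{..<d}. borel) (\<lambda>x. \<lambda>i\<in>{..<d}. x i) =
      distr (gauss \<sigma> d m) (gauss \<sigma> d m) (\<lambda>x. x)"
    by (rule distr_cong[OF refl s[symmetric]]) (auto simp: gauss_def space_PiM PiE_def extensional_restrict)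
  also have "\<dots> = gauss \<sigma> d m" by (rule distr_id)
  also have "\<dots> = (\<Pi>\<^sub>M i\<in>{..<d}. distr (gauss \<sigma> d m) borel (\<lambda>x. x i))"
    by (subst gauss_def, rule PiM_cong[OF refl], subst distr_gauss_component[OF assms(1)]) auto
  finally show ?thesis
    using assms(2) gauss_component_measurable[of _ d \<sigma> m]
    by (subst indep_vars_iff_distr_eq_PiM') (auto simp: lessThan_empty_iff)
qed

lemma subgaussian_gauss:
  assumes \<sigma>: "\<sigma> > 0" and d: "d \<ge> 1"
  shows "subgaussian_arm \<sigma> d (gauss \<sigma> d m)"
proof -
  interpret prob_space "gauss \<sigma> d m" by (rule prob_space_gauss[OF \<sigma>])
  define Sig where "Sig = (\<lambda>i j::nat. if i = j then \<sigma>^2 else 0)"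
  define B where "B = (\<lambda>i j::nat. if i = j then 1 / \<sigma> else 0)"
  have E: "(\<Sum>j<d. B i j * (x j - mean d (gauss \<sigma> d m) j)) = (x i - m i) / \<sigma>" if "i < d" for i x
    using that by (simp add: B_def mean_gauss[OF \<sigma>] if_distrib[of "\<lambda>z. z * _"] sum.delta' cong: if_cong)
  have "sym_mat d Sig" "sym_mat d B" by (auto simp: sym_mat_def Sig_def B_def)
  moreover have "op_norm d Sig \<le> \<sigma>^2"
    unfolding op_norm_def
  proof (rule cSup_least)
    have "vnorm d (\<lambda>_. 0) \<le> 1" by (simp add: vnorm_def)
    then show "{vnorm d (mat_vec d Sig x) |x. vnorm d x \<le> 1} \<noteq> {}" by blast
  next
    fix y assume "y \<in> {vnorm d (mat_vec d Sig x) |x. vnorm d x \<le> 1}"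
    then obtain x where x: "y = vnorm d (mat_vec d Sig x)" "vnorm d x \<le> 1" by blast
    have "mat_vec d Sig x i = \<sigma>^2 * x i" if "i < d" for i
      using that by (simp add: mat_vec_def Sig_def if_distrib[of "\<lambda>z. z * _"] sum.delta' cong: if_cong)
    then have "y = sqrt (\<Sum>i<d. (\<sigma>^2)^2 * (x i)^2)"
      unfolding x vnorm_def by (simp add: power_mult_distrib)
    also have "\<dots> = \<sigma>^2 * vnorm d x"
      unfolding sum_distrib_left[symmetric] vnorm_def real_sqrt_mult real_sqrt_abs by simp
    also have "\<dots> \<le> \<sigma>^2" using x(2) by (simp add: mult_left_le)
    finally show "y \<le> \<sigma>^2" .
  qed
  moreover have "pos_def_mat d B"
    unfolding pos_def_mat_def
  proof (intro allI impI)
    fix x :: obs assume "\<exists>i<d. x i \<noteq> 0"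
    then obtain i where i: "i < d" "x i \<noteq> 0" by blast
    have "(\<Sum>i<d. \<Sum>j<d. x i * B i j * x j) = (\<Sum>i<d. (x i)^2 / \<sigma>)"
      by (intro sum.cong refl) (simp add: B_def if_distrib[of "\<lambda>z. _ * z"] if_distrib[of "\<lambda>z. z * _"] sum.delta' power2_eq_square cong: if_cong)
    also have "\<dots> > 0" using i \<sigma> by (intro sum_pos2[of _ i]) auto
    finally show "(\<Sum>i<d. \<Sum>j<d. x i * B i j * x j) > 0" .
  qed
  moreover have "(\<Sum>j<d. \<Sum>l<d. B i j * B j l * Sig l k) = (if i = k then 1 else 0)" if "i < d" "k < d" for i k
  proof -
    have "(\<Sum>l<d. B i j * B j l * Sig l k) = B i j * (1 / \<sigma>) * Sig j k" if "j < d" for j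
      using that by (simp add: B_def if_distrib[of "\<lambda>z. _ * z"] if_distrib[of "\<lambda>z. z * _"] sum.delta' cong: if_cong)
    then have "(\<Sum>j<d. \<Sum>l<d. B i j * B j l * Sig l k) = (\<Sum>j<d. B i j * (1 / \<sigma>) * Sig j k)" by simp
    also have "\<dots> = (1 / \<sigma>) * (1 / \<sigma>) * Sig i k"
      using that by (simp add: B_def if_distrib[of "\<lambda>z. z * _"] sum.delta' sum_divide_distrib[symmetric] cong: if_cong)
    finally show ?thesis using \<sigma> by (simp add: Sig_def power2_eq_square)
  qed
  ultimately have mats: "sym_mat d Sig \<and> op_norm d Sig \<le> \<sigma>^2 \<and> is_inv_sqrt d Sig B"
    by (auto simp: is_inv_sqrt_def)
  have "indep_vars (\<lambda>_. borel) (\<lambda>i x. (x i - m i) / \<sigma>) {..<d}"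
    using indep_vars_compose2[OF indep_gauss_components[OF \<sigma> d, of m], of "\<lambda>i y. (y - m i) / \<sigma>" "\<lambda>_. borel"] by simp
  then have ind: "indep_vars (\<lambda>_. borel) (\<lambda>i x. \<Sum>j<d. B i j * (x j - mean d (gauss \<sigma> d m) j)) {..<d}"
    by (subst indep_vars_cong[OF refl _ refl, of _ _ "\<lambda>i x. (x i - m i) / \<sigma>"]) (auto simp: E fun_eq_iff)
  have "has_bochner_integral (gauss \<sigma> d m) (\<lambda>x. exp (t * ((x i - m i) / \<sigma>))) (exp (t^2 / 2))" if "i < d" for i t
    using integral_gauss_component[where f = "\<lambda>y. exp (t / \<sigma> * (y - m i))" and m = m, OF \<sigma> that normal_law_exp[OF \<sigma>]] \<sigma>
    by (simp add: power_divide)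
  then have "\<forall>i<d. \<forall>t::real. integrable (gauss \<sigma> d m) (\<lambda>x. exp (t * (\<Sum>j<d. B i j * (x j - mean d (gauss \<sigma> d m) j)))) \<and>
      (\<integral>x. exp (t * (\<Sum>j<d. B i j * (x j - mean d (gauss \<sigma> d m) j))) \<partial>gauss \<sigma> d m) \<le> exp (t^2 / 2)"
    by (auto simp: E has_bochner_integral_iff)
  moreover have "\<forall>i<d. integrable (gauss \<sigma> d m) (\<lambda>x. x i)"
    using integral_gauss_component[where f = "\<lambda>y. y" and m = m and d = d, OF \<sigma> _ normal_law_mean[OF \<sigma>]] by (auto simp: has_bochner_integral_iff)
  ultimately show ?thesis
    unfolding subgaussian_arm_def Let_def using mats ind by blast
qed

section \<open>The hard environments\<close>

text \<open>Arms \<open>2q\<close> and \<open>2q + 1\<close> form a pair of opposite signs, and \<open>s\<close> is the set of swapped pairs. Blocks consist of \<open>m\<close>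
  consecutive pairs and carry the two labels \<open>2j\<close> and \<open>2j + 1\<close>; surplus arms get the last label. Pairs with
  \<open>q mod m = 0\<close> are never swapped: swapping all pairs of a block yields the same partition, and fixing one pair per block
  makes the partition determine \<open>s\<close>.\<close>

definition arm_label :: "nat \<Rightarrow> nat \<Rightarrow> nat set \<Rightarrow> nat \<Rightarrow> nat" where
  "arm_label m K s c = (if c < 2 * m * (K div 2) then 2 * (c div (2 * m)) + of_bool (odd c \<noteq> (c div 2 \<in> s)) else K - 1)"

definition flippable :: "nat \<Rightarrow> nat \<Rightarrow> nat set" where
  "flippable m K = {q. q < m * (K div 2) \<and> q mod m \<noteq> 0}"

definition label_partition :: "nat \<Rightarrow> nat \<Rightarrow> nat \<Rightarrow> nat set \<Rightarrow> nat set set" where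
  "label_partition N m K s = (\<lambda>k. {c. c < N \<and> arm_label m K s c = k}) ` {..<K}"

definition flip :: "nat \<Rightarrow> nat set \<Rightarrow> nat set" where
  "flip q s = (s - {q}) \<union> ({q} - s)"

text \<open>Different blocks are far apart along the first axis; inside block \<open>j\<close> the two centres are \<open>\<plusminus>\<close> a vertex of the cube of
  half-width \<open>\<Delta> / (2 sqrt d)\<close>, selected by \<open>{i. (j, i) \<in> \<theta>}\<close>, hence at distance exactly \<open>\<Delta>\<close>.\<close>

definition centre :: "real \<Rightarrow> nat \<Rightarrow> (nat \<times> nat) set \<Rightarrow> nat \<Rightarrow> obs" where
  "centre \<Delta> d \<theta> k i = (if i = 0 then 4 * \<Delta> * real (k div 2) else 0) +
     (if even k then 1 else -1) * ((if (k div 2, i) \<in> \<theta> then 1 else -1) * (\<Delta> / (2 * sqrt d)))"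

definition hard_env :: "real \<Rightarrow> real \<Rightarrow> nat \<Rightarrow> nat \<Rightarrow> nat \<Rightarrow> nat set \<Rightarrow> (nat \<times> nat) set \<Rightarrow> nat \<Rightarrow> obs measure" where
  "hard_env \<sigma> \<Delta> d m K s \<theta> a = gauss \<sigma> d (centre \<Delta> d \<theta> (arm_label m K s a))"

lemma flip_flip [simp]: "flip q (flip q s) = s"
  by (auto simp: flip_def)

lemma flip_Pow: "q \<in> A \<Longrightarrow> flip q s \<in> Pow A \<longleftrightarrow> s \<in> Pow A"
  by (auto simp: flip_def)

text \<open>Reindexing by an involution. It turns the wrong answer \<open>s\<close> in the
  environment \<open>flip q s\<close> into the wrong answer \<open>flip q s\<close> in the
  environment \<open>s\<close>. For fixed \<open>s\<close> these answers are distinct, so their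
  probabilities can be added.\<close>

lemma sum_flip:
  assumes "q \<in> A"
  shows "(\<Sum>s\<in>Pow A. f (flip q s) s) = (\<Sum>s\<in>Pow A. f s (flip q s))"
  by (rule sum.reindex_bij_witness[of _ "flip q" "flip q"]) (use assms flip_Pow in auto)

text \<open>Writing q = j * m + i, each block j contributes the m - 1 residues i different from 0. A
  bound averaged over blocks thus becomes one averaged over pairs.\<close>

lemma sum_flippable:
  assumes "m \<ge> 1"
  shows "(\<Sum>q\<in>flippable m K. f (q div m)) = real (m - 1) * (\<Sum>j<K div 2. f j :: real)"
proof -
  have "(\<Sum>q\<in>flippable m K. f (q div m)) = (\<Sum>z\<in>{..<K div 2} \<times> {1..<m}. f (fst z))"
  proof (rule sum.reindex_bij_witness[of _ "\<lambda>z. fst z * m + snd z" "\<lambda>q. (q div m, q mod m)"])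
    fix z assume "z \<in> {..<K div 2} \<times> {1..<m}"
    then have z: "fst z < K div 2" "1 \<le> snd z" "snd z < m" by auto
    then have "fst z * m + snd z < Suc (fst z) * m" by simp
    also have "\<dots> \<le> (K div 2) * m" using z by (intro mult_le_mono) auto
    finally show "fst z * m + snd z \<in> flippable m K" using z by (auto simp: flippable_def mult.commute)
    show "((fst z * m + snd z) div m, (fst z * m + snd z) mod m) = z" using z by (cases z) auto
  next
    fix q assume "q \<in> flippable m K"
    then show "(q div m, q mod m) \<in> {..<K div 2} \<times> {1..<m}"
      using assms by (auto simp: flippable_def less_mult_imp_div_less mult.commute)
  qed auto
  also have "\<dots> = (\<Sum>j<K div 2. \<Sum>i\<in>{1..<m}. f j)"
    unfolding sum.cartesian_product split_def ..
  also have "\<dots> = real (m - 1) * (\<Sum>j<K div 2. f j)"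
    by (simp add: sum_distrib_left)
  finally show ?thesis .
qed

lemma finite_flippable [simp]: "finite (flippable m K)"
  by (auto simp: flippable_def)

lemma card_flippable: "m \<ge> 1 \<Longrightarrow> real (card (flippable m K)) = real (m - 1) * real (K div 2)"
  using sum_flippable[of m "\<lambda>_. 1" K] by simp

section \<open>Partitions and membership in the environment class\<close>

lemma hidden_partition_unique:
  assumes "hidden_partition N K d \<nu> G"
  shows "G = (\<lambda>a. {b. b < N \<and> mean d (\<nu> b) = mean d (\<nu> a)}) ` {..<N}" (is "G = ?f ` _")
proof -
  have P: "is_partition N K G" and M: "\<And>a b. a < N \<Longrightarrow> b < N \<Longrightarrow>
      mean d (\<nu> a) = mean d (\<nu> b) \<longleftrightarrow> (\<exists>g\<in>G. a \<in> g \<and> b \<in> g)"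
    using assms by (auto simp: hidden_partition_def)
  have lt: "a < N" if "a \<in> g" "g \<in> G" for a g using P that by (auto simp: is_partition_def)
  have eq: "g = ?f a" if ag: "g \<in> G" "a \<in> g" for g a
  proof -
    have "b \<in> g \<longleftrightarrow> b \<in> ?f a" for b
    proof
      assume "b \<in> g" then show "b \<in> ?f a" using M[of b a] lt ag by auto
    next
      assume "b \<in> ?f a"
      then obtain g' where "g' \<in> G" "a \<in> g'" "b \<in> g'" using M[of b a] lt[OF ag(2,1)] by auto
      moreover have "\<forall>g\<in>G. \<forall>g'\<in>G. g \<noteq> g' \<longrightarrow> g \<inter> g' = {}" using P by (simp add: is_partition_def)
      ultimately show "b \<in> g" using ag by blast
    qed
    then show ?thesis by blast
  qed
  show ?thesis
  proof
    show "G \<subseteq> ?f ` {..<N}"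
    proof
      fix g assume g: "g \<in> G"
      then have "g \<noteq> {}" using P by (simp add: is_partition_def)
      then obtain a where "a \<in> g" by (auto simp: ex_in_conv[symmetric])
      then show "g \<in> ?f ` {..<N}" using eq[OF g] lt g by blast
    qed
    show "?f ` {..<N} \<subseteq> G"
    proof
      fix h assume "h \<in> ?f ` {..<N}"
      then obtain a where a: "a < N" "h = ?f a" by blast
      have "a \<in> \<Union>G" using P a by (simp add: is_partition_def)
      then obtain g where "g \<in> G" "a \<in> g" by blast
      then show "h \<in> G" using eq a by metis
    qed
  qed
qed

lemma true_partition_eq: "hidden_partition N K d \<nu> G \<Longrightarrow> true_partition N K d \<nu> = G"
  unfolding true_partition_def
  by (rule the_equality) (auto dest: hidden_partition_unique)

text \<open>Pigeonhole: the smallest of K groups has at most \<open>N div K\<close> arms. This is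
  how nonemptiness enters the proof: the hard environments have at least \<open>N div K\<close> arms
  in every group, hence satisfy any balance constraint that can be satisfied at all.\<close>

lemma envs_nonempty_theta:
  assumes "envs \<Delta> \<theta> \<sigma> N K d \<noteq> {}" "K \<ge> 1" "N \<ge> 1"
  shows "\<theta> \<le> real (N div K) / real N"
proof -
  obtain \<nu> G where G: "hidden_partition N K d \<nu> G" and th: "theta_star N K d \<nu> \<ge> \<theta>"
    using assms(1) by (auto simp: envs_def)
  have P: "is_partition N K G" using G by (auto simp: hidden_partition_def)
  have fin: "finite G" "card G = K" using P assms(2) by (auto simp: is_partition_def intro: card_ge_0_finite)
  have "finite (\<Union>G)" using P by (auto simp: is_partition_def)
  then have fg: "finite g" if "g \<in> G" for g using that by (meson Union_upper finite_subset)
  have "K * Min (card ` G) = (\<Sum>g\<in>G. Min (card ` G))" using fin by simp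
  also have "\<dots> \<le> (\<Sum>g\<in>G. card g)" using fin by (intro sum_mono Min_le) auto
  also have "\<dots> = card (\<Union>G)"
    using P fg by (intro card_Union_disjoint[symmetric]) (auto simp: is_partition_def pairwise_def disjnt_def)
  also have "\<dots> = N" using P by (simp add: is_partition_def)
  finally have "Min (card ` G) \<le> N div K" using assms(2) by (simp add: less_eq_div_iff_mult_less_eq mult.commute)
  then have "theta_star N K d \<nu> \<le> real (N div K) / real N"
    unfolding theta_star_def true_partition_eq[OF G] by (intro divide_right_mono) auto
  then show ?thesis using th by simp
qed

lemma arm_label_less: "K \<ge> 2 \<Longrightarrow> arm_label m K s c < K"
proof (cases "c < 2 * m * (K div 2)")
  case True
  assume K: "K \<ge> 2"
  have "c div (2 * m) < K div 2" using True by (simp add: less_mult_imp_div_less mult.commute mult.assoc)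
  then show ?thesis using True by (auto simp: arm_label_def)
qed (auto simp: arm_label_def)

text \<open>Each of the m pairs of a block gives one arm to each of its two labels, swapped or not.
  If K is odd, the last label belongs to no block and receives the surplus, which has at least m
  arms.\<close>

lemma arm_label_group_card:
  assumes m: "m \<ge> 1" and N: "m * K \<le> N" and K: "K \<ge> 2" and k: "k < K"
  shows "m \<le> card {c. c < N \<and> arm_label m K s c = k}"
proof (cases "k < 2 * (K div 2)")
  case True
  define j where "j = k div 2"
  have j: "j < K div 2" using True by (auto simp: j_def)
  \<comment> \<open>From pair i of block j, \<open>f\<close> picks the member that carries label k,
    correcting the parity when the pair is swapped.\<close>
  define f where "f = (\<lambda>i. 2 * (j * m + i) + of_bool (odd k \<noteq> (j * m + i \<in> s)))"
  have half: "f i div 2 = j * m + i" for i by (simp add: f_def)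
  have inj: "inj_on f {..<m}" by (rule inj_onI) (metis half add_left_cancel)
  have sub: "f i \<in> {c. c < N \<and> arm_label m K s c = k}" if i: "i < m" for i
  proof -
    have b: "f i < 2 * m * Suc j" using i by (auto simp: f_def algebra_simps)
    have "2 * m * Suc j \<le> 2 * m * (K div 2)" using j by (intro mult_le_mono) auto
    then have lt: "f i < 2 * m * (K div 2)" using b by simp
    have "2 * m * (K div 2) \<le> m * K" by (metis mult.assoc mult.commute mult_le_mono2 times_div_less_eq_dividend)
    then have N': "f i < N" using lt N by linarith
    have "f i div (2 * m) = j"
      by (rule div_nat_eqI) (use b in \<open>auto simp: f_def algebra_simps\<close>)
    moreover note half[of i]
    moreover have "odd (f i) \<longleftrightarrow> (odd k \<noteq> (j * m + i \<in> s))" by (auto simp: f_def)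
    ultimately have "arm_label m K s (f i) = 2 * j + of_bool (odd k)" using lt by (auto simp: arm_label_def)
    then show ?thesis using N' by (auto simp: j_def)
  qed
  have "card (f ` {..<m}) \<le> card {c. c < N \<and> arm_label m K s c = k}"
    using sub by (intro card_mono) auto
  then show ?thesis using inj by (simp add: card_image)
next
  case False
  then have k': "k = K - 1" "K = 2 * (K div 2) + 1" using k by presburger+
  have "{2 * m * (K div 2)..<N} \<subseteq> {c. c < N \<and> arm_label m K s c = k}" using k' by (auto simp: arm_label_def)
  then have "card {2 * m * (K div 2)..<N} \<le> card {c. c < N \<and> arm_label m K s c = k}" by (intro card_mono) auto
  moreover have "m * K = 2 * m * (K div 2) + m"
  proof -
    have "m * K = m * (2 * (K div 2) + 1)" using k'(2) by simp
    then show ?thesis by (simp add: algebra_simps)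
  qed
  ultimately show ?thesis using N by simp
qed

lemma vnorm_ge_component: "i < d \<Longrightarrow> \<bar>x i\<bar> \<le> vnorm d x"
  unfolding vnorm_def by (metis finite_lessThan lessThan_iff member_le_sum real_sqrt_abs real_sqrt_le_iff zero_le_power2)

lemma centre_separated:
  assumes \<Delta>: "\<Delta> > 0" and d: "d \<ge> 1" and k: "k \<noteq> k'"
  shows "\<Delta> \<le> vnorm d (\<lambda>i. centre \<Delta> d \<theta> k i - centre \<Delta> d \<theta> k' i)"
proof (cases "k div 2 = k' div 2")
  case True
  have par: "even k \<noteq> even k'" using True k by presburger
  have sq: "(centre \<Delta> d \<theta> k i - centre \<Delta> d \<theta> k' i)^2 = \<Delta>^2 / real d" for i
    using par d by (auto simp: centre_def True power2_eq_square field_simps)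
  show ?thesis unfolding vnorm_def sq using \<Delta> d by simp
next
  case False
  \<comment> \<open>The cube terms of two centres differ by at most 2 e \<le> \<Delta> in the first
    coordinate, against a gap of at least 4 \<Delta> between blocks.\<close>
  define e where "e = \<Delta> / (2 * sqrt d)"
  have e: "0 \<le> e" "e \<le> \<Delta> / 2" using \<Delta> d by (auto simp: e_def field_simps)
  have "1 \<le> \<bar>real (k div 2) - real (k' div 2)\<bar>" using False by linarith
  then have "4 * \<Delta> * 1 \<le> 4 * \<Delta> * \<bar>real (k div 2) - real (k' div 2)\<bar>" using \<Delta> by (intro mult_left_mono) auto
  also have "\<dots> = \<bar>4 * \<Delta> * (real (k div 2) - real (k' div 2))\<bar>" using \<Delta> by (simp add: abs_mult)
  finally have *: "4 * \<Delta> \<le> \<bar>4 * \<Delta> * real (k div 2) - 4 * \<Delta> * real (k' div 2)\<bar>" by (simp add: right_diff_distrib)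
  have "\<Delta> \<le> \<bar>centre \<Delta> d \<theta> k 0 - centre \<Delta> d \<theta> k' 0\<bar>"
    unfolding centre_def e_def[symmetric] using * e \<Delta> by (auto split: if_splits)
  also have "\<dots> \<le> vnorm d (\<lambda>i. centre \<Delta> d \<theta> k i - centre \<Delta> d \<theta> k' i)"
    using d vnorm_ge_component[of 0 d "\<lambda>i. centre \<Delta> d \<theta> k i - centre \<Delta> d \<theta> k' i"] by simp
  finally show ?thesis .
qed

lemma same_group_label_partition:
  assumes "K \<ge> 2" "a < N" "b < N"
  shows "(\<exists>g\<in>label_partition N m K s. a \<in> g \<and> b \<in> g) \<longleftrightarrow> arm_label m K s a = arm_label m K s b"
  using assms arm_label_less[OF assms(1)] by (auto simp: label_partition_def)

lemma label_partition_inj: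
  assumes K: "K \<ge> 2" and N: "m * K \<le> N" and s: "s \<subseteq> flippable m K" "s' \<subseteq> flippable m K"
    and eq: "label_partition N m K s = label_partition N m K s'"
  shows "s = s'"
proof -
  \<comment> \<open>The pair q div m * m is the one never swapped in the block of q. Whether arm 2 q
    shares a group with its first arm is visible in the partition alone, without the labels.\<close>
  have key: "q \<in> s \<longleftrightarrow> arm_label m K s (2 * q) \<noteq> arm_label m K s (2 * (q div m * m))"
    if s: "s \<subseteq> flippable m K" and q: "q \<in> flippable m K" for s q
  proof -
    have m: "m > 0" and ql: "q < m * (K div 2)" using q by (auto simp: flippable_def intro: gr0I)
    have q0: "q div m * m < m * (K div 2)" using ql div_times_less_eq_dividend[of q m] by linarith
    have "q div m * m \<notin> s" using s by (auto simp: flippable_def)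
    then have "arm_label m K s (2 * (q div m * m)) = 2 * (q div m)" using q0 m by (simp add: arm_label_def)
    moreover have "arm_label m K s (2 * q) = 2 * (q div m) + of_bool (q \<in> s)" using ql m by (simp add: arm_label_def)
    ultimately show ?thesis by simp
  qed
  have "q \<in> s \<longleftrightarrow> q \<in> s'" if q: "q \<in> flippable m K" for q
  proof -
    have "2 * m * (K div 2) \<le> m * K" by (metis mult.assoc mult.commute mult_le_mono2 times_div_less_eq_dividend)
    moreover have "q < m * (K div 2)" using q by (auto simp: flippable_def)
    moreover have "q div m * m \<le> q" by simp
    ultimately have "2 * q < N" "2 * (q div m * m) < N" using N by linarith+
    then show ?thesis
      using key[OF s(1) q] key[OF s(2) q] same_group_label_partition[OF K, of _ N _ m] eq by metis
  qed
  then show ?thesis using s by blast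
qed

lemma hard_env_hidden_partition:
  assumes \<sigma>: "\<sigma> > 0" and \<Delta>: "\<Delta> > 0" and d: "d \<ge> 1" and m: "m \<ge> 1" and N: "m * K \<le> N" and K: "K \<ge> 2"
  shows "hidden_partition N K d (hard_env \<sigma> \<Delta> d m K s \<theta>) (label_partition N m K s)"
proof -
  let ?g = "\<lambda>k. {c. c < N \<and> arm_label m K s c = k}"
  have ne: "?g k \<noteq> {}" if "k < K" for k
    using arm_label_group_card[OF m N K that, of s] m by (metis card.empty not_one_le_zero order_trans)
  have inj: "inj_on ?g {..<K}"
  proof (rule inj_onI)
    fix k k' assume "k \<in> {..<K}" "?g k = ?g k'"
    then show "k = k'" using ne[of k] by fastforce
  qed
  have "is_partition N K (label_partition N m K s)"
    unfolding is_partition_def label_partition_def using ne arm_label_less[OF K] by (auto simp: card_image[OF inj])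
  moreover have "mean d (hard_env \<sigma> \<Delta> d m K s \<theta> a) = mean d (hard_env \<sigma> \<Delta> d m K s \<theta> b) \<longleftrightarrow> arm_label m K s a = arm_label m K s b" for a b
  proof
    assume "mean d (hard_env \<sigma> \<Delta> d m K s \<theta> a) = mean d (hard_env \<sigma> \<Delta> d m K s \<theta> b)"
    then have "restrict (centre \<Delta> d \<theta> (arm_label m K s a)) {..<d} = restrict (centre \<Delta> d \<theta> (arm_label m K s b)) {..<d}"
      by (simp add: hard_env_def mean_gauss[OF \<sigma>])
    then have "centre \<Delta> d \<theta> (arm_label m K s a) i = centre \<Delta> d \<theta> (arm_label m K s b) i" if "i < d" for i
      using that by (metis lessThan_iff restrict_apply')
    then have "vnorm d (\<lambda>i. centre \<Delta> d \<theta> (arm_label m K s a) i - centre \<Delta> d \<theta> (arm_label m K s b) i) = 0"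
      by (simp add: vnorm_def)
    then show "arm_label m K s a = arm_label m K s b" using centre_separated[OF \<Delta> d, of "arm_label m K s a" "arm_label m K s b" \<theta>] \<Delta> by force
  qed (simp add: hard_env_def)
  ultimately show ?thesis
    unfolding hidden_partition_def using same_group_label_partition[OF K] by auto
qed

lemma arm_laws_env: "\<sigma> > 0 \<Longrightarrow> arm_laws N d (hard_env \<sigma> \<Delta> d m K s \<theta>)"
  by (auto simp: arm_laws_def hard_env_def prob_space_gauss sets_gauss)

lemma hard_env_in_envs:
  assumes \<sigma>: "\<sigma> > 0" and \<Delta>: "\<Delta> > 0" and d: "d \<ge> 1" and m: "m = N div K" "m \<ge> 1" and K: "K \<ge> 2"
    and ne: "envs \<Delta> \<theta>0 \<sigma> N K d \<noteq> {}"
  shows "hard_env \<sigma> \<Delta> d m K s \<theta> \<in> envs \<Delta> \<theta>0 \<sigma> N K d"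
    and "true_partition N K d (hard_env \<sigma> \<Delta> d m K s \<theta>) = label_partition N m K s"
proof -
  let ?\<nu> = "hard_env \<sigma> \<Delta> d m K s \<theta>"
  have N: "m * K \<le> N" by (simp add: m)
  have hp: "hidden_partition N K d ?\<nu> (label_partition N m K s)" by (rule hard_env_hidden_partition[OF \<sigma> \<Delta> d m(2) N K])
  show tp: "true_partition N K d ?\<nu> = label_partition N m K s" by (rule true_partition_eq[OF hp])
  have fin: "finite (label_partition N m K s)" and pne: "label_partition N m K s \<noteq> {}" using K by (auto simp: label_partition_def lessThan_empty_iff)
  have gm: "\<exists>k. g = {c. c < N \<and> arm_label m K s c = k} \<and> (\<forall>i<d. group_mean d ?\<nu> g i = centre \<Delta> d \<theta> k i)"
    if g: "g \<in> label_partition N m K s" for g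
  proof -
    obtain k where k: "g = {c. c < N \<and> arm_label m K s c = k}" using g by (auto simp: label_partition_def)
    have "g \<noteq> {}" using hp g by (auto simp: hidden_partition_def is_partition_def)
    then have "(SOME a. a \<in> g) \<in> g" by (simp add: some_in_eq)
    then have "arm_label m K s (SOME a. a \<in> g) = k" using k by blast
    then show ?thesis using k by (auto simp: group_mean_def hard_env_def mean_gauss[OF \<sigma>])
  qed
  have "Delta_star N K d ?\<nu> \<ge> \<Delta>"
    unfolding Delta_star_def tp
  proof (subst Min_ge_iff)
    let ?F = "\<lambda>g g'. vnorm d (\<lambda>i. group_mean d ?\<nu> g i - group_mean d ?\<nu> g' i)"
    let ?D = "{?F g g' | g g'. g \<in> label_partition N m K s \<and> g' \<in> label_partition N m K s \<and> g \<noteq> g'}"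
    have "?D \<subseteq> (\<lambda>(g, g'). ?F g g') ` (label_partition N m K s \<times> label_partition N m K s)" by auto
    then show "finite ?D" using fin by (meson finite_SigmaI finite_imageI finite_subset)
    have "card (label_partition N m K s) = K" using hp by (auto simp: hidden_partition_def is_partition_def)
    then have "\<not> (\<exists>g. label_partition N m K s \<subseteq> {g})" using K by (metis card_mono card.empty card_insert_disjoint empty_iff finite.intros(1) finite_insert le_trans One_nat_def not_less_eq_eq numeral_2_eq_2)
    then show "?D \<noteq> {}" using pne by auto
    show "\<forall>x\<in>?D. \<Delta> \<le> x"
    proof
      fix x assume "x \<in> ?D"
      then obtain g g' where g: "x = ?F g g'" "g \<in> label_partition N m K s" "g' \<in> label_partition N m K s" "g \<noteq> g'" by blast
      obtain k k' where k: "g = {c. c < N \<and> arm_label m K s c = k}" "g' = {c. c < N \<and> arm_label m K s c = k'}"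
        "\<And>i. i < d \<Longrightarrow> group_mean d ?\<nu> g i = centre \<Delta> d \<theta> k i" "\<And>i. i < d \<Longrightarrow> group_mean d ?\<nu> g' i = centre \<Delta> d \<theta> k' i"
        using gm[OF g(2)] gm[OF g(3)] by blast
      have "k \<noteq> k'" using g(4) k by auto
      then have "\<Delta> \<le> vnorm d (\<lambda>i. centre \<Delta> d \<theta> k i - centre \<Delta> d \<theta> k' i)" by (rule centre_separated[OF \<Delta> d])
      also have "\<dots> = x" unfolding g(1) vnorm_def using k by simp
      finally show "\<Delta> \<le> x" .
    qed
  qed
  moreover have "theta_star N K d ?\<nu> \<ge> \<theta>0"
  proof -
    have "m \<le> Min (card ` label_partition N m K s)"
      using fin pne arm_label_group_card[OF m(2) N K] by (auto simp: label_partition_def)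
    then have "real m / real N \<le> theta_star N K d ?\<nu>"
      unfolding theta_star_def tp by (intro divide_right_mono) auto
    moreover have "N \<ge> 1" using m by (cases N) auto
    ultimately show ?thesis using envs_nonempty_theta[OF ne] K m by auto
  qed
  ultimately show "?\<nu> \<in> envs \<Delta> \<theta>0 \<sigma> N K d"
    using arm_laws_env[OF \<sigma>, of N d \<Delta> m K s \<theta>] hp subgaussian_gauss[OF \<sigma> d]
    by (auto simp: envs_def arm_laws_def hard_env_def)
qed

section \<open>The potential\<close>

text \<open>With \<open>w\<close> and \<open>u\<close> the rescaled sums over the rest of the block and over the tested pair, \<open>cosh (w + u)\<close> and
  \<open>cosh (w - u)\<close> are, up to a common factor, the two mixture likelihoods. The bound on their chi-square integrand
  consists of exponentials only, and its last term factorises in \<open>w\<close> and \<open>u\<close>.\<close>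

lemma cosh_sq_bound:
  fixes w u :: real
  shows "(cosh (w + u))^2 \<le> cosh (w - u) * (cosh w * cosh u + 3 * (sinh w * sinh u)
    + 4 * ((sinh w)^2 / cosh w) * (2 * (sinh u)^2 * cosh u))"
proof -
  have pos: "cosh w > 0" "cosh u > 0" "cosh (w - u) > 0" by (rule cosh_real_pos)+
  \<comment> \<open>Expand cosh w as the cosh of u + (w - u) and use \<bar>sinh\<bar> \<le> cosh.
    This inserts the factor cosh (w - u) that the claim needs.\<close>
  have "(sinh w)^2 * (sinh u)^2 * cosh w \<le> (sinh w)^2 * (sinh u)^2 * (2 * cosh u * cosh (w - u))"
  proof (rule mult_left_mono)
    have "cosh w = cosh u * cosh (w - u) + sinh u * sinh (w - u)"
      using cosh_add[of u "w - u"] by simp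
    also have "sinh u * sinh (w - u) \<le> \<bar>sinh u\<bar> * \<bar>sinh (w - u)\<bar>" by (simp add: abs_mult[symmetric])
    also have "\<dots> \<le> cosh u * cosh (w - u)"
    proof (rule mult_mono)
      show "\<bar>sinh u\<bar> \<le> cosh u" by (metis abs_le_square_iff abs_of_pos cosh_square_eq less_add_one less_imp_le pos(2))
      show "\<bar>sinh (w - u)\<bar> \<le> cosh (w - u)" by (metis abs_le_square_iff abs_of_pos cosh_square_eq less_add_one less_imp_le pos(3))
    qed (use pos in auto)
    finally show "cosh w \<le> 2 * cosh u * cosh (w - u)" by simp
  qed simp
  then have h1: "(sinh w)^2 * (sinh u)^2 \<le> cosh (w - u) * (((sinh w)^2 / cosh w) * (2 * (sinh u)^2 * cosh u))"
    using pos by (simp add: field_simps)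
  \<comment> \<open>With a = cosh w cosh u and b = sinh w sinh u this is (a + b)^2 = (a - b) (a + 3
    b) + 4 b^2, the division of the square by a - b with remainder.\<close>
  have h2: "(cosh (w + u))^2 = cosh (w - u) * (cosh w * cosh u + 3 * (sinh w * sinh u)) + 4 * ((sinh w)^2 * (sinh u)^2)"
    unfolding cosh_add cosh_diff by (simp add: algebra_simps power2_eq_square)
  have h3: "cosh (w - u) * (P + 4 * a * b) = cosh (w - u) * P + 4 * (cosh (w - u) * (a * b))" for P a b
    by (simp add: algebra_simps)
  show ?thesis unfolding h3 h2 using h1 by linarith
qed

lemma cosh_triple_real: "2 * (sinh x)^2 * cosh x = (cosh (3 * x) - cosh x) / (2::real)"
proof -
  have "cosh (3 * x) = cosh (2 * x + x)" by simp
  also have "\<dots> = ((cosh x)^2 + (sinh x)^2) * cosh x + (2 * sinh x * cosh x) * sinh x"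
    unfolding cosh_add cosh_double sinh_double ..
  also have "\<dots> = cosh x + 4 * (sinh x)^2 * cosh x"
  proof -
    have "(cosh x)^2 = 1 + (sinh x)^2" by (simp add: cosh_square_eq)
    then show ?thesis by (simp add: algebra_simps power2_eq_square)
  qed
  finally show ?thesis by simp
qed

text \<open>A Gaussian martingale that dominates \<open>2 sinh\<^sup>2 cosh = (cosh 3x - cosh x) / 2\<close> as long as the number \<open>n\<close> of samples is at
  most \<open>p\<close>; its initial value is \<open>(exp (4 e p) - 1) / 2\<close>.\<close>

definition cosh_gap :: "real \<Rightarrow> real \<Rightarrow> real \<Rightarrow> real \<Rightarrow> real \<Rightarrow> real" where
  "cosh_gap e k p n w = exp (4 * e * p - 9 * n * e / 2) * cosh (3 * k * w) / 2 - exp (- n * e / 2) * cosh (k * w) / 2"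

text \<open>The factor of the rest of the block. \<open>False\<close> gives the bound of the problem with known centres, \<open>True\<close> the gain from
  the centres being unknown.\<close>

definition rest_weight :: "bool \<Rightarrow> real \<Rightarrow> real \<Rightarrow> real \<Rightarrow> real \<Rightarrow> real \<Rightarrow> real" where
  "rest_weight b e k p n w = (if b then cosh_gap e k p n w else exp (- n * e / 2) * cosh (k * w))"

text \<open>Here \<open>n\<close> and \<open>w\<close> are the count and signed sum of the rest of
  the block, \<open>m\<close> and \<open>u\<close> those of the pair. With e = k^2 \<sigma>^2 one
  Gaussian sample multiplies the mean of cosh (k w) by exp (e / 2), which the exponential prefactors
  compensate.\<close>

definition potential :: "bool \<Rightarrow> real \<Rightarrow> real \<Rightarrow> real \<Rightarrow> real \<Rightarrow> real \<Rightarrow> real \<Rightarrow> real \<Rightarrow> real \<Rightarrow> real" where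
  "potential b e k R r n m w u = exp (- (n + m) * e / 2) * (cosh (k * w) * cosh (k * u) + 3 * (sinh (k * w) * sinh (k * u)))
    + 4 * rest_weight b e k R n w * cosh_gap e k r m u"

text \<open>The term in 3 k needs the compensation 9 e / 2 per sample, while the common factor
  supplies e / 2. The deficit 4 e n is prepaid by the constant 4 e p as long as n \<le> p.\<close>

lemma cosh_gap_ge:
  assumes "e \<ge> 0" "n \<le> p"
  shows "exp (- n * e / 2) * (2 * (sinh (k * w))^2 * cosh (k * w)) \<le> cosh_gap e k p n w"
proof -
  have "0 \<le> 4 * e * (p - n)" using assms by simp
  then have "- n * e / 2 \<le> 4 * e * p - 9 * n * e / 2" by (simp add: algebra_simps)
  then have "exp (- n * e / 2) * cosh (3 * k * w) \<le> exp (4 * e * p - 9 * n * e / 2) * cosh (3 * k * w)"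
    by (intro mult_right_mono) auto
  then show ?thesis unfolding cosh_triple_real cosh_gap_def by (simp add: field_simps)
qed

text \<open>Two estimates of sinh^2 / cosh: by cosh, and, since cosh \<ge> 1, by 2 sinh^2 cosh. The
  second one starts from a value that is small when e p is small, which reflects that few samples
  reveal little about the direction.\<close>

lemma rest_weight_ge:
  assumes "e \<ge> 0" "n \<le> p"
  shows "exp (- n * e / 2) * ((sinh (k * w))^2 / cosh (k * w)) \<le> rest_weight b e k p n w"
proof -
  have c: "cosh (k * w) \<ge> 1" by (rule cosh_real_ge_1)
  have "(sinh (k * w))^2 / cosh (k * w) \<le> cosh (k * w)"
  proof -
    have "(sinh (k * w))^2 \<le> (cosh (k * w))^2" by (simp add: sinh_square_eq)
    then show ?thesis using c by (simp add: divide_le_eq power2_eq_square)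
  qed
  moreover have "(sinh (k * w))^2 / cosh (k * w) \<le> 2 * (sinh (k * w))^2 * cosh (k * w)"
  proof -
    have "(sinh (k * w))^2 * 1 \<le> (sinh (k * w))^2 * (2 * (cosh (k * w))^2)"
      using c by (intro mult_left_mono) (auto intro: order_trans[OF one_le_power[of "cosh (k*w)" 2]])
    then show ?thesis using c by (simp add: divide_le_eq power2_eq_square mult_ac)
  qed
  ultimately show ?thesis
    using order_trans[OF mult_left_mono cosh_gap_ge[OF assms, of k w], of "(sinh (k * w))^2 / cosh (k * w)"]
      mult_left_mono[of "(sinh (k * w))^2 / cosh (k * w)" "cosh (k * w)" "exp (- n * e / 2)"]
    unfolding rest_weight_def by (cases b) (simp_all only: if_True if_False exp_ge_zero)
qed

text \<open>This is \<open>cosh_sq_bound\<close> times the square of the common factor. The limits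
  on the counts enter through the two factors of the last term, whose lower bounds are nonnegative
  and can be multiplied. The product form on the right is the one required by
  \<open>amgm_real\<close>.\<close>

lemma potential_dominates:
  assumes "e \<ge> 0" "n \<le> R" "m \<le> r"
  shows "(exp (- (n + m) * e / 2) * cosh (k * (w + u)))^2 \<le>
    (exp (- (n + m) * e / 2) * cosh (k * (w - u))) * potential b e k R r n m w u"
proof -
  let ?E = "exp (- (n + m) * e / 2)"
  have E: "?E = exp (- n * e / 2) * exp (- m * e / 2)"
    unfolding exp_add[symmetric] by (rule arg_cong[of _ _ exp]) (simp add: field_simps)
  let ?a = "(sinh (k * w))^2 / cosh (k * w)" and ?b = "2 * (sinh (k * u))^2 * cosh (k * u)"
  have "?E * (?a * ?b) = (exp (- n * e / 2) * ?a) * (exp (- m * e / 2) * ?b)" unfolding E by (simp add: algebra_simps)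
  also have "\<dots> \<le> rest_weight b e k R n w * cosh_gap e k r m u"
  proof (rule mult_mono[OF rest_weight_ge cosh_gap_ge])
    have "0 \<le> exp (- n * e / 2) * ?a" using cosh_real_pos[of "k * w"] by simp
    also have "\<dots> \<le> rest_weight b e k R n w" by (rule rest_weight_ge) fact+
    finally show "0 \<le> rest_weight b e k R n w" .
    show "0 \<le> exp (- m * e / 2) * ?b" using cosh_real_pos[of "k * u"] by simp
  qed fact+
  finally have 1: "?E * (cosh (k * w) * cosh (k * u) + 3 * (sinh (k * w) * sinh (k * u)) + 4 * ?a * ?b) \<le> potential b e k R r n m w u"
  proof -
    assume *: "?E * (?a * ?b) \<le> rest_weight b e k R n w * cosh_gap e k r m u"
    have "?E * (P + 4 * x * y) = ?E * P + 4 * (?E * (x * y))" for P x y by (simp add: algebra_simps)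
    then show ?thesis unfolding potential_def using * by (simp only: mult.assoc[of 4])
  qed
  have "(?E * cosh (k * (w + u)))^2 = ?E^2 * (cosh (k * w + k * u))^2" by (simp add: power_mult_distrib distrib_left)
  also have "\<dots> \<le> ?E^2 * (cosh (k * w - k * u) * (cosh (k * w) * cosh (k * u) + 3 * (sinh (k * w) * sinh (k * u)) + 4 * ?a * ?b))"
    by (intro mult_left_mono cosh_sq_bound) auto
  also have "\<dots> = (?E * cosh (k * (w - u))) * (?E * (cosh (k * w) * cosh (k * u) + 3 * (sinh (k * w) * sinh (k * u)) + 4 * ?a * ?b))"
    by (simp add: power2_eq_square right_diff_distrib)
  also have "\<dots> \<le> (?E * cosh (k * (w - u))) * potential b e k R r n m w u"
    using cosh_real_pos[of "k * (w - u)"] by (intro mult_left_mono 1) auto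
  finally show ?thesis .
qed

text \<open>The \<open>sinh\<close> product can be negative, so the sign is not visible term by
  term. It follows because a positive multiple of the potential dominates a square.\<close>

lemma potential_nonneg:
  assumes "e \<ge> 0" "n \<le> R" "m \<le> r"
  shows "0 \<le> potential b e k R r n m w u"
proof -
  have "0 \<le> (exp (- (n + m) * e / 2) * cosh (k * (w - u))) * potential b e k R r n m w u"
    using order_trans[OF zero_le_power2 potential_dominates[OF assms]] .
  moreover have "exp (- (n + m) * e / 2) * cosh (k * (w - u)) > 0" using cosh_real_pos by simp
  ultimately show ?thesis by (metis linorder_not_le mult_pos_neg)
qed

section \<open>The martingale property of the potential and the mixture over the cube\<close>

lemma cosh_gap_martingale:
  assumes \<sigma>: "\<sigma> > 0" and e: "e = k^2 * \<sigma>^2" and s: "s^2 = 1"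
  shows "has_bochner_integral (normal_law \<sigma> c) (\<lambda>x. cosh_gap e k p (n + 1) (w + s * (x - c))) (cosh_gap e k p n w)"
proof -
  have 1: "exp (4 * e * p - 9 * (n + 1) * e / 2) / 2 * (exp ((3 * k)^2 * s^2 * \<sigma>^2 / 2) * cosh (3 * k * w)) =
      exp (4 * e * p - 9 * n * e / 2) * cosh (3 * k * w) / 2"
  proof -
    have "exp (4 * e * p - 9 * (n + 1) * e / 2) * exp ((3 * k)^2 * s^2 * \<sigma>^2 / 2) = exp (4 * e * p - 9 * n * e / 2)"
      unfolding exp_add[symmetric] s by (rule arg_cong[of _ _ exp]) (simp add: e power_mult_distrib field_simps)
    then show ?thesis by (simp add: field_simps)
  qed
  have 2: "exp (- (n + 1) * e / 2) / 2 * (exp (k^2 * s^2 * \<sigma>^2 / 2) * cosh (k * w)) = exp (- n * e / 2) * cosh (k * w) / 2"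
  proof -
    have "exp (- (n + 1) * e / 2) * exp (k^2 * s^2 * \<sigma>^2 / 2) = exp (- n * e / 2)"
      unfolding exp_add[symmetric] s by (rule arg_cong[of _ _ exp]) (simp add: e field_simps)
    then show ?thesis by (simp add: field_simps)
  qed
  have "has_bochner_integral (normal_law \<sigma> c)
     (\<lambda>x. exp (4 * e * p - 9 * (n + 1) * e / 2) / 2 * cosh (3 * k * (w + s * (x - c))) -
        exp (- (n + 1) * e / 2) / 2 * cosh (k * (w + s * (x - c))))
     (exp (4 * e * p - 9 * (n + 1) * e / 2) / 2 * (exp ((3 * k)^2 * s^2 * \<sigma>^2 / 2) * cosh (3 * k * w)) -
        exp (- (n + 1) * e / 2) / 2 * (exp (k^2 * s^2 * \<sigma>^2 / 2) * cosh (k * w)))"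
    by (intro has_bochner_integral_diff has_bochner_integral_mult_right normal_law_cosh \<sigma>)
  then show ?thesis unfolding 1 2 by (simp add: cosh_gap_def)
qed

lemma exp_cosh_martingale:
  assumes \<sigma>: "\<sigma> > 0" and e: "e = k^2 * \<sigma>^2" and s: "s^2 = 1"
  shows "has_bochner_integral (normal_law \<sigma> c) (\<lambda>x. exp (- (n + 1) * e / 2) * cosh (k * (w + s * (x - c)))) (exp (- n * e / 2) * cosh (k * w))"
    and "has_bochner_integral (normal_law \<sigma> c) (\<lambda>x. exp (- (n + 1) * e / 2) * sinh (k * (w + s * (x - c)))) (exp (- n * e / 2) * sinh (k * w))"
proof -
  have 2: "exp (- (n + 1) * e / 2) * (exp (k^2 * s^2 * \<sigma>^2 / 2) * z) = exp (- n * e / 2) * z" for z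
  proof -
    have "exp (- (n + 1) * e / 2) * exp (k^2 * s^2 * \<sigma>^2 / 2) = exp (- n * e / 2)"
      unfolding exp_add[symmetric] s by (rule arg_cong[of _ _ exp]) (simp add: e field_simps)
    then show ?thesis by (simp add: field_simps)
  qed
  show "has_bochner_integral (normal_law \<sigma> c) (\<lambda>x. exp (- (n + 1) * e / 2) * cosh (k * (w + s * (x - c)))) (exp (- n * e / 2) * cosh (k * w))"
    using has_bochner_integral_mult_right[OF normal_law_cosh(1)[OF \<sigma>, of c k w s], of "exp (- (n + 1) * e / 2)"] unfolding 2 .
  show "has_bochner_integral (normal_law \<sigma> c) (\<lambda>x. exp (- (n + 1) * e / 2) * sinh (k * (w + s * (x - c)))) (exp (- n * e / 2) * sinh (k * w))"
    using has_bochner_integral_mult_right[OF normal_law_cosh(2)[OF \<sigma>, of c k w s], of "exp (- (n + 1) * e / 2)"] unfolding 2 .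
qed

text \<open>Each summand separates into a factor in (n, w) and a factor in (m, u). Every factor is a
  martingale, and a sample moves only one of the two.\<close>

lemma potential_alt:
  "potential b e k R r n m w u = exp (- n * e / 2) * cosh (k * w) * (exp (- m * e / 2) * cosh (k * u))
    + 3 * (exp (- n * e / 2) * sinh (k * w) * (exp (- m * e / 2) * sinh (k * u))) + rest_weight b e k R n w * (4 * cosh_gap e k r m u)"
proof -
  have E: "exp (- (n + m) * e / 2) = exp (- n * e / 2) * exp (- m * e / 2)"
    unfolding exp_add[symmetric] by (rule arg_cong[of _ _ exp]) (simp add: field_simps)
  show ?thesis unfolding potential_def E by (simp add: algebra_simps)
qed

lemma potential_martingale:
  assumes \<sigma>: "\<sigma> > 0" and e: "e = k^2 * \<sigma>^2" and s: "s^2 = 1"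
  shows "has_bochner_integral (normal_law \<sigma> c) (\<lambda>x. potential b e k R r (n + 1) m (w + s * (x - c)) u) (potential b e k R r n m w u)"
    and "has_bochner_integral (normal_law \<sigma> c) (\<lambda>x. potential b e k R r n (m + 1) w (u + s * (x - c))) (potential b e k R r n m w u)"
proof -
  have a: "has_bochner_integral (normal_law \<sigma> c) (\<lambda>x. rest_weight b e k R (n + 1) (w + s * (x - c))) (rest_weight b e k R n w)"
    using cosh_gap_martingale[OF assms] exp_cosh_martingale(1)[OF assms] by (cases b) (auto simp: rest_weight_def)
  show "has_bochner_integral (normal_law \<sigma> c) (\<lambda>x. potential b e k R r (n + 1) m (w + s * (x - c)) u) (potential b e k R r n m w u)"
    unfolding potential_alt
    by (intro has_bochner_integral_add has_bochner_integral_mult_left has_bochner_integral_mult_right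
        exp_cosh_martingale a assms)
  show "has_bochner_integral (normal_law \<sigma> c) (\<lambda>x. potential b e k R r n (m + 1) w (u + s * (x - c))) (potential b e k R r n m w u)"
    unfolding potential_alt
    by (intro has_bochner_integral_add has_bochner_integral_mult_left has_bochner_integral_mult_right
        exp_cosh_martingale cosh_gap_martingale assms)
qed

lemma potential_measurable [measurable]:
  assumes "f \<in> borel_measurable M" "g \<in> borel_measurable M" "w \<in> borel_measurable M" "u \<in> borel_measurable M"
  shows "(\<lambda>x. potential b e k R r (f x) (g x) (w x) (u x)) \<in> borel_measurable M"
  using assms unfolding potential_def rest_weight_def cosh_gap_def cosh_field_def sinh_field_def
  by (cases b) (simp_all, measurable)

definition cube_sign :: "nat set \<Rightarrow> nat \<Rightarrow> real" where
  "cube_sign \<xi> i = (if i \<in> \<xi> then 1 else -1)"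

text \<open>The sum over the vertices factorises over the coordinates. This is why the direction is
  drawn from a cube: the mixture likelihood becomes a product of one-dimensional ones.\<close>

lemma sum_Pow_exp_cube_sign:
  "(\<Sum>\<xi>\<in>Pow {..<d}. exp (\<Sum>i<d. k * cube_sign \<xi> i * y i + z)) = 2 ^ d * (\<Prod>i<d. exp z * cosh (k * y i))"
proof -
  have "(\<Prod>i<d. exp (k * y i + z) + exp (- (k * y i) + z)) =
      (\<Sum>\<xi>\<in>Pow {..<d}. (\<Prod>i\<in>\<xi>. exp (k * y i + z)) * (\<Prod>i\<in>{..<d} - \<xi>. exp (- (k * y i) + z)))"
    by (rule prod_add) simp
  also have "\<dots> = (\<Sum>\<xi>\<in>Pow {..<d}. exp (\<Sum>i<d. k * cube_sign \<xi> i * y i + z))"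
  proof (rule sum.cong[OF refl])
    fix \<xi> assume "\<xi> \<in> Pow {..<d}"
    then have sub: "\<xi> \<subseteq> {..<d}" by simp
    have "exp (\<Sum>i<d. k * cube_sign \<xi> i * y i + z) = (\<Prod>i<d. exp (k * cube_sign \<xi> i * y i + z))" by (simp add: exp_sum)
    also have "\<dots> = (\<Prod>i\<in>{..<d} - \<xi>. exp (k * cube_sign \<xi> i * y i + z)) * (\<Prod>i\<in>\<xi>. exp (k * cube_sign \<xi> i * y i + z))"
      by (rule prod.subset_diff[OF sub]) simp
    also have "\<dots> = (\<Prod>i\<in>{..<d} - \<xi>. exp (- (k * y i) + z)) * (\<Prod>i\<in>\<xi>. exp (k * y i + z))"
      by (intro arg_cong2[of _ _ _ _ "(*)"] prod.cong refl) (auto simp: cube_sign_def)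
    finally show "(\<Prod>i\<in>\<xi>. exp (k * y i + z)) * (\<Prod>i\<in>{..<d} - \<xi>. exp (- (k * y i) + z)) = exp (\<Sum>i<d. k * cube_sign \<xi> i * y i + z)"
      by (simp add: mult.commute)
  qed
  also have "(\<Prod>i<d. exp (k * y i + z) + exp (- (k * y i) + z)) = (\<Prod>i<d. 2 * (exp z * cosh (k * y i)))"
    by (intro prod.cong refl) (simp add: cosh_field_def exp_add exp_diff exp_minus field_simps)
  finally show ?thesis by (simp add: prod.distrib)
qed

text \<open>Expand (c Y - X)^2 \<ge> 0. It stands in for the Cauchy-Schwarz step from chi-square
  divergence to probabilities. Being linear in X, Y and V, it can be integrated and then averaged,
  with c chosen at the very end.\<close>

lemma amgm_real:
  fixes X Y V c :: real
  assumes "X^2 \<le> Y * V" "Y > 0" "c > 0"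
  shows "X \<le> c / 2 * Y + V / (2 * c)"
proof -
  have V: "X^2 / Y \<le> V" using assms by (simp add: divide_le_eq mult.commute)
  have "0 \<le> (c * Y - X)^2 / (2 * c * Y)" using assms by simp
  also have "\<dots> = c / 2 * Y - X + (X^2 / Y) / (2 * c)" using assms by (simp add: field_simps power2_eq_square)
  also have "\<dots> \<le> c / 2 * Y - X + V / (2 * c)" using V assms by (intro add_left_mono divide_right_mono) auto
  finally show ?thesis by simp
qed

section \<open>Mixtures over the hidden direction\<close>

definition signed_sum :: "(nat \<Rightarrow> real) \<Rightarrow> obs \<Rightarrow> nat set \<Rightarrow> nat \<Rightarrow> nat \<Rightarrow> hist \<Rightarrow> real" where
  "signed_sum sg b A t i = hsum t (\<lambda>a x. indicator A a * (sg a * (x i - b i)))"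

text \<open>The reference is pure noise around \<open>b\<close>. The value \<tau> = 1 gives the
  original environment and \<tau> = -1 the one with the pair \<open>AU\<close> swapped. Arms outside
  the block have the reference law and contribute 0.\<close>

definition log_lik :: "real \<Rightarrow> real \<Rightarrow> nat \<Rightarrow> (nat \<Rightarrow> real) \<Rightarrow> obs \<Rightarrow> nat set \<Rightarrow> nat set \<Rightarrow> real \<Rightarrow> nat set \<Rightarrow> nat \<Rightarrow> obs \<Rightarrow> real" where
  "log_lik \<sigma> \<epsilon> d sg b AW AU \<tau> \<xi> a x = (if a \<in> AW \<union> AU then
     (\<Sum>i<d. ((if a \<in> AU then \<tau> else 1) * sg a * cube_sign \<xi> i * \<epsilon> * (x i - b i)
        - ((if a \<in> AU then \<tau> else 1) * sg a * cube_sign \<xi> i * \<epsilon>)^2 / 2) / \<sigma>^2) else 0)"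

lemma hsum_log_lik:
  assumes \<sigma>: "\<sigma> > 0" and disj: "AW \<inter> AU = {}" and sg: "\<And>a. (sg a)^2 = 1" and \<tau>: "\<tau>^2 = 1"
  shows "hsum t (log_lik \<sigma> \<epsilon> d sg b AW AU \<tau> \<xi>) h =
    (\<Sum>i<d. (\<epsilon> / \<sigma>^2) * cube_sign \<xi> i * (signed_sum sg b AW t i h + \<tau> * signed_sum sg b AU t i h)
       + (- (pulls t AW h + pulls t AU h) * (\<epsilon>^2 / \<sigma>^2) / 2))"
proof -
  have chi2: "(cube_sign \<xi> i)^2 = 1" for i by (simp add: cube_sign_def)
  have pt: "log_lik \<sigma> \<epsilon> d sg b AW AU \<tau> \<xi> a x = (\<Sum>i<d. (\<epsilon> / \<sigma>^2) * cube_sign \<xi> i *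
      (indicator AW a * (sg a * (x i - b i)) + \<tau> * (indicator AU a * (sg a * (x i - b i))))
      + (- (indicator AW a + indicator AU a) * (\<epsilon>^2 / \<sigma>^2) / 2))" for a x
  proof (cases "a \<in> AW")
    case True
    then have "a \<notin> AU" using disj by blast
    then show ?thesis using True \<sigma> unfolding log_lik_def
      by (intro trans[OF if_P] sum.cong refl)
        (auto simp: power_mult_distrib sg chi2 field_simps)
  next
    case False
    show ?thesis
    proof (cases "a \<in> AU")
      case True
      then show ?thesis using False \<sigma> unfolding log_lik_def
        by (intro trans[OF if_P] sum.cong refl)
          (auto simp: power_mult_distrib sg chi2 \<tau> field_simps)
    qed (use False in \<open>simp add: log_lik_def\<close>)
  qed
  have lin: "(\<Sum>s<t. A * (f s + \<tau> * g s) + (- (p s + q s) * B / 2)) =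
      A * ((\<Sum>s<t. f s) + \<tau> * (\<Sum>s<t. g s)) + (- ((\<Sum>s<t. p s) + (\<Sum>s<t. q s)) * B / 2)"
    for A B :: real and f g p q :: "nat \<Rightarrow> real"
    by (induction t) (simp_all add: algebra_simps add_divide_distrib diff_divide_distrib)
  show ?thesis
    unfolding hsum_def[of t "log_lik \<sigma> \<epsilon> d sg b AW AU \<tau> \<xi>"] pt signed_sum_def
    unfolding hsum_def
    by (subst sum.swap, intro sum.cong refl lin)
qed

context table_run
begin

text \<open>Both mixtures have densities that are products over coordinates, so the product of the
  coordinate potentials dominates the ratio of the squared first to the second.
  \<open>amgm_real\<close> gives the pointwise comparison and \<open>change_of_measure\<close>
  integrates it.\<close>

lemma mixture_bound:
  fixes R r :: nat
  assumes \<sigma>: "\<sigma> > 0" and c: "c > 0" and disj: "AW \<inter> AU = {}" and sg: "\<And>a. (sg a)^2 = 1"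
    and \<mu>: "arm_laws N d \<mu>"
    and \<mu>b: "\<And>a. a < N \<Longrightarrow> a \<in> AW \<union> AU \<Longrightarrow> \<mu> a = gauss \<sigma> d b"
    and \<nu>': "\<And>\<xi> a. \<xi> \<subseteq> {..<d} \<Longrightarrow> a < N \<Longrightarrow> \<nu>' \<xi> a =
      (if a \<in> AW \<union> AU then gauss \<sigma> d (\<lambda>i. b i + sg a * cube_sign \<xi> i * \<epsilon>) else \<mu> a)"
    and \<nu>: "\<And>\<xi> a. \<xi> \<subseteq> {..<d} \<Longrightarrow> a < N \<Longrightarrow> \<nu> \<xi> a =
      (if a \<in> AW \<union> AU then gauss \<sigma> d (\<lambda>i. b i + (if a \<in> AU then - 1 else 1) * sg a * cube_sign \<xi> i * \<epsilon>) else \<mu> a)"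
    and g: "good_meas g"
    and trunc: "\<And>t h. g t h \<Longrightarrow> pulls t AW h \<le> real R \<and> pulls t AU h \<le> real r"
    and e: "e = \<epsilon>^2 / \<sigma>^2"
  shows "(\<Sum>\<xi>\<in>Pow {..<d}. stop_prob (\<nu>' \<xi>) g) \<le> c / 2 * (\<Sum>\<xi>\<in>Pow {..<d}. stop_prob (\<nu> \<xi>) g)
    + 2 ^ d / (2 * c) * (1 + 2 * rest_weight bb e k (real R) 0 0 * (exp (4 * e * real r) - 1)) ^ d"
proof -
  have lin2: "ennreal (p * y + q * v) = ennreal p * ennreal y + ennreal q * ennreal v"
    if "0 \<le> p" "0 \<le> y" "0 \<le> q" "0 \<le> v" for p y q v
    using that by (simp add: ennreal_mult)
  define kk where "kk = \<epsilon> / \<sigma>^2"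
  have ek: "e = kk^2 * \<sigma>^2" using \<sigma> by (simp add: e kk_def power2_eq_square)
  have e0: "e \<ge> 0" by (simp add: e)
  let ?L = "\<lambda>\<tau>. log_lik \<sigma> \<epsilon> d sg b AW AU \<tau>"
  let ?p = "\<lambda>t h i. potential bb e kk (real R) (real r) (pulls t AW h) (pulls t AU h) (signed_sum sg b AW t i h) (signed_sum sg b AU t i h)"
  let ?ok = "\<lambda>t h. pulls t AW h \<le> real R \<and> pulls t AU h \<le> real r"
  \<comment> \<open>The process is killed once a limit is exceeded, since the potential is known to
    be nonnegative only within the limits.\<close>
  define Z where "Z = (\<lambda>t h. if ?ok t h then ennreal (\<Prod>i<d. ?p t h i) else 0)"
  have xm [measurable]: "i < d \<Longrightarrow> (\<lambda>x. x i) \<in> borel_measurable (obs_space d)" for i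
    unfolding obs_space_def by (rule measurable_component_singleton) simp
  have Lm: "?L \<tau> \<xi> a \<in> borel_measurable (obs_space d)" for \<tau> \<xi> a
    unfolding log_lik_def by (cases "a \<in> AW \<union> AU") (auto intro!: borel_measurable_sum borel_measurable_divide borel_measurable_diff borel_measurable_times xm)
  have wm: "signed_sum sg b A t i \<in> borel_measurable (hist_space N d t)" if "i < d" for A t i
    unfolding signed_sum_def by (intro hsum_measurable) (use xm[OF that] in measurable)
  have pm: "pulls t A \<in> borel_measurable (hist_space N d t)" for A t
    by (intro hsum_measurable) auto
  have Zm: "Z t \<in> borel_measurable (hist_space N d t)" for t
  proof -
    have "(\<lambda>h. ennreal (\<Prod>i<d. ?p t h i)) \<in> borel_measurable (hist_space N d t)"
      by (intro measurable_compose[OF _ measurable_ennreal] borel_measurable_prod potential_measurable pm wm) auto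
    then show ?thesis unfolding Z_def using pm by (intro measurable_If) auto
  qed
  have arm': "arm_laws N d (\<nu>' \<xi>)" "arm_laws N d (\<nu> \<xi>)" if "\<xi> \<in> Pow {..<d}" for \<xi>
    using \<mu> \<nu> \<nu>' that by (auto simp: arm_laws_def prob_space_gauss[OF \<sigma>] sets_gauss)
  have dens: "\<nu> \<xi> a = density (\<mu> a) (\<lambda>x. ennreal (exp (?L (-1) \<xi> a x)))" if "\<xi> \<in> Pow {..<d}" "a < N" for \<xi> a
  proof (cases "a \<in> AW \<union> AU")
    case True
    then show ?thesis
      using that \<nu>[of \<xi> a] \<mu>b[of a] gauss_tilt[OF \<sigma>, of d b "\<lambda>i. (if a \<in> AU then - 1 else 1) * sg a * cube_sign \<xi> i * \<epsilon>"]
      by (simp add: log_lik_def)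
  qed (use that \<nu> in \<open>simp add: log_lik_def density_1\<close>)
  have dens': "\<nu>' \<xi> a = density (\<mu> a) (\<lambda>x. ennreal (exp (?L 1 \<xi> a x)))" if "\<xi> \<in> Pow {..<d}" "a < N" for \<xi> a
  proof (cases "a \<in> AW \<union> AU")
    case True
    then show ?thesis
      using that \<nu>'[of \<xi> a] \<mu>b[of a] gauss_tilt[OF \<sigma>, of d b "\<lambda>i. sg a * cube_sign \<xi> i * \<epsilon>"]
      by (simp add: log_lik_def)
  qed (use that \<nu>' in \<open>simp add: log_lik_def density_1\<close>)
  have super: "(\<integral>\<^sup>+x. Z (Suc t) (h(t := (a, x))) \<partial>\<mu> a) \<le> Z t h" if a: "a < N" for t h a
  proof (cases "a \<in> AW \<union> AU")
    case False
    interpret prob_space "\<mu> a" using \<mu> a by (auto simp: arm_laws_def)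
    have "Z (Suc t) (h(t := (a, x))) = Z t h" for x using False by (simp add: Z_def signed_sum_def)
    then show ?thesis by (simp add: emeasure_space_1)
  next
    case True
    define nW where "nW = pulls t AW h + indicator AW a"
    define nU where "nU = pulls t AU h + indicator AU a"
    have Z': "Z (Suc t) (h(t := (a, x))) = (if nW \<le> real R \<and> nU \<le> real r then
        ennreal (\<Prod>i<d. potential bb e kk (real R) (real r) nW nU
          (signed_sum sg b AW t i h + indicator AW a * (sg a * (x i - b i)))
          (signed_sum sg b AU t i h + indicator AU a * (sg a * (x i - b i)))) else 0)" for x
      by (simp add: Z_def nW_def nU_def signed_sum_def)
    show ?thesis
    proof (cases "nW \<le> real R \<and> nU \<le> real r")
      case ok: True
      \<comment> \<open>Counts never decrease, so the limits held before the pull if they hold after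
        it. Hence a killed process stays killed.\<close>
      then have okt: "?ok t h" unfolding nW_def nU_def by (smt (verit) indicator_pos_le)
      let ?f = "\<lambda>i y. potential bb e kk (real R) (real r) nW nU
          (signed_sum sg b AW t i h + indicator AW a * (sg a * (y - b i)))
          (signed_sum sg b AU t i h + indicator AU a * (sg a * (y - b i)))"
      have nn: "0 \<le> ?f i y" for i y using ok by (intro potential_nonneg e0) auto
      have hb: "has_bochner_integral (normal_law \<sigma> (b i)) (?f i) (?p t h i)" for i
      proof (cases "a \<in> AW")
        case True
        then have "a \<notin> AU" using disj by blast
        then show ?thesis using True potential_martingale(1)[OF \<sigma> ek sg] by (simp add: nW_def nU_def)
      next
        case False
        then have "a \<in> AU" using \<open>a \<in> AW \<union> AU\<close> by blast
        then show ?thesis using False potential_martingale(2)[OF \<sigma> ek sg] by (simp add: nW_def nU_def)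
      qed
      have "(\<integral>\<^sup>+x. Z (Suc t) (h(t := (a, x))) \<partial>\<mu> a) = (\<integral>\<^sup>+x. (\<Prod>i<d. ennreal (?f i (x i))) \<partial>gauss \<sigma> d b)"
        using True a ok nn by (simp add: Z' \<mu>b prod_ennreal)
      also have "\<dots> = (\<Prod>i<d. \<integral>\<^sup>+y. ennreal (?f i y) \<partial>normal_law \<sigma> (b i))"
        by (intro nn_integral_gauss_prod \<sigma> measurable_compose[OF _ measurable_ennreal] potential_measurable) auto
      also have "\<dots> = (\<Prod>i<d. ennreal (?p t h i))"
        using hb nn by (intro prod.cong refl) (simp add: nn_integral_eq_integral has_bochner_integral_iff)
      also have "\<dots> = Z t h"
        using okt by (simp add: Z_def prod_ennreal potential_nonneg e0)
      finally show ?thesis by simp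
    next
      case False
      then have "Z (Suc t) (h(t := (a, x))) = 0" for x unfolding Z' by (rule if_not_P)
      then show ?thesis by simp
    qed
  qed
  have dom: "ennreal (\<Sum>\<xi>\<in>Pow {..<d}. exp (hsum t (?L 1 \<xi>) h)) \<le>
      ennreal (c / 2) * ennreal (\<Sum>\<xi>\<in>Pow {..<d}. exp (hsum t (?L (-1) \<xi>) h)) + ennreal (2 ^ d / (2 * c)) * Z t h"
    if "g t h" for t h
  proof -
    have ok: "?ok t h" by (rule trunc[OF that])
    let ?w = "\<lambda>i. signed_sum sg b AW t i h" and ?u = "\<lambda>i. signed_sum sg b AU t i h"
    let ?E = "exp (- (pulls t AW h + pulls t AU h) * e / 2)"
    have s1: "(\<Sum>\<xi>\<in>Pow {..<d}. exp (hsum t (?L 1 \<xi>) h)) = 2 ^ d * (\<Prod>i<d. ?E * cosh (kk * (?w i + ?u i)))"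
      unfolding hsum_log_lik[OF \<sigma> disj sg, of 1, simplified] sum_Pow_exp_cube_sign[symmetric] by (simp add: e kk_def)
    have s2: "(\<Sum>\<xi>\<in>Pow {..<d}. exp (hsum t (?L (-1) \<xi>) h)) = 2 ^ d * (\<Prod>i<d. ?E * cosh (kk * (?w i - ?u i)))"
      unfolding hsum_log_lik[OF \<sigma> disj sg, of "-1", simplified] sum_Pow_exp_cube_sign[symmetric] by (simp add: e kk_def)
    let ?X = "\<Prod>i<d. ?E * cosh (kk * (?w i + ?u i))" and ?Y = "\<Prod>i<d. ?E * cosh (kk * (?w i - ?u i))"
    have "?X^2 = (\<Prod>i<d. (?E * cosh (kk * (?w i + ?u i)))^2)" by (simp add: prod_power_distrib)
    also have "\<dots> \<le> (\<Prod>i<d. (?E * cosh (kk * (?w i - ?u i))) * ?p t h i)"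
      using ok by (intro prod_mono conjI potential_dominates e0) auto
    finally have "?X^2 \<le> ?Y * (\<Prod>i<d. ?p t h i)" by (simp add: prod.distrib)
    then have "?X \<le> c / 2 * ?Y + (\<Prod>i<d. ?p t h i) / (2 * c)"
      by (rule amgm_real) (auto intro!: prod_pos simp: c cosh_real_pos)
    then have "2 ^ d * ?X \<le> 2 ^ d * (c / 2 * ?Y + (\<Prod>i<d. ?p t h i) / (2 * c))" by (intro mult_left_mono) auto
    also have "\<dots> = c / 2 * (2 ^ d * ?Y) + 2 ^ d / (2 * c) * (\<Prod>i<d. ?p t h i)" by (simp add: algebra_simps)
    finally have "ennreal (2 ^ d * ?X) \<le> ennreal (c / 2 * (2 ^ d * ?Y) + 2 ^ d / (2 * c) * (\<Prod>i<d. ?p t h i))"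
      by (rule ennreal_leI)
    also have "\<dots> = ennreal (c / 2) * ennreal (2 ^ d * ?Y) + ennreal (2 ^ d / (2 * c)) * ennreal (\<Prod>i<d. ?p t h i)"
    proof (rule lin2)
      show "0 \<le> 2 ^ d * ?Y" by (intro mult_nonneg_nonneg prod_nonneg) (auto simp: cosh_real_nonneg)
      show "0 \<le> (\<Prod>i<d. ?p t h i)" using ok by (intro prod_nonneg potential_nonneg e0) auto
    qed (use c in auto)
    finally show ?thesis unfolding s1 s2 using ok by (simp add: Z_def)
  qed
  \<comment> \<open>Initially all signed sums vanish, so the scale \<open>kk\<close> inside the
    hyperbolic functions may be replaced by any \<open>k\<close>.\<close>
  have Z0: "Z 0 (\<lambda>_. undefined) = ennreal ((1 + 2 * rest_weight bb e k (real R) 0 0 * (exp (4 * e * real r) - 1)) ^ d)"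
  proof -
    have "rest_weight bb e kk (real R) 0 0 = rest_weight bb e k (real R) 0 0" by (simp add: rest_weight_def cosh_gap_def)
    then have "potential bb e kk (real R) (real r) 0 0 0 0 = 1 + 2 * rest_weight bb e k (real R) 0 0 * (exp (4 * e * real r) - 1)"
      by (simp add: potential_def cosh_gap_def algebra_simps)
    then show ?thesis by (simp add: Z_def signed_sum_def)
  qed
  have "ennreal (\<Sum>\<xi>\<in>Pow {..<d}. stop_prob (\<nu>' \<xi>) g) \<le>
      ennreal (c / 2) * ennreal (\<Sum>\<xi>\<in>Pow {..<d}. stop_prob (\<nu> \<xi>) g) + ennreal (2 ^ d / (2 * c)) * Z 0 (\<lambda>_. undefined)"
    by (rule change_of_measure[OF \<mu> _ arm'(2) arm'(1) Lm Lm dens dens' Zm super g dom]) auto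
  also have "\<dots> = ennreal (c / 2 * (\<Sum>\<xi>\<in>Pow {..<d}. stop_prob (\<nu> \<xi>) g)
    + 2 ^ d / (2 * c) * (1 + 2 * rest_weight bb e k (real R) 0 0 * (exp (4 * e * real r) - 1)) ^ d)"
  proof -
    have "0 \<le> rest_weight bb e k (real R) 0 0" using rest_weight_ge[of e 0 "real R" k 0 bb] e0 by simp
    moreover have "0 \<le> exp (4 * e * real r) - 1" using e0 by simp
    ultimately show ?thesis
      unfolding Z0 using c
      by (intro lin2[symmetric]) (auto simp: stop_prob_def intro!: sum_nonneg)
  qed
  finally show ?thesis
  proof (rule ennreal_le_iff[THEN iffD1, rotated])
    have "0 \<le> rest_weight bb e k (real R) 0 0" using rest_weight_ge[of e 0 "real R" k 0 bb] e0 by simp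
    moreover have "0 \<le> exp (4 * e * real r) - 1" using e0 by simp
    ultimately show "0 \<le> c / 2 * (\<Sum>\<xi>\<in>Pow {..<d}. stop_prob (\<nu> \<xi>) g)
    + 2 ^ d / (2 * c) * (1 + 2 * rest_weight bb e k (real R) 0 0 * (exp (4 * e * real r) - 1)) ^ d"
      using c by (auto intro!: add_nonneg_nonneg mult_nonneg_nonneg sum_nonneg simp: stop_prob_def)
  qed
qed

end

section \<open>Averaging over environments\<close>

lemma sum_Pow_Times_split:
  fixes f :: "('a \<times> 'b) set \<Rightarrow> real"
  assumes j: "j \<in> I"
  shows "(\<Sum>\<theta>\<in>Pow (I \<times> D). f \<theta>) = (\<Sum>\<theta>\<in>Pow ((I - {j}) \<times> D). \<Sum>\<xi>\<in>Pow D. f (\<theta> \<union> {j} \<times> \<xi>))"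
proof -
  have "(\<Sum>\<theta>\<in>Pow (I \<times> D). f \<theta>) = (\<Sum>z\<in>Pow ((I - {j}) \<times> D) \<times> Pow D. f (fst z \<union> {j} \<times> snd z))"
  proof (rule sum.reindex_bij_witness[of _ "\<lambda>z. fst z \<union> {j} \<times> snd z" "\<lambda>\<theta>. (\<theta> \<inter> (I - {j}) \<times> D, {i. (j, i) \<in> \<theta>})"])
    fix \<theta> assume "\<theta> \<in> Pow (I \<times> D)"
    then show "fst (\<theta> \<inter> (I - {j}) \<times> D, {i. (j, i) \<in> \<theta>}) \<union> {j} \<times> snd (\<theta> \<inter> (I - {j}) \<times> D, {i. (j, i) \<in> \<theta>}) = \<theta>"
      by auto
    then show "f (fst (\<theta> \<inter> (I - {j}) \<times> D, {i. (j, i) \<in> \<theta>}) \<union> {j} \<times> snd (\<theta> \<inter> (I - {j}) \<times> D, {i. (j, i) \<in> \<theta>})) = f \<theta>"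
      by simp
  qed (use j in \<open>auto\<close>)
  then show ?thesis by (simp add: sum.cartesian_product split_def)
qed

lemma arm_label_div2: "arm_label m K s a div 2 = (if a < 2 * m * (K div 2) then a div (2 * m) else (K - 1) div 2)"
  by (simp add: arm_label_def)

lemma arm_label_flip_other: "a \<notin> {2 * q, 2 * q + 1} \<Longrightarrow> arm_label m K (flip q s) a = arm_label m K s a"
proof -
  assume "a \<notin> {2 * q, 2 * q + 1}"
  then have "a div 2 \<noteq> q" by auto
  then show ?thesis by (simp add: arm_label_def flip_def)
qed

lemma even_arm_label_flip:
  assumes "a \<in> {2 * q, 2 * q + 1}" "q < m * (K div 2)"
  shows "even (arm_label m K (flip q s) a) \<longleftrightarrow> odd (arm_label m K s a)"
proof -
  have "a div 2 = q" "a < 2 * m * (K div 2)" using assms by auto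
  then show ?thesis by (auto simp: arm_label_def flip_def)
qed

text \<open>A swap changes only the parity of a label, so \<open>{}\<close> can represent every set
  of swapped pairs. If K is even, the last block also contains the surplus arms.\<close>

definition block :: "nat \<Rightarrow> nat \<Rightarrow> nat \<Rightarrow> nat \<Rightarrow> nat set" where
  "block N m K j = {a. a < N \<and> arm_label m K {} a div 2 = j}"

lemma pair_subset_block:
  assumes "q \<in> flippable m K" "m * K \<le> N"
  shows "{2 * q, 2 * q + 1} \<subseteq> block N m K (q div m)"
proof -
  have q: "q < m * (K div 2)" using assms by (simp add: flippable_def)
  have "2 * m * (K div 2) \<le> m * K" by (metis mult.assoc mult.commute mult_le_mono2 times_div_less_eq_dividend)
  then have "2 * q + 1 < N" "2 * q < N" using q assms(2) by linarith+
  moreover have "(2 * q + 1) div (2 * m) = q div m" by (simp add: div_mult2_eq)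
  ultimately show ?thesis using q by (auto simp: block_def arm_label_div2)
qed

context table_run
begin

text \<open>The limit R is imposed on the whole block and not on the block without the pair, so that
  Markov's inequality applies to the disjoint blocks independently of q.\<close>

definition trunc_correct :: "nat \<Rightarrow> nat \<Rightarrow> nat \<Rightarrow> nat \<Rightarrow> nat set \<Rightarrow> nat \<Rightarrow> hist \<Rightarrow> bool" where
  "trunc_correct m R r q s t h \<longleftrightarrow> out_rule S t h = label_partition N m K s \<and>
     (pulls t (block N m K (q div m)) h \<le> real R \<and> pulls t {2 * q, 2 * q + 1} h \<le> real r)"

lemma good_meas_trunc_correct: "good_meas (trunc_correct m R r q s)"
  unfolding trunc_correct_def by (intro good_meas_conj good_meas_out good_meas_pulls)

text \<open>Only the direction of the block of q is averaged; \<theta> fixes those of the other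
  blocks. All arms outside the block then have the same law in both environments.\<close>

lemma hard_env_mixture_bound:
  fixes R r :: nat
  assumes \<sigma>: "\<sigma> > 0" and c: "c > 0" and q: "q \<in> flippable m K" and N: "m * K \<le> N"
    and \<theta>: "\<theta> \<subseteq> (I - {q div m}) \<times> {..<d}"
    and e: "e = (\<Delta> / (2 * sqrt d))^2 / \<sigma>^2"
  shows "(\<Sum>\<xi>\<in>Pow {..<d}. stop_prob (hard_env \<sigma> \<Delta> d m K s (\<theta> \<union> {q div m} \<times> \<xi>)) (trunc_correct m R r q s)) \<le>
    c / 2 * (\<Sum>\<xi>\<in>Pow {..<d}. stop_prob (hard_env \<sigma> \<Delta> d m K (flip q s) (\<theta> \<union> {q div m} \<times> \<xi>)) (trunc_correct m R r q s))
    + 2 ^ d / (2 * c) * (1 + 2 * rest_weight bb e 0 (real R) 0 0 * (exp (4 * e * real r) - 1)) ^ d"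
proof -
  define j where "j = q div m"
  define AU where "AU = {2 * q, 2 * q + 1}"
  define AW where "AW = block N m K j - AU"
  define sg where "sg = (\<lambda>a. if even (arm_label m K s a) then 1 else - 1 :: real)"
  define b where "b = (\<lambda>i::nat. if i = 0 then 4 * \<Delta> * real j else 0)"
  \<comment> \<open>In the tested block both centres are replaced by their midpoint
    \<open>b\<close>, which depends neither on \<xi> nor on the swap.\<close>
  define \<mu> where "\<mu> = (\<lambda>a. if a \<in> block N m K j then gauss \<sigma> d b else hard_env \<sigma> \<Delta> d m K s \<theta> a)"
  have AU: "AU \<subseteq> block N m K j" unfolding AU_def j_def by (rule pair_subset_block[OF q N])
  then have AWU: "AW \<union> AU = block N m K j" by (auto simp: AW_def)
  have qm: "q < m * (K div 2)" using q by (simp add: flippable_def)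
  have blk: "arm_label m K s' a div 2 = j \<longleftrightarrow> a \<in> block N m K j" if "a < N" for a s'
    using that by (simp add: block_def arm_label_div2)
  have centre_j: "centre \<Delta> d (\<theta> \<union> {j} \<times> \<xi>) k i = b i + (if even k then 1 else -1) * cube_sign \<xi> i * (\<Delta> / (2 * sqrt d))"
    if "k div 2 = j" for k i \<xi>
  proof -
    have "(j, i) \<in> \<theta> \<union> {j} \<times> \<xi> \<longleftrightarrow> i \<in> \<xi>" using \<theta> by (auto simp: j_def)
    then show ?thesis using that by (simp add: centre_def b_def cube_sign_def)
  qed
  have centre_other: "centre \<Delta> d (\<theta> \<union> {j} \<times> \<xi>) k = centre \<Delta> d \<theta> k" if "k div 2 \<noteq> j" for k \<xi>
    using that by (auto simp: centre_def fun_eq_iff)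
  show ?thesis
    unfolding j_def[symmetric]
  proof (rule mixture_bound[where AW = AW and AU = AU and sg = sg and b = b and \<mu> = \<mu> and \<epsilon> = "\<Delta> / (2 * sqrt d)" and k = 0, OF \<sigma> c])
    show "AW \<inter> AU = {}" by (auto simp: AW_def)
    show "(sg a)^2 = 1" for a by (simp add: sg_def)
    show "arm_laws N d \<mu>"
      using arm_laws_env[OF \<sigma>, of N d \<Delta> m K s \<theta>]
      by (auto simp: arm_laws_def \<mu>_def prob_space_gauss[OF \<sigma>] sets_gauss)
    show "\<mu> a = gauss \<sigma> d b" if "a \<in> AW \<union> AU" for a
      using that unfolding AWU by (simp add: \<mu>_def)
    show "hard_env \<sigma> \<Delta> d m K s (\<theta> \<union> {j} \<times> \<xi>) a = (if a \<in> AW \<union> AU then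
        gauss \<sigma> d (\<lambda>i. b i + sg a * cube_sign \<xi> i * (\<Delta> / (2 * sqrt d))) else \<mu> a)" if "a < N" for \<xi> a
      using blk[OF that, of s] centre_j[of "arm_label m K s a"] centre_other[of "arm_label m K s a"]
      unfolding AWU by (auto simp: hard_env_def \<mu>_def sg_def intro!: arg_cong[of _ _ "gauss \<sigma> d"])
    show "hard_env \<sigma> \<Delta> d m K (flip q s) (\<theta> \<union> {j} \<times> \<xi>) a = (if a \<in> AW \<union> AU then
        gauss \<sigma> d (\<lambda>i. b i + (if a \<in> AU then - 1 else 1) * sg a * cube_sign \<xi> i * (\<Delta> / (2 * sqrt d))) else \<mu> a)" if a: "a < N" for \<xi> a
    proof (cases "a \<in> AU")
      case True
      have "even (arm_label m K (flip q s) a) \<longleftrightarrow> odd (arm_label m K s a)"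
        using even_arm_label_flip[OF _ qm] True by (simp add: AU_def)
      then show ?thesis
        using True AU blk[OF a, of "flip q s"] centre_j[of "arm_label m K (flip q s) a"]
        unfolding AWU by (auto simp: hard_env_def sg_def intro!: arg_cong[of _ _ "gauss \<sigma> d"])
    next
      case False
      then have "arm_label m K (flip q s) a = arm_label m K s a" unfolding AU_def by (rule arm_label_flip_other)
      then show ?thesis
        using False blk[OF a, of s] centre_j[of "arm_label m K s a"] centre_other[of "arm_label m K s a"]
        unfolding AWU by (auto simp: hard_env_def \<mu>_def sg_def intro!: arg_cong[of _ _ "gauss \<sigma> d"])
    qed
    show "good_meas (trunc_correct m R r q s)" by (rule good_meas_trunc_correct)
    show "pulls t AW h \<le> real R \<and> pulls t AU h \<le> real r" if "trunc_correct m R r q s t h" for t h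
    proof -
      have "pulls t AW h \<le> pulls t (block N m K j) h"
        unfolding hsum_def by (intro sum_mono) (auto simp: AW_def indicator_def)
      then show ?thesis using that by (auto simp: trunc_correct_def j_def AU_def)
    qed
  qed (rule e)
qed

lemma stop_prob_nonneg: "0 \<le> stop_prob \<nu> g"
  by (simp add: stop_prob_def)

text \<open>The factor 8 in the limits makes the block failures and the pair failures cost at most P
  / 8 each. Correctness gives at least 3 P / 4, as \<delta> < 1 / 4, and P / 2 remains.\<close>

lemma correct_prob_sum_ge:
  fixes T :: real and R r :: nat
  assumes \<nu>: "arm_laws N d \<nu>" and succ: "1 - \<delta> \<le> stop_prob \<nu> (\<lambda>t h. out_rule S t h = label_partition N m K s)"
    and \<delta>: "\<delta> < 1 / 12" and budget: "expected_budget S N \<nu> \<le> ennreal T" and T: "T \<ge> 0"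
    and m: "m \<ge> 1"
    and R: "8 * T \<le> real (Suc R) * real (K div 2)"
    and r: "8 * T \<le> real (Suc r) * real (card (flippable m K))"
  shows "real (card (flippable m K)) / 2 \<le> (\<Sum>q\<in>flippable m K. stop_prob \<nu> (trunc_correct m R r q s))"
proof -
  let ?F = "flippable m K" and ?P = "real (card (flippable m K))"
  let ?o = "\<lambda>t h. out_rule S t h = label_partition N m K s"
  let ?x = "\<lambda>j. stop_prob \<nu> (\<lambda>t h. \<not> pulls t (block N m K j) h \<le> real R)"
  let ?y = "\<lambda>q. stop_prob \<nu> (\<lambda>t h. \<not> pulls t {2 * q, 2 * q + 1} h \<le> real r)"
  have markov: "(\<Sum>q\<in>Q. stop_prob \<nu> (\<lambda>t h. \<not> pulls t (B q) h \<le> real L)) \<le> c / 8"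
    if "finite Q" "disjoint_family_on B Q" "8 * T \<le> real (Suc L) * c" for Q L c and B :: "nat \<Rightarrow> nat set"
  proof -
    let ?z = "\<lambda>q. stop_prob \<nu> (\<lambda>t h. \<not> pulls t (B q) h \<le> real L)"
    have "ennreal (\<Sum>q\<in>Q. real (Suc L) * ?z q) = (\<Sum>q\<in>Q. ennreal (real (Suc L) * ?z q))"
      by (intro sum_ennreal[symmetric] mult_nonneg_nonneg stop_prob_nonneg) auto
    also have "\<dots> \<le> ennreal T"
      using stop_prob_markov[OF \<nu> that(1,2), of L] budget by (rule order_trans)
    finally have "(\<Sum>q\<in>Q. real (Suc L) * ?z q) \<le> T" using T by simp
    then have "real (Suc L) * (8 * (\<Sum>q\<in>Q. ?z q)) \<le> real (Suc L) * c"
      using that(3) by (simp only: sum_distrib_left[symmetric])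
    then have "8 * (\<Sum>q\<in>Q. ?z q) \<le> c" by (rule mult_left_le_imp_le) simp
    then show ?thesis by simp
  qed
  have y: "(\<Sum>q\<in>?F. ?y q) \<le> ?P / 8"
    by (rule markov[OF _ _ r]) (auto simp: disjoint_family_on_def)
  have "(\<Sum>j<K div 2. ?x j) \<le> real (K div 2) / 8"
    by (rule markov[OF _ _ R]) (auto simp: disjoint_family_on_def block_def)
  then have "real (m - 1) * (\<Sum>j<K div 2. ?x j) \<le> real (m - 1) * (real (K div 2) / 8)"
    by (intro mult_left_mono) auto
  then have x: "(\<Sum>q\<in>?F. ?x (q div m)) \<le> ?P / 8"
    unfolding sum_flippable[OF m, where f = ?x] card_flippable[OF m] by simp
  have "1 - \<delta> - ?x (q div m) - ?y q \<le> stop_prob \<nu> (trunc_correct m R r q s)" for q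
  proof -
    have "1 - \<delta> - ?x (q div m) \<le> stop_prob \<nu> (\<lambda>t h. ?o t h \<and> pulls t (block N m K (q div m)) h \<le> real R)"
      using stop_prob_conj_ge[OF \<nu> good_meas_out good_meas_pulls, of "label_partition N m K s" "block N m K (q div m)" "real R"] succ by linarith
    moreover have "stop_prob \<nu> (\<lambda>t h. ?o t h \<and> pulls t (block N m K (q div m)) h \<le> real R) - ?y q \<le>
        stop_prob \<nu> (\<lambda>t h. (?o t h \<and> pulls t (block N m K (q div m)) h \<le> real R) \<and> pulls t {2 * q, 2 * q + 1} h \<le> real r)"
      by (rule stop_prob_conj_ge[OF \<nu> good_meas_conj[OF good_meas_out good_meas_pulls] good_meas_pulls])
    ultimately show ?thesis unfolding trunc_correct_def conj_assoc by linarith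
  qed
  then have "(\<Sum>q\<in>?F. 1 - \<delta> - ?x (q div m) - ?y q) \<le> (\<Sum>q\<in>?F. stop_prob \<nu> (trunc_correct m R r q s))"
    by (rule sum_mono)
  moreover have "(\<Sum>q\<in>?F. 1 - \<delta> - ?x (q div m) - ?y q) = ?P * (1 - \<delta>) - (\<Sum>q\<in>?F. ?x (q div m)) - (\<Sum>q\<in>?F. ?y q)"
    by (simp add: sum_subtractf)
  moreover have "?P * (3 / 4) \<le> ?P * (1 - \<delta>)" using \<delta> by (intro mult_left_mono) auto
  ultimately show ?thesis using x y by linarith
qed

text \<open>The flipped partitions differ from each other and from the correct one, so together they
  share the mass at most \<delta> left by the correct answer.\<close>

lemma flipped_prob_sum_le:
  assumes \<nu>: "arm_laws N d \<nu>" and succ: "1 - \<delta> \<le> stop_prob \<nu> (\<lambda>t h. out_rule S t h = label_partition N m K s)"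
    and K: "K \<ge> 2" and N: "m * K \<le> N" and s: "s \<subseteq> flippable m K"
  shows "(\<Sum>q\<in>flippable m K. stop_prob \<nu> (trunc_correct m R r q (flip q s))) \<le> \<delta>"
proof -
  let ?F = "flippable m K"
  \<comment> \<open>Index 0 is free because 0 mod m = 0 keeps it out of
    \<open>flippable m K\<close>. It stands for the correct answer, which must be counted without
    truncation to have mass at least 1 - \<delta>.\<close>
  define G where "G = (\<lambda>q. if q = 0 then label_partition N m K s else label_partition N m K (flip q s))"
  define f where "f = (\<lambda>q t h. q \<noteq> 0 \<longrightarrow>
    (pulls t (block N m K (q div m)) h \<le> real R \<and> pulls t {2 * q, 2 * q + 1} h \<le> real r))"
  have F0: "0 \<notin> ?F" by (simp add: flippable_def)
  have inj: "inj_on G (insert 0 ?F)"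
  proof (rule inj_onI)
    fix q q' assume *: "q \<in> insert 0 ?F" "q' \<in> insert 0 ?F" "G q = G q'"
    let ?t = "\<lambda>q. if q = 0 then s else flip q s"
    have sub: "?t q \<subseteq> ?F" if "q \<in> insert 0 ?F" for q using that s flip_Pow[of q ?F s] by auto
    have "label_partition N m K (?t q) = label_partition N m K (?t q')" using *(3) by (auto simp: G_def split: if_splits)
    then have "?t q = ?t q'" by (rule label_partition_inj[OF K N sub[OF *(1)] sub[OF *(2)]])
    then show "q = q'" by (auto simp: flip_def split: if_splits)
  qed
  have gm: "good_meas (f q)" for q
  proof (cases "q = 0")
    case True
    then show ?thesis by (simp add: f_def good_meas_def)
  next
    case False
    then show ?thesis unfolding f_def by (simp add: good_meas_conj good_meas_pulls)
  qed
  have "(\<Sum>q\<in>insert 0 ?F. stop_prob \<nu> (\<lambda>t h. out_rule S t h = G q \<and> f q t h)) \<le> 1"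
    by (rule sum_stop_prob_out_le[OF \<nu> _ inj gm]) auto
  then have "stop_prob \<nu> (\<lambda>t h. out_rule S t h = G 0 \<and> f 0 t h) +
      (\<Sum>q\<in>?F. stop_prob \<nu> (\<lambda>t h. out_rule S t h = G q \<and> f q t h)) \<le> 1"
    using F0 by simp
  moreover have "(\<lambda>t h. out_rule S t h = G 0 \<and> f 0 t h) = (\<lambda>t h. out_rule S t h = label_partition N m K s)"
    by (simp add: G_def f_def)
  moreover have "(\<Sum>q\<in>?F. stop_prob \<nu> (\<lambda>t h. out_rule S t h = G q \<and> f q t h)) =
      (\<Sum>q\<in>?F. stop_prob \<nu> (trunc_correct m R r q (flip q s)))"
  proof (rule sum.cong[OF refl])
    fix q assume "q \<in> ?F"
    then have "q \<noteq> 0" using F0 by metis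
    then have "(\<lambda>t h. out_rule S t h = G q \<and> f q t h) = trunc_correct m R r q (flip q s)"
      by (intro ext) (simp add: G_def f_def trunc_correct_def)
    then show "stop_prob \<nu> (\<lambda>t h. out_rule S t h = G q \<and> f q t h) = stop_prob \<nu> (trunc_correct m R r q (flip q s))"
      by simp
  qed
  ultimately show ?thesis using succ by simp
qed

lemma divergence_lower_bound:
  fixes T :: real and R r :: nat
  assumes \<sigma>: "\<sigma> > 0" and \<Delta>: "\<Delta> > 0" and d: "d \<ge> 1" and \<delta>: "0 < \<delta>" "\<delta> < 1 / 12"
    and m: "m = N div K" "m \<ge> 2" and K: "K \<ge> 2"
    and ne: "envs \<Delta> \<theta>0 \<sigma> N K d \<noteq> {}" and PAC: "delta_PAC \<delta> N K d (envs \<Delta> \<theta>0 \<sigma> N K d) S"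
    and budget: "\<And>\<nu>. \<nu> \<in> envs \<Delta> \<theta>0 \<sigma> N K d \<Longrightarrow> expected_budget S N \<nu> \<le> ennreal T" and T: "T \<ge> 0"
    and R: "8 * T \<le> real (Suc R) * real (K div 2)"
    and r: "8 * T \<le> real (Suc r) * real (card (flippable m K))"
    and e: "e = (\<Delta> / (2 * sqrt d))^2 / \<sigma>^2"
  shows "real (card (flippable m K)) / (4 * \<delta>) \<le> (1 + 2 * rest_weight bb e 0 (real R) 0 0 * (exp (4 * e * real r) - 1)) ^ d"
    (is "_ \<le> ?B")
proof -
  let ?F = "flippable m K" and ?P = "real (card (flippable m K))"
  let ?\<Theta> = "Pow ({..<K} \<times> {..<d})" and ?S = "Pow (flippable m K)"
  let ?hard_env = "\<lambda>s \<theta>. hard_env \<sigma> \<Delta> d m K s \<theta>"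
  let ?A = "\<lambda>q s. trunc_correct m R r q s"
  have N: "m * K \<le> N" by (simp add: m)
  have m1: "m \<ge> 1" using m by simp
  have P: "?P > 0" unfolding card_flippable[OF m1] using m K by (simp add: div_greater_zero_iff)
  \<comment> \<open>This choice makes c / 2 * \<delta> equal to P / 4, half of the lower bound P /
    2. The remainder P * B / (2 c) = \<delta> * B must cover the other half.\<close>
  define c where "c = ?P / (2 * \<delta>)"
  have c: "c > 0" using P \<delta> by (simp add: c_def)
  have E: "?hard_env s \<theta> \<in> envs \<Delta> \<theta>0 \<sigma> N K d" "true_partition N K d (?hard_env s \<theta>) = label_partition N m K s" for s \<theta>
    using hard_env_in_envs[OF \<sigma> \<Delta> d m(1) m1 K ne] by auto
  have succ: "1 - \<delta> \<le> stop_prob (?hard_env s \<theta>) (\<lambda>t h. out_rule S t h = label_partition N m K s)" for s \<theta>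
    using PAC E[of s \<theta>] success_prob_eq[of "?hard_env s \<theta>"] by (auto simp: delta_PAC_def)
  have arm: "arm_laws N d (?hard_env s \<theta>)" for s \<theta> by (rule arm_laws_env[OF \<sigma>])
  define n where "n = real (card ?S) * real (card ?\<Theta>)"
  have n: "n > 0" by (simp add: n_def card_Pow)
  have "n * (?P / 2) = (\<Sum>s\<in>?S. \<Sum>\<theta>\<in>?\<Theta>. ?P / 2)" by (simp add: n_def)
  also have "\<dots> \<le> (\<Sum>s\<in>?S. \<Sum>\<theta>\<in>?\<Theta>. \<Sum>q\<in>?F. stop_prob (?hard_env s \<theta>) (?A q s))"
    by (intro sum_mono correct_prob_sum_ge[OF arm succ \<delta>(2) budget[OF E(1)] T m1 R r])
  also have "\<dots> = (\<Sum>s\<in>?S. \<Sum>q\<in>?F. \<Sum>\<theta>\<in>?\<Theta>. stop_prob (?hard_env s \<theta>) (?A q s))"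
    by (intro sum.cong refl sum.swap)
  also have "\<dots> \<le> (\<Sum>s\<in>?S. \<Sum>q\<in>?F. c / 2 * (\<Sum>\<theta>\<in>?\<Theta>. stop_prob (?hard_env (flip q s) \<theta>) (?A q s)) + real (card ?\<Theta>) * (?B / (2 * c)))"
  proof (intro sum_mono)
    fix s q assume q: "q \<in> ?F"
    define j where "j = q div m"
    have "q div m < K div 2" using q by (simp add: flippable_def less_mult_imp_div_less mult.commute)
    then have j: "j \<in> {..<K}" by (simp add: j_def)
    note split = sum_Pow_Times_split[OF j, of _ "{..<d}"]
    have "(\<Sum>\<theta>\<in>?\<Theta>. stop_prob (?hard_env s \<theta>) (?A q s)) =
        (\<Sum>\<theta>\<in>Pow (({..<K} - {j}) \<times> {..<d}). \<Sum>\<xi>\<in>Pow {..<d}. stop_prob (?hard_env s (\<theta> \<union> {j} \<times> \<xi>)) (?A q s))"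
      by (rule split)
    also have "\<dots> \<le> (\<Sum>\<theta>\<in>Pow (({..<K} - {j}) \<times> {..<d}).
        c / 2 * (\<Sum>\<xi>\<in>Pow {..<d}. stop_prob (?hard_env (flip q s) (\<theta> \<union> {j} \<times> \<xi>)) (?A q s)) + 2 ^ d / (2 * c) * ?B)"
      unfolding j_def by (intro sum_mono hard_env_mixture_bound[OF \<sigma> c q N _ e]) auto
    also have "\<dots> = c / 2 * (\<Sum>\<theta>\<in>?\<Theta>. stop_prob (?hard_env (flip q s) \<theta>) (?A q s)) +
        (\<Sum>\<theta>\<in>Pow (({..<K} - {j}) \<times> {..<d}). \<Sum>\<xi>\<in>Pow {..<d}. ?B / (2 * c))"
      unfolding split by (simp add: sum.distrib sum_distrib_left card_Pow)
    also have "(\<Sum>\<theta>\<in>Pow (({..<K} - {j}) \<times> {..<d}). \<Sum>\<xi>\<in>Pow {..<d}. ?B / (2 * c)) = real (card ?\<Theta>) * (?B / (2 * c))"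
      unfolding split[of "\<lambda>_. ?B / (2 * c)", symmetric] by simp
    finally show "(\<Sum>\<theta>\<in>?\<Theta>. stop_prob (?hard_env s \<theta>) (?A q s)) \<le>
      c / 2 * (\<Sum>\<theta>\<in>?\<Theta>. stop_prob (?hard_env (flip q s) \<theta>) (?A q s)) + real (card ?\<Theta>) * (?B / (2 * c))" .
  qed
  also have "\<dots> = c / 2 * (\<Sum>s\<in>?S. \<Sum>q\<in>?F. \<Sum>\<theta>\<in>?\<Theta>. stop_prob (?hard_env (flip q s) \<theta>) (?A q s)) + n * (?P * (?B / (2 * c)))"
    by (simp add: sum.distrib sum_distrib_left n_def)
  also have "(\<Sum>s\<in>?S. \<Sum>q\<in>?F. \<Sum>\<theta>\<in>?\<Theta>. stop_prob (?hard_env (flip q s) \<theta>) (?A q s)) =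
      (\<Sum>q\<in>?F. \<Sum>s\<in>?S. \<Sum>\<theta>\<in>?\<Theta>. stop_prob (?hard_env (flip q s) \<theta>) (?A q s))"
    by (rule sum.swap)
  also have "\<dots> = (\<Sum>q\<in>?F. \<Sum>s\<in>?S. \<Sum>\<theta>\<in>?\<Theta>. stop_prob (?hard_env s \<theta>) (?A q (flip q s)))"
    by (intro sum.cong refl sum_flip)
  also have "\<dots> = (\<Sum>s\<in>?S. \<Sum>q\<in>?F. \<Sum>\<theta>\<in>?\<Theta>. stop_prob (?hard_env s \<theta>) (?A q (flip q s)))"
    by (rule sum.swap)
  also have "\<dots> = (\<Sum>s\<in>?S. \<Sum>\<theta>\<in>?\<Theta>. \<Sum>q\<in>?F. stop_prob (?hard_env s \<theta>) (?A q (flip q s)))"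
    by (intro sum.cong refl sum.swap)
  also have "c / 2 * \<dots> \<le> c / 2 * (\<Sum>s\<in>?S. \<Sum>\<theta>\<in>?\<Theta>. \<delta>)"
    using c by (intro mult_left_mono sum_mono flipped_prob_sum_le[OF arm succ K N]) auto
  also have "(\<Sum>s\<in>?S. \<Sum>\<theta>\<in>?\<Theta>. \<delta>) = n * \<delta>" by (simp add: n_def)
  finally have "n * (?P / 2) \<le> n * (c / 2 * \<delta> + ?P * (?B / (2 * c)))" by (simp add: algebra_simps)
  then have "?P / 2 \<le> c / 2 * \<delta> + ?P * (?B / (2 * c))" using n by simp
  also have "c / 2 * \<delta> = ?P / 4" using \<delta> by (simp add: c_def)
  also have "?P * (?B / (2 * c)) = \<delta> * ?B" using P \<delta> by (auto simp: c_def card_gt_0_iff)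
  finally have "?P / 4 \<le> \<delta> * ?B" by simp
  then show ?thesis using \<delta> by (simp add: divide_le_eq mult_ac)
qed

end

section \<open>The budget\<close>

text \<open>Applied to x = N / \<delta>: P \<ge> N / 9 gives P / (4 \<delta>) \<ge> x / 36, and N
  \<ge> 4 with \<delta> < 1 / 12 gives x \<ge> 48. The factor 1 / 20 works because 36 ^ 20 \<le> 48
  ^ 19.\<close>

lemma ln_div_36_ge:
  assumes "x \<ge> (48::real)"
  shows "ln x / 20 \<le> ln (x / 36)"
proof -
  have "20 * ln 36 = ln ((36::real) ^ 20)" by (subst ln_realpow) auto
  also have "\<dots> \<le> ln (48 ^ 19)" by (subst ln_le_cancel_iff) auto
  also have "\<dots> = 19 * ln (48::real)" by (subst ln_realpow) auto
  also have "\<dots> \<le> 19 * ln x" using assms by simp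
  finally show ?thesis using assms by (simp add: ln_div)
qed

lemma exp_minus_one_le: "0 \<le> y \<Longrightarrow> y \<le> 1 \<Longrightarrow> exp y - 1 \<le> 2 * (y::real)"
proof -
  assume y: "0 \<le> y" "y \<le> 1"
  have "exp y \<le> 1 + y + y^2" by (rule exp_bound[OF y])
  moreover have "y^2 \<le> y * 1" unfolding power2_eq_square using y by (intro mult_left_mono) auto
  ultimately show ?thesis by simp
qed

text \<open>Here \<open>a\<close> is \<sigma>^2 / \<Delta>^2. The limits being at most 8 T / J and 8
  T / P, \<open>r1\<close> yields the term N and \<open>known\<close> the logarithmic term. For e R
  \<le> 1 / 4 the exponentials in \<open>unknown\<close> can be linearised, which bounds T^2 from
  below by the product under the root.\<close>

lemma budget_arithmetic:
  fixes N K d P J R r T a \<delta> e :: real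
  assumes pos: "N > 0" "K > 0" "d > 0" "a > 0" "P \<ge> 1" "J > 0" "R \<ge> 0" "r \<ge> 0" "T \<ge> 0" "\<delta> > 0"
    and \<delta>: "\<delta> < 1 / 12" and N4: "N \<ge> 4" and P: "N \<le> 9 * P" and J: "K \<le> 3 * J" and JP: "J \<le> P"
    and R: "R \<le> 8 * T / J" and r: "r \<le> 8 * T / P" and r1: "r \<ge> 1"
    and e: "e = 1 / (4 * d * a)"
    and known: "ln (P / (4 * \<delta>)) \<le> 8 * d * e * r"
    and unknown: "ln (P / (4 * \<delta>)) \<le> d * ((exp (4 * e * R) - 1) * (exp (4 * e * r) - 1))"
    and rR: "e * R \<le> 1 / 4 \<Longrightarrow> e * r \<le> 1 / 4"
  shows "1 / 9000 * N + 1 / 9000 * a * (N * ln (N / \<delta>) + sqrt (d * K * N * ln (N / \<delta>))) \<le> T"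
proof -
  define L where "L = ln (N / \<delta>)"
  define L0 where "L0 = ln (P / (4 * \<delta>))"
  have x48: "N / \<delta> \<ge> 48"
  proof -
    have "48 * \<delta> \<le> N" using \<delta> N4 by linarith
    then show ?thesis using pos by (simp add: le_divide_eq)
  qed
  have L: "L > 0" unfolding L_def using x48 by (intro ln_gt_zero) auto
  have L0: "L / 20 \<le> L0"
  proof -
    have "L / 20 \<le> ln (N / \<delta> / 36)" unfolding L_def by (rule ln_div_36_ge[OF x48])
    also have "\<dots> \<le> L0" unfolding L0_def
    proof (rule ln_mono)
      show "N / \<delta> / 36 \<le> P / (4 * \<delta>)" using P pos by (simp add: field_simps)
    qed (use pos in auto)
    finally show ?thesis .
  qed
  have t1: "N \<le> 72 * T"
  proof -
    have "1 \<le> 8 * T / P" using r r1 by linarith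
    then have "P \<le> 8 * T" using pos by (simp add: le_divide_eq)
    then show ?thesis using P by linarith
  qed
  have t2: "a * (N * L) \<le> 2880 * T"
  proof -
    have "L0 \<le> 2 * r / a" using known pos by (simp add: e L0_def)
    also have "\<dots> \<le> 2 * (8 * T / P) / a" using r pos by (intro divide_right_mono mult_left_mono) auto
    finally have "a * P * L0 \<le> 16 * T" using pos by (simp add: field_simps)
    moreover have "a * (N / 9) * (L / 20) \<le> a * P * L0"
      using P L0 L pos by (intro mult_mono) auto
    ultimately show ?thesis by (simp add: field_simps)
  qed
  have t3: "a * sqrt (d * K * N * L) \<le> 2880 * T"
  proof (cases "e * R \<le> 1 / 4")
    case True
    have e0: "e > 0" using pos by (simp add: e)
    have 1: "exp (4 * e * R) - 1 \<le> 2 * (4 * e * R)" using True e0 pos by (intro exp_minus_one_le) auto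
    have 2: "exp (4 * e * r) - 1 \<le> 2 * (4 * e * r)" using rR[OF True] e0 pos by (intro exp_minus_one_le) auto
    have "L0 \<le> d * ((exp (4 * e * R) - 1) * (exp (4 * e * r) - 1))" unfolding L0_def by (rule unknown)
    also have "\<dots> \<le> d * ((2 * (4 * e * R)) * (2 * (4 * e * r)))"
      using 1 2 e0 pos by (intro mult_left_mono mult_mono) auto
    also have "\<dots> = 64 * d * e^2 * (R * r)" by (simp add: power2_eq_square)
    also have "\<dots> \<le> 64 * d * e^2 * ((8 * T / J) * (8 * T / P))"
      using R r pos by (intro mult_left_mono mult_mono) auto
    also have "\<dots> = 256 * T^2 / (d * a^2 * P * J)" using pos by (simp add: e field_simps power2_eq_square)
    finally have "d * a^2 * P * J * L0 \<le> 256 * T^2" using pos by (simp add: field_simps)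
    moreover have "d * a^2 * (N / 9) * (K / 3) * (L / 20) \<le> d * a^2 * P * J * L0"
      using P J L0 L pos by (intro mult_mono) auto
    ultimately have "d * a^2 * (N / 9) * (K / 3) * (L / 20) \<le> 256 * T^2" by linarith
    then have "a^2 * (d * K * N * L) \<le> 138240 * T^2" by (simp add: mult_ac)
    also have "\<dots> \<le> (2880 * T)^2" by (simp add: power_mult_distrib)
    finally have "a^2 * (d * K * N * L) \<le> (2880 * T)^2" .
    then have "sqrt (a^2 * (d * K * N * L)) \<le> 2880 * T" using pos by (intro real_le_lsqrt) auto
    then show ?thesis using pos by (simp add: real_sqrt_mult)
  next
    case False
    \<comment> \<open>Beyond the linear regime the block alone forces a T of order a d K, and the
      geometric mean of d K and N L is at most the larger of the two.\<close>
    then have "R > d * a" using pos by (simp add: e field_simps)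
    then have "d * a < 8 * T / J" using R by linarith
    then have "d * a * J < 8 * T" using pos by (simp add: less_divide_eq)
    moreover have "d * a * (K / 3) \<le> d * a * J" using J pos by (intro mult_left_mono) auto
    ultimately have daK: "a * (d * K) \<le> 24 * T" by (simp add: algebra_simps)
    have "sqrt (d * K * N * L) \<le> max (d * K) (N * L)"
    proof (rule real_le_lsqrt)
      have "(d * K) * (N * L) \<le> max (d * K) (N * L) * max (d * K) (N * L)"
        using pos L by (intro mult_mono) (auto simp: le_max_iff_disj)
      then show "d * K * N * L \<le> (max (d * K) (N * L))^2" by (simp add: power2_eq_square mult_ac)
    qed (use pos L in \<open>auto simp: max_def\<close>)
    then have "a * sqrt (d * K * N * L) \<le> a * max (d * K) (N * L)" using pos by (intro mult_left_mono) auto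
    also have "\<dots> \<le> 2880 * T" using daK t2 pos by (auto simp: max_def)
    finally show ?thesis .
  qed
  \<comment> \<open>The three constants add up to 72 + 2880 + 2880 = 5832, which is below
    9000.\<close>
  show ?thesis using t1 t2 t3 pos unfolding L_def[symmetric] by (simp add: distrib_left)
qed

context table_run
begin

lemma budget_lower_bound:
  assumes \<sigma>: "\<sigma> > 0" and \<Delta>: "\<Delta> > 0" and d: "d \<ge> 1" and \<delta>: "0 < \<delta>" "\<delta> < 1 / 12"
    and NK: "N \<ge> 2 * K" and K: "K \<ge> 2"
    and ne: "envs \<Delta> \<theta>0 \<sigma> N K d \<noteq> {}" and PAC: "delta_PAC \<delta> N K d (envs \<Delta> \<theta>0 \<sigma> N K d) S"
    and budget: "\<And>\<nu>. \<nu> \<in> envs \<Delta> \<theta>0 \<sigma> N K d \<Longrightarrow> expected_budget S N \<nu> \<le> ennreal T" and T: "T \<ge> 0"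
  shows "1 / 9000 * real N + 1 / 9000 * (\<sigma>^2 / \<Delta>^2) * (real N * ln (real N / \<delta>) +
    sqrt (real d * real K * real N * ln (real N / \<delta>))) \<le> T"
proof -
  define m where "m = N div K"
  define P where "P = card (flippable m K)"
  define J where "J = K div 2"
  \<comment> \<open>With the floor, \<open>R\<close> stays below the Markov threshold while
    \<open>Suc R\<close> reaches it. The same holds for \<open>r\<close>.\<close>
  define R where "R = nat \<lfloor>8 * T / real J\<rfloor>"
  define r where "r = nat \<lfloor>8 * T / real P\<rfloor>"
  define e where "e = (\<Delta> / (2 * sqrt d))^2 / \<sigma>^2"
  have m: "m \<ge> 2" using NK K by (simp add: m_def less_eq_div_iff_mult_less_eq)
  have J: "J \<ge> 1" "K \<le> 3 * J" using K by (auto simp: J_def)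
  have P: "P = (m - 1) * J" using card_flippable[of m K] m
    unfolding P_def J_def by (metis le_trans of_nat_eq_iff of_nat_mult one_le_numeral)
  have P1: "P \<ge> 1" "J \<le> P" using m J by (auto simp: P)
  have NP: "N \<le> 9 * P"
  proof -
    \<comment> \<open>The constant 9 combines m + 1 \<le> 3 (m - 1), valid for m \<ge> 2, with K
      \<le> 3 * J.\<close>
    have "N < (m + 1) * K" using K dividend_less_div_times[of K N] by (simp add: m_def)
    also have "\<dots> \<le> (3 * (m - 1)) * (3 * J)" using m J by (intro mult_le_mono) auto
    finally show ?thesis by (simp add: P)
  qed
  have Rb: "real R \<le> 8 * T / real J" "8 * T \<le> real (Suc R) * real J"
  proof -
    show "real R \<le> 8 * T / real J" unfolding R_def using T by simp
    have "8 * T / real J \<le> real (Suc R)" unfolding R_def using T by linarith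
    then show "8 * T \<le> real (Suc R) * real J" using J by (simp add: divide_le_eq)
  qed
  have rb: "real r \<le> 8 * T / real P" "8 * T \<le> real (Suc r) * real P"
  proof -
    show "real r \<le> 8 * T / real P" unfolding r_def using T by simp
    have "8 * T / real P \<le> real (Suc r)" unfolding r_def using T by linarith
    then show "8 * T \<le> real (Suc r) * real P" using P1 by (simp add: divide_le_eq)
  qed
  have rR: "r \<le> R" unfolding r_def R_def using P1 J T
    by (intro nat_mono floor_mono divide_left_mono) auto
  have bound: "real P / (4 * \<delta>) \<le> (1 + 2 * rest_weight bb e 0 (real R) 0 0 * (exp (4 * e * real r) - 1)) ^ d" for bb
    unfolding P_def
    by (rule divergence_lower_bound[OF \<sigma> \<Delta> d \<delta> m_def m K ne PAC budget T _ _ e_def])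
      (use Rb(2) rb(2) in \<open>simp_all add: P_def J_def\<close>)
  have e0: "e \<ge> 0" by (simp add: e_def)
  have P\<delta>: "real P / (4 * \<delta>) > 1"
  proof -
    have "4 * \<delta> < real P" using P1 \<delta> by linarith
    then show ?thesis using \<delta> by (simp add: less_divide_eq)
  qed
  have known: "real P / (4 * \<delta>) \<le> exp (8 * real d * e * real r)"
  proof -
    let ?y = "exp (4 * e * real r)"
    have "1 + 2 * rest_weight False e 0 (real R) 0 0 * (?y - 1) = 2 * ?y - 1" by (simp add: rest_weight_def)
    \<comment> \<open>For \<open>False\<close> the initial weight is 1, and 2 y - 1 \<le> y^2 turns
      the d-th power into a pure exponential.\<close>
    also have "\<dots> \<le> ?y^2" using zero_le_power2[of "?y - 1"] by (simp add: power2_eq_square algebra_simps)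
    finally have "(1 + 2 * rest_weight False e 0 (real R) 0 0 * (?y - 1)) ^ d \<le> (?y^2) ^ d"
    proof (rule power_mono)
      show "0 \<le> 1 + 2 * rest_weight False e 0 (real R) 0 0 * (?y - 1)"
        using e0 by (intro add_nonneg_nonneg mult_nonneg_nonneg) (auto simp: rest_weight_def)
    qed
    also have "\<dots> = exp (8 * real d * e * real r)"
      by (simp add: exp_of_nat_mult[symmetric] power_mult[symmetric] mult_ac)
    finally show ?thesis using bound[of False] by linarith
  qed
  have unknown: "real P / (4 * \<delta>) \<le> exp (real d * ((exp (4 * e * real R) - 1) * (exp (4 * e * real r) - 1)))"
  proof -
    let ?z = "(exp (4 * e * real R) - 1) * (exp (4 * e * real r) - 1)"
    have z: "0 \<le> ?z" using e0 by (intro mult_nonneg_nonneg) auto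
    have "1 + 2 * rest_weight True e 0 (real R) 0 0 * (exp (4 * e * real r) - 1) = 1 + ?z"
      by (simp add: rest_weight_def cosh_gap_def field_simps)
    then have "(1 + 2 * rest_weight True e 0 (real R) 0 0 * (exp (4 * e * real r) - 1)) ^ d \<le> (exp ?z) ^ d"
      using z by (auto intro!: power_mono)
    also have "\<dots> = exp (real d * ?z)" by (simp add: exp_of_nat_mult)
    finally show ?thesis using bound[of True] by linarith
  qed
  \<comment> \<open>With limit 0 on the pair the data carry no information about its swap, and
    \<open>known\<close> would read P / (4 \<delta>) \<le> 1.\<close>
  have r1: "r \<ge> 1"
  proof (rule ccontr)
    assume "\<not> r \<ge> 1"
    then have "r = 0" by simp
    then show False using known P\<delta> by simp
  qed
  have e_eq: "e = 1 / (4 * real d * (\<sigma>^2 / \<Delta>^2))"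
    using d \<sigma> \<Delta> by (simp add: e_def power_divide power_mult_distrib)
  show ?thesis
  proof (rule budget_arithmetic[where P = "real P" and J = "real J" and R = "real R" and r = "real r" and e = e])
    show "e = 1 / (4 * real d * (\<sigma>^2 / \<Delta>^2))" by (rule e_eq)
    have lnmono: "ln (real P / (4 * \<delta>)) \<le> x" if "real P / (4 * \<delta>) \<le> exp x" for x
      using that P\<delta> by (metis exp_gt_zero less_trans ln_exp ln_mono zero_less_one)
    show "ln (real P / (4 * \<delta>)) \<le> 8 * real d * e * real r" by (rule lnmono[OF known])
    show "ln (real P / (4 * \<delta>)) \<le> real d * ((exp (4 * e * real R) - 1) * (exp (4 * e * real r) - 1))"
      by (rule lnmono[OF unknown])
    show "e * real r \<le> 1 / 4" if "e * real R \<le> 1 / 4"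
      using that mult_left_mono[of "real r" "real R" e] rR e0 by simp
    show "real N \<le> 9 * real P" using NP by (metis of_nat_le_iff of_nat_mult of_nat_numeral)
    show "real K \<le> 3 * real J" using J(2) by (metis of_nat_le_iff of_nat_mult of_nat_numeral)
    show "real N \<ge> 4" "real N > 0" using NK K by linarith+
  qed (use K d \<sigma> \<Delta> P1 J T \<delta> Rb(1) rb(1) r1 in auto)
qed

end

theorem theorem1:
  shows "\<exists>c::real > 0. \<forall>(\<sigma>::real) (\<Delta>::real) (\<theta>::real) (\<delta>::real) (d::nat) (N::nat) (K::nat).
     \<sigma> > 0 \<longrightarrow> \<Delta> > 0 \<longrightarrow> d \<ge> 1 \<longrightarrow> \<theta> > 0 \<longrightarrow> 0 < \<delta> \<longrightarrow> \<delta> < 1/12 \<longrightarrow>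
     N \<ge> 2 * K \<longrightarrow> 2 * K \<ge> 4 \<longrightarrow> envs \<Delta> \<theta> \<sigma> N K d \<noteq> {} \<longrightarrow>
     T_star \<delta> N K d (envs \<Delta> \<theta> \<sigma> N K d) \<ge>
       ennreal (c * real N + c * (\<sigma>^2 / \<Delta>^2) *
         (real N * ln (real N / \<delta>) + sqrt (real d * real K * real N * ln (real N / \<delta>))))"
proof (intro exI[of _ "1 / 9000"] conjI allI impI)
  fix \<sigma> \<Delta> \<theta> \<delta> :: real and d N K :: nat
  assume \<sigma>: "\<sigma> > 0" and \<Delta>: "\<Delta> > 0" and d: "d \<ge> 1" and \<delta>: "0 < \<delta>" "\<delta> < 1 / 12"
    and NK: "N \<ge> 2 * K" and K: "2 * K \<ge> 4" and ne: "envs \<Delta> \<theta> \<sigma> N K d \<noteq> {}"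
  let ?E = "envs \<Delta> \<theta> \<sigma> N K d"
  let ?b = "1 / 9000 * real N + 1 / 9000 * (\<sigma>^2 / \<Delta>^2) *
         (real N * ln (real N / \<delta>) + sqrt (real d * real K * real N * ln (real N / \<delta>)))"
  show "ennreal ?b \<le> T_star \<delta> N K d ?E"
    unfolding T_star_def
  proof (rule INF_greatest)
    fix S assume "S \<in> {S. delta_PAC \<delta> N K d ?E S}"
    then have PAC: "delta_PAC \<delta> N K d ?E S" by simp
    then interpret table_run S N K d by unfold_locales (simp add: delta_PAC_def)
    show "ennreal ?b \<le> (SUP \<nu>\<in>?E. expected_budget S N \<nu>)"
    \<comment> \<open>An infinite worst-case budget satisfies every lower bound; otherwise the
      supremum itself serves as T.\<close>
    proof (cases "(SUP \<nu>\<in>?E. expected_budget S N \<nu>)")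
      case (real T)
      have "?b \<le> T"
      proof (rule budget_lower_bound[OF \<sigma> \<Delta> d \<delta> NK _ ne PAC])
        show "expected_budget S N \<nu> \<le> ennreal T" if "\<nu> \<in> ?E" for \<nu>
          using SUP_upper[OF that, of "expected_budget S N"] real by simp
      qed (use K real in auto)
      then show ?thesis using real by (simp add: ennreal_leI)
    next
      case top
      then show ?thesis by (simp only: top_greatest)
    qed
  qed
qed simp

end
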